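(* Let $N\ge3$, $R>0$, and let $B_R\subset\mathbb{R}^N$ be the open ball of radius $R$ centered at the origin. Let $v$ be a radial function on $B_R$ and set $$v(|x|)=w(t),\qquad t=\left(-\log\frac{|x|}{R}\right)^{-\frac1{N-2}},$$ where $w$ is regarded as a radial function on $\mathbb{R}^N$ with radial variable $t$. Then $v\in W_{0,r}^{1,2}(|x|^{-(N-2)},B_R)$ if and only if $w\in D_r^{1,2}(\mathbb{R}^N)$, and $$\|v\|^2_{W_{0,r}^{1,2}(|x|^{-(N-2)},B_R)}=(N-2)^{-1}\,\|w\|^2_{D_r^{1,2}(\mathbb{R}^N)}.$$
   Context: $W_0^{1,2}(|x|^{-(N-2)},B_R)$ is the completion of $C_0^\infty(B_R)$ under the norm $\|v\|^2=\int_{B_R}|x|^{-(N-2)}|\nabla v|^2dx$, and $W_{0,r}^{1,2}(|x|^{-(N-2)},B_R)$ is its subspace of radial functions. $D^{1,2}(\mathbb{R}^N)$ is the closure of $C_0^\infty(\mathbb{R}^N)$ under the norm $\|\phi\|^2=\int_{\mathbb{R}^N}|\nabla\phi|^2dx$, and $D_r^{1,2}(\mathbb{R}^N)$ is its subspace of radial functions. *)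

theory Defs
  imports "HOL-Analysis.Analysis"
begin

definition grad :: "('a::euclidean_space \<Rightarrow> real) \<Rightarrow> 'a \<Rightarrow> 'a" where
  "grad f x = (THE D. GDERIV f x :> D)"

lemma grad_eq:
  fixes f :: "'a::euclidean_space \<Rightarrow> real"
  assumes "GDERIV f x :> D"
  shows "grad f x = D"
  unfolding grad_def
proof (rule the_equality[where P = "\<lambda>D. GDERIV f x :> D", OF assms])
  fix D' assume "GDERIV f x :> D'"
  then have "(\<lambda>h. inner h D') = (\<lambda>h. inner h D)"
    using assms unfolding gderiv_def by (rule has_derivative_unique)
  then show "D' = D"
    by (metis inner_commute vector_eq_rdot)
qed

lemma GDERIV_grad:
  fixes f :: "'a::euclidean_space \<Rightarrow> real"
  assumes "f differentiable (at x)"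
  shows "GDERIV f x :> grad f x"
proof -
  obtain f' where f': "(f has_derivative f') (at x)"
    using assms by (auto simp: differentiable_def)
  then interpret bounded_linear f' by (rule has_derivative_bounded_linear)
  have "f' h = inner h (\<Sum>i\<in>Basis. f' i *\<^sub>R i)" for h
  proof -
    have "f' h = f' (\<Sum>i\<in>Basis. inner h i *\<^sub>R i)" by (simp add: euclidean_representation)
    also have "\<dots> = (\<Sum>i\<in>Basis. inner h i * f' i)" by (simp add: sum scaleR)
    also have "\<dots> = inner h (\<Sum>i\<in>Basis. f' i *\<^sub>R i)"
      by (simp add: inner_sum_right mult.commute)
    finally show ?thesis .
  qed
  then have "f' = (\<lambda>h. inner h (\<Sum>i\<in>Basis. f' i *\<^sub>R i))" by blast
  with f' have "GDERIV f x :> (\<Sum>i\<in>Basis. f' i *\<^sub>R i)"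
    unfolding gderiv_def by simp
  then show ?thesis by (simp add: grad_eq)
qed

primrec C_k :: "nat \<Rightarrow> ('a::euclidean_space \<Rightarrow> real) \<Rightarrow> bool" where
  "C_k 0 f \<longleftrightarrow> continuous_on UNIV f"
| "C_k (Suc k) f \<longleftrightarrow>
     (\<forall>x. f differentiable (at x)) \<and> (\<forall>i\<in>Basis. C_k k (\<lambda>x. inner (grad f x) i))"

text \<open>Elements of \<open>C\<^sub>0\<^sup>\<infinity>(\<Omega>)\<close> are taken extended by zero to the whole space.\<close>

definition test_functions :: "'a::euclidean_space set \<Rightarrow> ('a \<Rightarrow> real) set" where
  "test_functions \<Omega> =
     {\<phi>. (\<forall>k. C_k k \<phi>) \<and> compact (closure {x. \<phi> x \<noteq> 0}) \<and> closure {x. \<phi> x \<noteq> 0} \<subseteq> \<Omega>}"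

definition energy_norm ::
    "('a::euclidean_space \<Rightarrow> real) \<Rightarrow> 'a set \<Rightarrow> ('a \<Rightarrow> real) \<Rightarrow> real" where
  "energy_norm \<rho> \<Omega> \<phi> = sqrt (LINT x:\<Omega>|lebesgue. \<rho> x * (norm (grad \<phi> x))\<^sup>2)"

definition locally_integrable_on :: "('a::euclidean_space \<Rightarrow> real) \<Rightarrow> 'a set \<Rightarrow> bool" where
  "locally_integrable_on u \<Omega> \<longleftrightarrow>
     (\<forall>K. compact K \<and> K \<subseteq> \<Omega> \<longrightarrow> set_integrable lebesgue K u)"

text \<open>The completion of \<open>C\<^sub>0\<^sup>\<infinity>(\<Omega>)\<close> under the norm \<open>energy_norm \<rho> \<Omega>\<close> is realised as a
  space of functions in the usual way: the class of a Cauchy sequence is identified with the limit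
  of the sequence in \<open>L\<^sup>1\<^sub>l\<^sub>o\<^sub>c(\<Omega>)\<close>. For the two weights used below this identification is
  well defined and injective by the Poincare and Sobolev inequalities and closability of the
  gradient. Functions stand for their classes modulo null sets, and their values outside \<open>\<Omega>\<close>
  are irrelevant.\<close>

definition represents ::
    "('a::euclidean_space \<Rightarrow> real) \<Rightarrow> 'a set \<Rightarrow> (nat \<Rightarrow> 'a \<Rightarrow> real) \<Rightarrow> ('a \<Rightarrow> real) \<Rightarrow> bool" where
  "represents \<rho> \<Omega> \<phi> u \<longleftrightarrow>
     (\<forall>n. \<phi> n \<in> test_functions \<Omega>) \<and>
     (\<forall>e>0. \<exists>M. \<forall>m\<ge>M. \<forall>n\<ge>M. energy_norm \<rho> \<Omega> (\<lambda>x. \<phi> m x - \<phi> n x) < e) \<and>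
     locally_integrable_on u \<Omega> \<and>
     (\<forall>K. compact K \<and> K \<subseteq> \<Omega> \<longrightarrow> (\<lambda>n. LINT x:K|lebesgue. \<bar>\<phi> n x - u x\<bar>) \<longlonglongrightarrow> 0)"

definition completion_space ::
    "('a::euclidean_space \<Rightarrow> real) \<Rightarrow> 'a set \<Rightarrow> ('a \<Rightarrow> real) set" where
  "completion_space \<rho> \<Omega> = {u. \<exists>\<phi>. represents \<rho> \<Omega> \<phi> u}"

text \<open>The norm of the completion is the limit of the norms along a representing Cauchy sequence;
  it is only meaningful on \<open>completion_space \<rho> \<Omega>\<close>.\<close>

definition completion_norm ::
    "('a::euclidean_space \<Rightarrow> real) \<Rightarrow> 'a set \<Rightarrow> ('a \<Rightarrow> real) \<Rightarrow> real" where
  "completion_norm \<rho> \<Omega> u =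
     (THE l. \<exists>\<phi>. represents \<rho> \<Omega> \<phi> u \<and> (\<lambda>n. energy_norm \<rho> \<Omega> (\<phi> n)) \<longlonglongrightarrow> l)"

definition radial_on :: "'a::euclidean_space set \<Rightarrow> ('a \<Rightarrow> real) \<Rightarrow> bool" where
  "radial_on S u \<longleftrightarrow> (\<forall>x\<in>S. \<forall>y\<in>S. norm x = norm y \<longrightarrow> u x = u y)"

definition singular_weight :: "'a::euclidean_space \<Rightarrow> real" where
  "singular_weight x = norm x powr (- (real DIM('a) - 2))"

definition W0 :: "real \<Rightarrow> ('a::euclidean_space \<Rightarrow> real) set" where
  "W0 R = completion_space singular_weight (ball 0 R)"

definition W0_norm :: "real \<Rightarrow> ('a::euclidean_space \<Rightarrow> real) \<Rightarrow> real" where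
  "W0_norm R = completion_norm singular_weight (ball 0 R)"

definition W0_rad :: "real \<Rightarrow> ('a::euclidean_space \<Rightarrow> real) set" where
  "W0_rad R = {u \<in> W0 R. radial_on (ball 0 R) u}"

definition D12 :: "('a::euclidean_space \<Rightarrow> real) set" where
  "D12 = completion_space (\<lambda>_. 1) UNIV"

definition D12_norm :: "('a::euclidean_space \<Rightarrow> real) \<Rightarrow> real" where
  "D12_norm = completion_norm (\<lambda>_. 1) UNIV"

definition D12_rad :: "('a::euclidean_space \<Rightarrow> real) set" where
  "D12_rad = {u \<in> D12. radial_on UNIV u}"

end

theory Submission
  imports Defs
begin

text \<open>Both spaces have the same one-dimensional description: a radial \<open>u(x) = U(|x|)\<close> lies in the
  completion iff \<open>U(r)\<close> is, for almost every \<open>r\<close>, the limit of \<open>- \<integral>\<^sub>r\<^sup>T g\<^sub>n\<close> for continuous \<open>g\<^sub>n\<close> with compact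
  support in \<open>(0, T)\<close> that are Cauchy in \<open>L\<^sup>2(p)\<close>, where \<open>p(s) = s\<close>, \<open>T = R\<close> for the ball and \<open>p(s) = s\<^bsup>N-1\<^esup>\<close>,
  \<open>T = \<infinity>\<close> for the whole space; the squared norm is the area of the unit sphere times
  \<open>lim \<integral> p g\<^sub>n\<^sup>2\<close>. Necessity follows by taking spherical means of an approximating sequence, whose
  radial derivatives have no larger energy by Jensen's inequality. Sufficiency follows by replacing \<open>g\<^sub>n\<close>
  by \<open>2 s \<gamma>(s\<^sup>2)\<close> with \<open>\<gamma>\<close> a polynomial times a smooth bump, so that the primitive is a smooth
  function of \<open>|x|\<^sup>2\<close>, and from the pointwise bound of the primitive by Cauchy-Schwarz. The norm does
  not depend on the representing sequence since the weighted gradient is closable. Finally the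
  substitution \<open>r = R exp(-t\<^bsup>-(N-2)\<^esup>)\<close> carries \<open>\<integral> r g\<^sup>2 dr\<close> into \<open>(N-2)\<^sup>-\<^sup>1 \<integral> t\<^bsup>N-1\<^esup> h\<^sup>2 dt\<close>.\<close>

section \<open>Polar coordinates\<close>

text \<open>The exponent \<open>-1/(N-2)\<close> comes from equating two radial fundamental
  solutions: \<open>ln (R/r)\<close> for the weight on the ball and a multiple of \<open>t\<close>
  to the power \<open>-(N-2)\<close> on the whole space. They are also the functions
  \<open>q\<close> that bound a profile at a given radius by its energy, so one one-dimensional
  argument serves both spaces. In the new variable \<open>dr/r = (N-2) dt/t^(N-1)\<close>, which is
  where the factor \<open>N-2\<close> arises; the area of the unit sphere occurs in both norms and
  cancels. The main obstacle is that membership only gives some sequence of test functions, not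
  radial and convergent merely in L1 on compact sets. Its spherical means have derivatives that need
  not vanish near the origin. Therefore the derivative, not the function, is cut off there: no
  derivative of the cutoff appears, and the primitive at a fixed positive radius is eventually
  unchanged. Conversely, derivatives supported away from the origin make the primitive constant,
  hence smooth, near it. Values at the origin, a null set, are never compared.\<close>

lemma nn_integral_lborel_scale:
  fixes f :: "'a::euclidean_space \<Rightarrow> ennreal"
  assumes [measurable]: "f \<in> borel_measurable borel" and "c > 0"
  shows "(\<integral>\<^sup>+x. f x \<partial>lborel) = ennreal (c ^ DIM('a)) * (\<integral>\<^sup>+x. f (c *\<^sub>R x) \<partial>lborel)"
proof -
  have "(\<integral>\<^sup>+x. f x \<partial>lborel) =
      (\<integral>\<^sup>+x. f x \<partial>(density (distr lborel borel (\<lambda>x. 0 + c *\<^sub>R x)) (\<lambda>_. ennreal (\<bar>c\<bar> ^ DIM('a)))))"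
    using assms by (subst lborel_affine[of c "0::'a"]) auto
  also have "\<dots> = ennreal (c ^ DIM('a)) * (\<integral>\<^sup>+x. f (c *\<^sub>R x) \<partial>lborel)"
    using assms(2) by (simp add: nn_integral_density nn_integral_distr nn_integral_cmult)
  finally show ?thesis .
qed

text \<open>With \<open>a = norm y\<close> and \<open>N = DIM('a)\<close> this integral cancels the
  factor \<open>norm y ^ N\<close> that is left over in the polar formula below.\<close>

lemma nn_integral_power_tail:
  fixes a :: real
  assumes "a > 0" "N > 0"
  shows "(\<integral>\<^sup>+s. ennreal (real N / s ^ (N + 1)) * indicator {a..} s \<partial>lborel) = ennreal (1 / a ^ N)"
proof -
  have "((\<lambda>s::real. - (1 / s ^ N)) \<longlongrightarrow> - 0) at_top"
    using \<open>N > 0\<close> by (intro tendsto_minus tendsto_divide_0[OF tendsto_const] 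
        filterlim_at_top_imp_at_infinity filterlim_pow_at_top filterlim_ident)
  moreover have "DERIV (\<lambda>s::real. - (1 / s ^ N)) s :> real N / s ^ (N + 1)" if "a \<le> s" for s
  proof -
    from that assms have "s > 0" by auto
    have "s ^ N = s ^ (N - Suc 0) * s"
      using \<open>N > 0\<close> by (metis Suc_pred' power_Suc2 One_nat_def)
    then show ?thesis
      using \<open>s > 0\<close> by (auto intro!: derivative_eq_intros simp: field_simps)
  qed
  ultimately show ?thesis
    using assms by (subst nn_integral_FTC_atLeast) auto
qed

lemma measurable_sgn_compose [measurable (raw)]:
  fixes f :: "_ \<Rightarrow> 'a::euclidean_space"
  assumes "f \<in> borel_measurable M"
  shows "(\<lambda>x. sgn (f x)) \<in> borel_measurable M"
  using measurable_compose[OF assms borel_measurable_sgn] .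

text \<open>Averaging \<open>f (r *\<^sub>R sgn x)\<close> over the unit ball replaces integration
  over the sphere. Tonelli allows two scalings: for fixed \<open>x\<close>,
  \<open>r = norm x * s\<close> turns \<open>r *\<^sub>R sgn x\<close> into
  \<open>s *\<^sub>R x\<close>; for fixed \<open>s\<close>, \<open>y = s *\<^sub>R x\<close> turns
  \<open>norm x \<le> 1\<close> into \<open>norm y \<le> s\<close>. What remains is
  \<open>f y\<close> times an integral over \<open>s \<ge> norm y\<close> that equals 1.\<close>

lemma nn_integral_polar_cball:
  fixes f :: "'a::euclidean_space \<Rightarrow> ennreal"
  assumes [measurable]: "f \<in> borel_measurable borel"
  shows "(\<integral>\<^sup>+x. f x \<partial>lborel) =
    (\<integral>\<^sup>+r. ennreal (real DIM('a) * r ^ (DIM('a) - 1)) * indicator {0<..} r *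
       (\<integral>\<^sup>+x. indicator (cball 0 1) x * f (r *\<^sub>R sgn x) \<partial>lborel) \<partial>lborel)"
proof -
  let ?N = "DIM('a)"
  define B where "B = cball (0::'a) 1"
  have [measurable]: "B \<in> sets borel"
    by (simp add: B_def)
  have B: "x \<in> B \<longleftrightarrow> norm x \<le> 1" for x
    by (auto simp: B_def)
  have dim: "?N > 0" by simp
  have N1: "a ^ ?N = a * a ^ (?N - 1)" for a :: real
    using dim by (metis Suc_pred' power_Suc One_nat_def)
  have AE0: "AE x in lborel. x \<noteq> (0::'a)" by (rule AE_lborel_singleton)
  have "(\<integral>\<^sup>+r. ennreal (real ?N * r ^ (?N - 1)) * indicator {0<..} r *
       (\<integral>\<^sup>+x. indicator B x * f (r *\<^sub>R sgn x) \<partial>lborel) \<partial>lborel) =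
     (\<integral>\<^sup>+r. (\<integral>\<^sup>+x. ennreal (real ?N * r ^ (?N - 1)) * indicator {0<..} r *
       (indicator B x * f (r *\<^sub>R sgn x)) \<partial>(lborel :: 'a measure)) \<partial>lborel)"
    by (intro nn_integral_cong nn_integral_cmult[symmetric]) measurable
  also have "\<dots> = (\<integral>\<^sup>+x. (\<integral>\<^sup>+r. ennreal (real ?N * r ^ (?N - 1)) * indicator {0<..} r *
       (indicator B x * f (r *\<^sub>R sgn x)) \<partial>lborel) \<partial>(lborel :: 'a measure))"
    by (rule lborel_pair.Fubini') measurable
  also have "\<dots> = (\<integral>\<^sup>+x. (\<integral>\<^sup>+s. ennreal (real ?N * s ^ (?N - 1)) * indicator {0<..} s *
       (indicator B x * (ennreal (norm x ^ ?N) * f (s *\<^sub>R x))) \<partial>lborel) \<partial>(lborel :: 'a measure))"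
  proof (rule nn_integral_cong_AE, use AE0 in eventually_elim)
    fix x :: 'a assume "x \<noteq> 0"
    show "(\<integral>\<^sup>+r. ennreal (real ?N * r ^ (?N - 1)) * indicator {0<..} r *
       (indicator B x * f (r *\<^sub>R sgn x)) \<partial>lborel) =
      (\<integral>\<^sup>+s. ennreal (real ?N * s ^ (?N - 1)) * indicator {0<..} s *
       (indicator B x * (ennreal (norm x ^ ?N) * f (s *\<^sub>R x))) \<partial>lborel)"
      apply (subst nn_integral_lborel_scale[where c = "norm x"])
        apply (measurable; fail)
       apply (simp add: \<open>x \<noteq> 0\<close>)
      apply (subst nn_integral_cmult[symmetric])
       apply (measurable; fail)
      apply (intro nn_integral_cong)
      subgoal for s
      proof (cases "s > 0")
        case True
        have "ennreal (norm x) * ennreal (real ?N * (norm x * s) ^ (?N - 1)) =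
              ennreal (real ?N * s ^ (?N - 1)) * ennreal (norm x ^ ?N)"
          using True by (simp add: ennreal_mult'[symmetric] power_mult_distrib N1 mult_ac)
        then have "ennreal (norm x) * (ennreal (real ?N * (norm x * s) ^ (?N - 1)) * F) =
              ennreal (real ?N * s ^ (?N - 1)) * (ennreal (norm x ^ ?N) * F)" for F
          by (metis mult.assoc)
        moreover have "(norm x * s) *\<^sub>R sgn x = s *\<^sub>R x"
          using \<open>x \<noteq> 0\<close> by (simp add: sgn_div_norm)
        ultimately show ?thesis
          using \<open>x \<noteq> 0\<close> True by (simp add: indicator_def)
      next
        case False
        then show ?thesis
          using \<open>x \<noteq> 0\<close> by (simp add: indicator_def zero_less_mult_iff)
      qed
      done
  qed
  also have "\<dots> = (\<integral>\<^sup>+s. (\<integral>\<^sup>+x. ennreal (real ?N * s ^ (?N - 1)) * indicator {0<..} s *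
       (indicator B x * (ennreal (norm x ^ ?N) * f (s *\<^sub>R x))) \<partial>(lborel :: 'a measure)) \<partial>lborel)"
    by (rule lborel_pair.Fubini'[symmetric]) measurable
  also have "\<dots> = (\<integral>\<^sup>+s. (\<integral>\<^sup>+y. ennreal (real ?N / s ^ (?N + 1)) * (if norm y \<le> s then 1 else 0) *
       indicator {0<..} s * (ennreal (norm y ^ ?N) * f y) \<partial>(lborel :: 'a measure)) \<partial>lborel)"
  proof (rule nn_integral_cong)
    fix s :: real
    show "(\<integral>\<^sup>+x. ennreal (real ?N * s ^ (?N - 1)) * indicator {0<..} s *
       (indicator B x * (ennreal (norm x ^ ?N) * f (s *\<^sub>R x))) \<partial>(lborel :: 'a measure)) =
      (\<integral>\<^sup>+y. ennreal (real ?N / s ^ (?N + 1)) * (if norm y \<le> s then 1 else 0) *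
       indicator {0<..} s * (ennreal (norm y ^ ?N) * f y) \<partial>(lborel :: 'a measure))"
    proof (cases "s > 0")
      case True
      have *: "s ^ ?N * (real ?N / s ^ (?N + 1)) * (s * norm x) ^ ?N =
               real ?N * s ^ (?N - 1) * norm x ^ ?N" for x :: 'a
        using True by (simp add: power_mult_distrib N1 field_simps)
      show ?thesis
        apply (subst (2) nn_integral_lborel_scale[where c = s])
          apply (measurable; fail)
         apply (rule True)
        apply (subst nn_integral_cmult[symmetric])
         apply (measurable; fail)
        apply (intro nn_integral_cong)
        subgoal for x
        proof -
          have "ennreal (s ^ ?N) * (ennreal (real ?N / s ^ (?N + 1)) * ennreal ((s * norm x) ^ ?N)) =
               ennreal (real ?N * s ^ (?N - 1)) * ennreal (norm x ^ ?N)"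
            using True *[of x]
            by (simp add: ennreal_mult'[symmetric] mult.assoc del: power_Suc)
          then have "ennreal (s ^ ?N) * (ennreal (real ?N / s ^ (?N + 1)) * (ennreal ((s * norm x) ^ ?N) * F)) =
               ennreal (real ?N * s ^ (?N - 1)) * (ennreal (norm x ^ ?N) * F)" for F
            by (metis mult.assoc)
          then show ?thesis
            using True by (simp add: indicator_def B)
        qed
        done
    qed simp
  qed
  also have "\<dots> = (\<integral>\<^sup>+y. (\<integral>\<^sup>+s. ennreal (real ?N / s ^ (?N + 1)) * (if norm y \<le> s then 1 else 0) *
       indicator {0<..} s * (ennreal (norm y ^ ?N) * f y) \<partial>lborel) \<partial>(lborel :: 'a measure))"
    by (rule lborel_pair.Fubini') measurable
  also have "\<dots> = (\<integral>\<^sup>+y. f y \<partial>lborel)"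
  proof (rule nn_integral_cong_AE, use AE0 in eventually_elim)
    fix y :: 'a assume y: "y \<noteq> 0"
    have "(\<integral>\<^sup>+s. ennreal (real ?N / s ^ (?N + 1)) * (if norm y \<le> s then 1 else 0) *
       indicator {0<..} s * (ennreal (norm y ^ ?N) * f y) \<partial>lborel) =
      (\<integral>\<^sup>+s. ennreal (real ?N / s ^ (?N + 1)) * (if norm y \<le> s then 1 else 0) \<partial>lborel) * (ennreal (norm y ^ ?N) * f y)"
      apply (subst nn_integral_multc[symmetric])
       apply (measurable; fail)
      using y zero_less_norm_iff[of y]
      by (intro nn_integral_cong) (auto simp: indicator_def simp del: zero_less_norm_iff)
    also have "\<dots> = f y"
      using y nn_integral_power_tail[of "norm y" ?N]
      by (auto simp: ennreal_mult'[symmetric] mult.assoc[symmetric] indicator_def of_bool_def)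
    finally show "(\<integral>\<^sup>+s. ennreal (real ?N / s ^ (?N + 1)) * (if norm y \<le> s then 1 else 0) *
       indicator {0<..} s * (ennreal (norm y ^ ?N) * f y) \<partial>lborel) = f y" .
  qed
  finally show ?thesis by (simp add: B_def)
qed

text \<open>Integrals over the unit sphere are encoded as means of \<open>f (sgn x)\<close> over the unit ball.\<close>

definition unit_measure :: "'a::euclidean_space measure" where
  "unit_measure = uniform_measure lborel (cball 0 1)"

text \<open>The derivative at \<open>r = 1\<close> of the volume of a ball of radius
  \<open>r\<close>. It is the constant that appears when the polar formula is normalised to the
  probability measure \<open>unit_measure\<close>.\<close>

definition sphere_area :: "'a::euclidean_space itself \<Rightarrow> real" where
  "sphere_area _ = real DIM('a) * measure lborel (cball (0::'a) 1)"

lemma sphere_area_pos: "sphere_area TYPE('a::euclidean_space) > 0"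
  by (simp add: sphere_area_def content_cball_pos)

lemma sets_unit_measure [measurable_cong, simp]: "sets unit_measure = sets borel"
  and space_unit_measure [simp]: "space unit_measure = UNIV"
  by (simp_all add: unit_measure_def)

lemma emeasure_unit_measure: "emeasure unit_measure (UNIV :: 'a::euclidean_space set) = 1"
proof -
  have "emeasure lborel (cball (0::'a) 1) \<noteq> 0"
    using content_cball_pos[of 1 "0::'a"] by (auto simp: measure_def)
  then have "emeasure lborel (cball (0::'a) 1) / emeasure lborel (cball (0::'a) 1) = 1"
    using emeasure_lborel_cball_finite[of "0::'a" 1]
    by (intro ennreal_divide_self) auto
  then show ?thesis
    by (simp add: unit_measure_def emeasure_uniform_measure)
qed

interpretation unit_measure: finite_measure "unit_measure :: 'a::euclidean_space measure"
  by standard (simp add: emeasure_unit_measure)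

lemma measure_unit_measure [simp]: "measure unit_measure (UNIV :: 'a::euclidean_space set) = 1"
  by (simp add: measure_def emeasure_unit_measure)

lemma AE_unit_measure_sgn: "AE x in (unit_measure :: 'a::euclidean_space measure). norm (sgn x) = 1"
proof -
  note AE_lborel_singleton[of "0::'a"]
  then have "AE x in (unit_measure :: 'a measure). x \<noteq> 0"
    unfolding unit_measure_def
    by (intro AE_uniform_measureI) auto
  then show ?thesis by eventually_elim (simp add: norm_sgn)
qed

text \<open>The indicator removes negative radii, where an even exponent would give a positive
  density.\<close>

abbreviation shell :: "'a::euclidean_space itself \<Rightarrow> real \<Rightarrow> ennreal" where
  "shell t r \<equiv> ennreal (sphere_area t * r ^ (DIM('a) - 1)) * indicator {0<..} r"

theorem nn_integral_polar:
  fixes f :: "'a::euclidean_space \<Rightarrow> ennreal"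
  assumes [measurable]: "f \<in> borel_measurable borel"
  shows "(\<integral>\<^sup>+x. f x \<partial>lborel) =
    (\<integral>\<^sup>+r. shell TYPE('a) r *
       (\<integral>\<^sup>+x. f (r *\<^sub>R sgn x) \<partial>unit_measure) \<partial>lborel)"
proof -
  have e: "emeasure lborel (cball (0::'a) 1) = ennreal (measure lborel (cball (0::'a) 1))"
    using emeasure_lborel_cball_finite[of "0::'a" 1] 
    by (simp add: emeasure_eq_ennreal_measure less_top)
  have "(\<integral>\<^sup>+x. f (r *\<^sub>R sgn x) \<partial>unit_measure) = 
    (\<integral>\<^sup>+x. indicator (cball 0 1) x * f (r *\<^sub>R sgn x) \<partial>lborel) / ennreal (measure lborel (cball (0::'a) 1))"
    for r
    unfolding unit_measure_def
    by (subst nn_integral_uniform_measure) (simp_all add: mult.commute e)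
  moreover have "shell TYPE('a) r *
      (I / ennreal (measure lborel (cball (0::'a) 1))) =
     ennreal (real DIM('a) * r ^ (DIM('a) - 1)) * indicator {0<..} r * I" for r and I :: ennreal
  proof (cases "r > 0")
    case True
    have c: "measure lborel (cball (0::'a) 1) > 0" by (simp add: content_cball_pos)
    have "ennreal (sphere_area TYPE('a) * r ^ (DIM('a) - 1)) / ennreal (measure lborel (cball (0::'a) 1))
       = ennreal (real DIM('a) * r ^ (DIM('a) - 1))"
      using c True by (subst divide_ennreal) (auto simp: sphere_area_def)
    then show ?thesis using True
      by (simp add: ennreal_times_divide mult.commute) 
         (metis ennreal_times_divide mult.commute)
  qed simp
  ultimately show ?thesis
    by (subst nn_integral_polar_cball) simp_all
qed

corollary nn_integral_radial:
  fixes f :: "real \<Rightarrow> ennreal"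
  assumes [measurable]: "f \<in> borel_measurable borel"
  shows "(\<integral>\<^sup>+x. f (norm x) \<partial>(lborel :: 'a::euclidean_space measure)) =
    (\<integral>\<^sup>+r. shell TYPE('a) r * f r \<partial>lborel)"
proof -
  have "(\<integral>\<^sup>+x. f (norm (r *\<^sub>R sgn x)) \<partial>(unit_measure :: 'a measure)) = f r" if "r > 0" for r
  proof -
    have "(\<integral>\<^sup>+x. f (norm (r *\<^sub>R sgn x)) \<partial>(unit_measure :: 'a measure)) =
          (\<integral>\<^sup>+x. f r \<partial>(unit_measure :: 'a measure))"
      using AE_unit_measure_sgn that
      by (intro nn_integral_cong_AE) (auto elim!: eventually_mono)
    then show ?thesis by (simp add: emeasure_unit_measure)
  qed
  then show ?thesis
    by (subst nn_integral_polar) (auto intro!: nn_integral_cong simp: indicator_def)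
qed

text \<open>A null set of radii has a null preimage under \<open>norm\<close>, because the polar
  integral of its indicator is 0. The guard \<open>0 < r\<close> costs only the origin.\<close>

lemma AE_radial:
  assumes "AE r in lborel. 0 < r \<longrightarrow> P r"
  shows "AE x in (lborel :: 'a::euclidean_space measure). P (norm x)"
proof -
  obtain Z where Z: "Z \<in> sets borel" "emeasure lborel Z = 0" "{r. \<not> (0 < r \<longrightarrow> P r)} \<subseteq> Z"
    using assms by (auto elim!: AE_E)
  have [measurable]: "Z \<in> sets borel" by (rule Z)
  have "(\<integral>\<^sup>+x. indicator Z (norm x) \<partial>(lborel :: 'a measure)) =
     (\<integral>\<^sup>+r. shell TYPE('a) r * indicator Z r \<partial>lborel)"
    by (rule nn_integral_radial) measurable
  also have "\<dots> = 0"
    using AE_not_in[of Z lborel] Z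
    by (subst nn_integral_0_iff_AE) (auto elim!: eventually_mono simp: null_sets_def)
  finally have "AE x in (lborel :: 'a measure). norm x \<notin> Z"
    by (subst (asm) nn_integral_0_iff_AE) (auto simp: indicator_eq_0_iff)
  moreover note AE_lborel_singleton[of "0::'a"]
  ultimately show ?thesis
    by eventually_elim (use Z(3) zero_less_norm_iff in blast)
qed

text \<open>A null set meets almost every sphere in a null set: the polar integral of its indicator
  is 0 and the radial density is positive for \<open>0 < r\<close>. This allows a function known
  only almost everywhere to be restricted to spheres.\<close>

lemma AE_polar:
  fixes P :: "'a::euclidean_space \<Rightarrow> bool"
  assumes "AE x in lborel. P x"
  shows "AE r in lborel. 0 < r \<longrightarrow> (AE x in unit_measure. P (r *\<^sub>R sgn x))"
proof -
  obtain Z where Z: "Z \<in> sets borel" "emeasure lborel Z = 0" "{x. \<not> P x} \<subseteq> Z"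
    using assms by (auto elim!: AE_E)
  have [measurable]: "Z \<in> sets borel" by (rule Z)
  have "0 = (\<integral>\<^sup>+x. indicator Z x \<partial>lborel)" using Z by simp
  also have "\<dots> = (\<integral>\<^sup>+r. shell TYPE('a) r *
       (\<integral>\<^sup>+x. indicator Z (r *\<^sub>R sgn (x::'a)) \<partial>unit_measure) \<partial>lborel)"
    by (rule nn_integral_polar) measurable
  finally have "(\<integral>\<^sup>+r. shell TYPE('a) r *
       (\<integral>\<^sup>+x. indicator Z (r *\<^sub>R sgn (x::'a)) \<partial>unit_measure) \<partial>lborel) = 0" by simp
  then have "AE r in lborel. shell TYPE('a) r *
       (\<integral>\<^sup>+x. indicator Z (r *\<^sub>R sgn (x::'a)) \<partial>unit_measure) = 0"
    by (rule nn_integral_0_iff_AE[THEN iffD1, rotated]) measurable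
  then show ?thesis
  proof (eventually_elim, intro impI)
    fix r :: real
    assume "shell TYPE('a) r *
       (\<integral>\<^sup>+x. indicator Z (r *\<^sub>R sgn (x::'a)) \<partial>unit_measure) = 0" "0 < r"
    moreover have "ennreal (sphere_area TYPE('a) * r ^ (DIM('a) - 1)) \<noteq> 0"
      using \<open>0 < r\<close> sphere_area_pos[where 'a='a] by (simp add: ennreal_eq_0_iff not_le)
    ultimately have "(\<integral>\<^sup>+x. indicator Z (r *\<^sub>R sgn (x::'a)) \<partial>unit_measure) = 0"
      by simp
    then have "AE x in unit_measure. indicator Z (r *\<^sub>R sgn (x::'a)) = (0::ennreal)"
      by (rule nn_integral_0_iff_AE[THEN iffD1, rotated]) measurable
    then show "AE x in unit_measure. P (r *\<^sub>R sgn x)"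
      by eventually_elim (use Z(3) in \<open>auto simp: indicator_def split: if_splits\<close>)
  qed
qed

section \<open>Test functions and integration by parts\<close>

lemma gderiv_differentiable:
  assumes "GDERIV f x :> D" shows "f differentiable (at x)"
  using assms unfolding gderiv_def differentiable_def by blast

lemma grad_diff:
  fixes f g :: "'a::euclidean_space \<Rightarrow> real"
  assumes "f differentiable (at x)" "g differentiable (at x)"
  shows "grad (\<lambda>x. f x - g x) x = grad f x - grad g x"
  by (intro grad_eq GDERIV_diff GDERIV_grad assms)

lemma grad_eq_0_off_closed:
  fixes f :: "'a::euclidean_space \<Rightarrow> real"
  assumes "closed K" "\<And>y. y \<notin> K \<Longrightarrow> f y = 0" "x \<notin> K"
  shows "grad f x = 0"
proof -
  have "((\<lambda>_. 0) has_derivative (\<lambda>_. 0)) (at x)" by (rule has_derivative_const)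
  then have "(f has_derivative (\<lambda>_. 0)) (at x)"
    by (rule has_derivative_transform_within_open[where s = "- K"]) (use assms in auto)
  then show ?thesis by (intro grad_eq) (simp add: gderiv_def)
qed

lemma C_k_diff:
  fixes f g :: "'a::euclidean_space \<Rightarrow> real"
  assumes "C_k k f" "C_k k g"
  shows "C_k k (\<lambda>x. f x - g x)"
  using assms
proof (induction k arbitrary: f g)
  case 0
  then show ?case by (auto intro!: continuous_intros)
next
  case (Suc k)
  then show ?case
    by (auto simp: grad_diff inner_diff_left)
qed

lemma continuous_compact_support:
  fixes f :: "'a::euclidean_space \<Rightarrow> 'b::{banach, second_countable_topology}"
  assumes "continuous_on UNIV f" "compact K" "\<And>x. x \<notin> K \<Longrightarrow> f x = 0"
  shows "integrable lborel f" and "\<exists>C. \<forall>x. norm (f x) \<le> C"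
proof -
  have "f = (\<lambda>x. indicator K x *\<^sub>R f x)"
    using assms(3) by (auto simp: indicator_def)
  moreover have "integrable lborel (\<lambda>x. indicator K x *\<^sub>R f x)"
    using assms by (intro borel_integrable_compact continuous_on_subset[OF assms(1)]) auto
  ultimately show "integrable lborel f" by simp
  have "bounded (f ` K)"
    using assms by (intro compact_imp_bounded compact_continuous_image continuous_on_subset[OF assms(1)]) auto
  then obtain C where "\<And>x. x \<in> K \<Longrightarrow> norm (f x) \<le> C"
    by (auto simp: bounded_iff)
  then have "norm (f x) \<le> max C 0" for x
    using assms(3)[of x] by (cases "x \<in> K") (auto simp: le_max_iff_disj)
  then show "\<exists>C. \<forall>x. norm (f x) \<le> C" by blast
qed

context
  fixes \<phi> :: "'a::euclidean_space \<Rightarrow> real" and \<Omega>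
  assumes \<phi>: "\<phi> \<in> test_functions \<Omega>"
begin

lemma test_fun_C_k: "C_k k \<phi>"
  using \<phi> by (auto simp: test_functions_def)

lemma test_fun_differentiable: "\<phi> differentiable (at x)"
  using test_fun_C_k[of 1] by simp

lemma test_fun_GDERIV: "GDERIV \<phi> x :> grad \<phi> x"
  by (intro GDERIV_grad test_fun_differentiable)

lemma test_fun_continuous: "continuous_on UNIV \<phi>"
  using test_fun_C_k[of 0] by simp

lemma test_fun_continuous_grad: "continuous_on UNIV (grad \<phi>)"
proof -
  have "continuous_on UNIV (\<lambda>x. \<Sum>i\<in>Basis. inner (grad \<phi> x) i *\<^sub>R i)"
    using test_fun_C_k[of 1] by (intro continuous_on_sum continuous_on_scaleR continuous_on_const) auto
  then show ?thesis by (simp add: euclidean_representation)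
qed

lemma test_fun_support:
  obtains K where "compact K" "K \<subseteq> \<Omega>" "\<And>x. x \<notin> K \<Longrightarrow> \<phi> x = 0" "\<And>x. x \<notin> K \<Longrightarrow> grad \<phi> x = 0"
proof (rule that)
  let ?K = "closure {x. \<phi> x \<noteq> 0}"
  show "compact ?K" "?K \<subseteq> \<Omega>"
    using \<phi> by (auto simp: test_functions_def)
  show z: "\<phi> x = 0" if "x \<notin> ?K" for x
    using that closure_subset[of "{x. \<phi> x \<noteq> 0}"] by auto
  show "grad \<phi> x = 0" if "x \<notin> ?K" for x
    by (rule grad_eq_0_off_closed[OF closed_closure z that])
qed

end

lemma test_functions_diff:
  assumes "\<phi> \<in> test_functions \<Omega>" "\<psi> \<in> test_functions \<Omega>"
  shows "(\<lambda>x. \<phi> x - \<psi> x) \<in> test_functions \<Omega>"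
proof -
  let ?K = "closure {x. \<phi> x \<noteq> 0} \<union> closure {x. \<psi> x \<noteq> 0}"
  have "closure {x. \<phi> x - \<psi> x \<noteq> 0} \<subseteq> ?K"
    unfolding closure_Un[symmetric] by (intro closure_mono) auto
  moreover have "compact ?K" "?K \<subseteq> \<Omega>"
    using assms by (auto simp: test_functions_def intro!: compact_Un)
  ultimately have "compact (closure {x. \<phi> x - \<psi> x \<noteq> 0})" "closure {x. \<phi> x - \<psi> x \<noteq> 0} \<subseteq> \<Omega>"
    by (meson bounded_subset closed_closure compact_eq_bounded_closed, meson order_trans)
  then show ?thesis
    using assms by (auto simp: test_functions_def intro: C_k_diff)
qed

lemma grad_test_functions_diff:
  assumes "\<phi> \<in> test_functions \<Omega>" "\<psi> \<in> test_functions \<Omega>"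
  shows "grad (\<lambda>x. \<phi> x - \<psi> x) x = grad \<phi> x - grad \<psi> x"
  by (intro grad_diff test_fun_differentiable[OF assms(1)] test_fun_differentiable[OF assms(2)])

section \<open>Cauchy-Schwarz and the triangle inequality for weighted integrals\<close>

lemma discriminant_nonneg:
  fixes A B C :: real
  assumes "\<And>t. 0 \<le> A - 2 * t * B + t\<^sup>2 * C"
  shows "B\<^sup>2 \<le> A * C"
proof (cases "C = 0")
  case True
  have "B = 0"
  proof (rule ccontr)
    assume "B \<noteq> 0"
    \<comment> \<open>With \<open>C = 0\<close> this \<open>t\<close> gives the polynomial the value
      -1.\<close>
    with assms[of "(A + 1) / (2 * B)"] True show False by simp
  qed
  then show ?thesis using True by simp
next
  case False
  have "C \<ge> 0"
  proof (rule ccontr)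
    assume "\<not> C \<ge> 0"
    then have C: "C < 0" by simp
    have q: "C * (A - 2 * t * B + t\<^sup>2 * C) = (C * t - B)\<^sup>2 - (B\<^sup>2 - A * C)" for t
      by (simp add: power2_eq_square algebra_simps)
    have "C * (A - 2 * t * B + t\<^sup>2 * C) \<le> 0" for t
      using assms[of t] C by (simp add: mult_nonpos_nonneg)
    then have "(C * t - B)\<^sup>2 \<le> B\<^sup>2 - A * C" for t
      using q by (metis diff_le_0_iff_le)
    \<comment> \<open>Here \<open>C * t - B\<close> becomes
      \<open>\<bar>B\<^sup>2 - A * C\<bar> + 1\<close>, whose square is too large.\<close>
    from this[of "(B + \<bar>B\<^sup>2 - A * C\<bar> + 1) / C"] have "(\<bar>B\<^sup>2 - A * C\<bar> + 1)\<^sup>2 \<le> B\<^sup>2 - A * C"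
      using C by simp
    moreover have "(\<bar>B\<^sup>2 - A * C\<bar> + 1)\<^sup>2 > \<bar>B\<^sup>2 - A * C\<bar>"
    proof -
      have "d < (d + 1)\<^sup>2" if "0 \<le> d" for d :: real
        using that zero_le_power2[of d] unfolding power2_sum by (simp, linarith)
      then show ?thesis by simp
    qed
    ultimately show False by linarith
  qed
  with False have "C > 0" by simp
  with assms[of "B / C"] show ?thesis
    by (simp add: power2_eq_square field_simps)
qed

text \<open>Expand the nonnegative integral of \<open>w\<close> times the squared norm of
  \<open>a - t b\<close> and apply the discriminant criterion. Values in an inner product space let
  one statement serve gradients, scalar profiles and, with weight 1 and a constant factor, Jensen's
  inequality.\<close>

lemma weighted_Cauchy_Schwarz:
  fixes a b :: "'c \<Rightarrow> 'b::real_inner" and w :: "'c \<Rightarrow> real"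
  assumes "integrable M (\<lambda>x. w x * (norm (a x))\<^sup>2)" "integrable M (\<lambda>x. w x * (norm (b x))\<^sup>2)"
    and "integrable M (\<lambda>x. w x * inner (a x) (b x))" and "AE x in M. 0 \<le> w x"
  shows "(LINT x|M. w x * inner (a x) (b x))\<^sup>2 \<le>
         (LINT x|M. w x * (norm (a x))\<^sup>2) * (LINT x|M. w x * (norm (b x))\<^sup>2)"
proof (rule discriminant_nonneg)
  fix t :: real
  have e: "w x * (norm (a x - t *\<^sub>R b x))\<^sup>2 =
     w x * (norm (a x))\<^sup>2 - 2 * t * (w x * inner (a x) (b x)) + t\<^sup>2 * (w x * (norm (b x))\<^sup>2)" for x
    unfolding power2_norm_eq_inner
    by (simp add: inner_diff_left inner_diff_right inner_commute[of "b x" "a x"]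
        algebra_simps power2_eq_square)
  have "0 \<le> (LINT x|M. w x * (norm (a x - t *\<^sub>R b x))\<^sup>2)"
    using assms(4) by (intro integral_nonneg_AE) (auto elim: eventually_mono)
  then show "0 \<le> (LINT x|M. w x * (norm (a x))\<^sup>2) - 2 * t * (LINT x|M. w x * inner (a x) (b x))
      + t\<^sup>2 * (LINT x|M. w x * (norm (b x))\<^sup>2)"
    using assms unfolding e by simp
qed

lemma weighted_norm_triangle:
  fixes a b :: "'c \<Rightarrow> 'b::real_inner" and w :: "'c \<Rightarrow> real"
  assumes "integrable M (\<lambda>x. w x * (norm (a x))\<^sup>2)" "integrable M (\<lambda>x. w x * (norm (b x))\<^sup>2)"
    and "integrable M (\<lambda>x. w x * inner (a x) (b x))" and w: "AE x in M. 0 \<le> w x"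
  shows "sqrt (LINT x|M. w x * (norm (a x - b x))\<^sup>2) \<le>
         sqrt (LINT x|M. w x * (norm (a x))\<^sup>2) + sqrt (LINT x|M. w x * (norm (b x))\<^sup>2)"
proof -
  let ?A = "LINT x|M. w x * (norm (a x))\<^sup>2" and ?B = "LINT x|M. w x * (norm (b x))\<^sup>2"
  let ?C = "LINT x|M. w x * inner (a x) (b x)"
  have nn: "0 \<le> ?A" "0 \<le> ?B"
    using w by (auto intro!: integral_nonneg_AE elim: eventually_mono)
  have "w x * (norm (a x - b x))\<^sup>2 =
     w x * (norm (a x))\<^sup>2 - 2 * (w x * inner (a x) (b x)) + (w x * (norm (b x))\<^sup>2)" for x
    by (simp add: power2_norm_eq_inner inner_diff_left inner_diff_right inner_commute[of "b x" "a x"]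
        algebra_simps)
  then have "(LINT x|M. w x * (norm (a x - b x))\<^sup>2) = ?A - 2 * ?C + ?B"
    using assms by simp
  also have "\<dots> \<le> ?A + 2 * (sqrt ?A * sqrt ?B) + ?B"
  proof -
    have "\<bar>?C\<bar> \<le> sqrt (?A * ?B)"
      using weighted_Cauchy_Schwarz[OF assms] by (intro real_le_rsqrt) simp
    then show ?thesis by (simp add: real_sqrt_mult)
  qed
  also have "\<dots> = (sqrt ?A + sqrt ?B)\<^sup>2"
    using nn by (simp add: power2_sum)
  finally show ?thesis
    using nn by (intro real_le_lsqrt) auto
qed

text \<open>Difference quotients of \<open>F\<close> have integral 0 by translation invariance of
  Lebesgue measure, and they converge dominatedly to the partial derivative.\<close>

lemma integral_partial_derivative_eq_0:
  fixes F :: "'a::euclidean_space \<Rightarrow> real"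
  assumes i: "i \<in> Basis" and diff: "\<And>x. F differentiable (at x)"
    and cont: "continuous_on UNIV (\<lambda>x. inner (grad F x) i)"
    and K: "compact K" "\<And>x. x \<notin> K \<Longrightarrow> F x = 0" "\<And>x. x \<notin> K \<Longrightarrow> inner (grad F x) i = 0"
  shows "(LINT x|lborel. inner (grad F x) i) = 0"
proof -
  have contF: "continuous_on UNIV F"
    using diff by (simp add: continuous_on_eq_continuous_at differentiable_imp_continuous_within)
  have [measurable]: "F \<in> borel_measurable borel" "(\<lambda>x. inner (grad F x) i) \<in> borel_measurable borel"
    using contF cont by (auto intro: borel_measurable_continuous_onI)
  have intF: "integrable lborel F"
    by (rule continuous_compact_support(1)[OF contF K(1,2)])
  obtain C where C: "\<And>x. \<bar>inner (grad F x) i\<bar> \<le> C"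
    using continuous_compact_support(2)[OF cont K(1,3)] by auto
  obtain b where b: "\<And>x. x \<in> K \<Longrightarrow> norm x \<le> b"
    using compact_imp_bounded[OF K(1)] unfolding bounded_iff by blast
  \<comment> \<open>Steps of length at most 1 keep every shifted support inside
    \<open>cball 0 (b + 1)\<close>, where the dominating function lives.\<close>
  define h where "h n = 1 / real (Suc n)" for n
  have h: "0 < h n" "h n \<le> 1" for n by (auto simp: h_def divide_le_eq)
  have hlim: "h \<longlonglongrightarrow> 0" unfolding h_def by (rule LIMSEQ_Suc[OF lim_1_over_n])
  let ?Q = "\<lambda>n x. (F (x + h n *\<^sub>R i) - F x) / h n"
  have der: "DERIV (\<lambda>t. F (x + t *\<^sub>R i)) t :> inner (grad F (x + t *\<^sub>R i)) i" for x t
  proof -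
    have "(F has_derivative (\<lambda>h. inner h (grad F (x + t *\<^sub>R i)))) (at (x + t *\<^sub>R i))"
      using GDERIV_grad[OF diff] by (simp add: gderiv_def)
    moreover have "((\<lambda>t. x + t *\<^sub>R i) has_derivative (\<lambda>s. s *\<^sub>R i)) (at t)"
      by (auto intro!: derivative_eq_intros)
    ultimately have "((\<lambda>t. F (x + t *\<^sub>R i)) has_derivative (\<lambda>s. inner (s *\<^sub>R i) (grad F (x + t *\<^sub>R i)))) (at t)"
      by (rule has_derivative_compose[rotated])
    then show ?thesis
      by (simp add: has_field_derivative_def inner_commute mult_commute_abs)
  qed
  have "(\<lambda>n. LINT x|lborel. ?Q n x) \<longlonglongrightarrow> (LINT x|lborel. inner (grad F x) i)"
  proof (rule integral_dominated_convergence)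
    show "(\<lambda>x. inner (grad F x) i) \<in> borel_measurable lborel" by measurable
    show "?Q n \<in> borel_measurable lborel" for n by measurable
    show "integrable lborel (\<lambda>x. indicator (cball (0::'a) (b + 1)) x * C)"
      using emeasure_lborel_cball_finite[of "0::'a" "b + 1"]
      by (intro integrable_mult_left integrable_real_indicator) auto
    show "AE x in lborel. (\<lambda>n. ?Q n x) \<longlonglongrightarrow> inner (grad F x) i"
    proof (intro AE_I2)
      fix x
      have "((\<lambda>t. (F (x + t *\<^sub>R i) - F x) / t) \<longlongrightarrow> inner (grad F x) i) (at 0)"
        using der[of x 0] by (simp add: has_field_derivative_iff)
      moreover have "filterlim h (at 0) sequentially"
        using hlim h(1) by (auto simp: filterlim_at less_imp_neq[symmetric])
      ultimately show "(\<lambda>n. ?Q n x) \<longlonglongrightarrow> inner (grad F x) i"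
        by (rule filterlim_compose)
    qed
    show "AE x in lborel. norm (?Q n x) \<le> indicator (cball 0 (b + 1)) x * C" for n
    proof (intro AE_I2)
      fix x
      show "norm (?Q n x) \<le> indicator (cball 0 (b + 1)) x * C"
      proof (cases "x \<in> cball 0 (b + 1)")
        case True
        \<comment> \<open>The mean value theorem bounds the quotient by the same \<open>C\<close>
          that bounds the partial derivative.\<close>
        have "\<exists>z>0. z < h n \<and> F (x + h n *\<^sub>R i) - F (x + 0 *\<^sub>R i) = (h n - 0) * inner (grad F (x + z *\<^sub>R i)) i"
          using h(1) der by (intro MVT2[where f = "\<lambda>t. F (x + t *\<^sub>R i)"]) auto
        then obtain z where "F (x + h n *\<^sub>R i) - F x = h n * inner (grad F (x + z *\<^sub>R i)) i"
          by auto
        then show ?thesis using True C h(1)[of n] by simp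
      next
        case False
        then have "x \<notin> K" using b by force
        moreover have "norm (x + h n *\<^sub>R i) \<ge> norm x - 1"
          using h[of n] i norm_triangle_ineq4[of "x + h n *\<^sub>R i" "h n *\<^sub>R i"] by simp
        then have "x + h n *\<^sub>R i \<notin> K" using False b by force
        ultimately show ?thesis using K False by simp
      qed
    qed
  qed
  moreover have Q0: "(\<lambda>n. LINT x|lborel. ?Q n x) = (\<lambda>n. 0)"
  proof
    fix n
    have "(LINT x|lborel. F (x + h n *\<^sub>R i)) = (LINT x|distr lborel borel ((+) (h n *\<^sub>R i)). F x)"
      by (subst integral_distr) (auto simp: add.commute)
    then have "(LINT x|lborel. F (x + h n *\<^sub>R i)) = (LINT x|lborel. F x)"
      by (simp add: lborel_distr_plus)
    moreover have "integrable lborel (\<lambda>x. F (x + h n *\<^sub>R i))"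
    proof -
      have "integrable (distr lborel borel ((+) (h n *\<^sub>R i))) F"
        using intF by (simp add: lborel_distr_plus)
      then show ?thesis by (subst (asm) integrable_distr_eq) (auto simp: add.commute)
    qed
    ultimately show "(LINT x|lborel. ?Q n x) = 0" using intF by simp
  qed
  ultimately have "(\<lambda>n. 0) \<longlonglongrightarrow> (LINT x|lborel. inner (grad F x) i)" by (simp only: Q0)
  then show ?thesis by (simp add: LIMSEQ_const_iff)
qed

text \<open>The partial derivative of \<open>f * g\<close> integrates to 0. The support condition is
  on \<open>g\<close> alone, so with \<open>g\<close> fixed and a sequence in place of
  \<open>f\<close> one set \<open>K\<close> serves throughout.\<close>

lemma integration_by_parts:
  fixes f g :: "'a::euclidean_space \<Rightarrow> real"
  assumes i: "i \<in> Basis"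
    and f: "\<And>x. f differentiable (at x)" "continuous_on UNIV (\<lambda>x. inner (grad f x) i)"
    and g: "\<And>x. g differentiable (at x)" "continuous_on UNIV (\<lambda>x. inner (grad g x) i)"
    and K: "compact K" "\<And>x. x \<notin> K \<Longrightarrow> g x = 0" "\<And>x. x \<notin> K \<Longrightarrow> inner (grad g x) i = 0"
  shows "(LINT x|lborel. inner (grad f x) i * g x) = - (LINT x|lborel. f x * inner (grad g x) i)"
proof -
  have cont: "continuous_on UNIV f" "continuous_on UNIV g"
    using f(1) g(1) by (simp_all add: continuous_on_eq_continuous_at differentiable_imp_continuous_within)
  have gr: "grad (\<lambda>x. f x * g x) x = f x *\<^sub>R grad g x + g x *\<^sub>R grad f x" for x
    by (intro grad_eq GDERIV_mult GDERIV_grad f g)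
  have "(LINT x|lborel. inner (grad (\<lambda>x. f x * g x) x) i) = 0"
  proof (rule integral_partial_derivative_eq_0[OF i _ _ K(1)])
    show "continuous_on UNIV (\<lambda>x. inner (grad (\<lambda>x. f x * g x) x) i)"
      unfolding gr inner_add_left inner_scaleR_left
      by (intro continuous_intros cont f g)
  qed (use f g K in \<open>auto simp: gr inner_add_left\<close>)
  moreover have "integrable lborel (\<lambda>x. f x * inner (grad g x) i)" "integrable lborel (\<lambda>x. inner (grad f x) i * g x)"
    using K by (auto intro!: continuous_compact_support(1)[OF _ K(1)] continuous_intros cont f g)
  ultimately have "(LINT x|lborel. f x * inner (grad g x) i) + (LINT x|lborel. inner (grad f x) i * g x) = 0"
    unfolding gr inner_add_left inner_scaleR_left
    by (subst Bochner_Integration.integral_add[symmetric]) (simp_all add: mult.commute)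
  then show ?thesis by linarith
qed

section \<open>Closability of the weighted gradient\<close>

abbreviation L1_dist :: "'a::euclidean_space set \<Rightarrow> ('a \<Rightarrow> real) \<Rightarrow> ('a \<Rightarrow> real) \<Rightarrow> real" where
  "L1_dist K f g \<equiv> (LINT x:K|lebesgue. \<bar>f x - g x\<bar>)"

text \<open>Integration by parts needs a \<open>C\<^sup>1\<close> weight; \<open>\<rho>a k\<close> approximates the possibly singular \<open>\<rho>\<close> from below.\<close>

locale energy_weight =
  fixes \<rho> :: "'a::euclidean_space \<Rightarrow> real" and \<Omega> :: "'a set" and \<rho>a :: "nat \<Rightarrow> 'a \<Rightarrow> real"
  assumes weight_measurable [measurable]: "\<rho> \<in> borel_measurable borel"
    and weight_nonneg: "0 \<le> \<rho> x"
    and weight_integrable: "compact K \<Longrightarrow> integrable lborel (\<lambda>x. indicator K x * \<rho> x)"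
    and approx_nonneg: "0 \<le> \<rho>a k x"
    and approx_le: "x \<noteq> 0 \<Longrightarrow> \<rho>a k x \<le> \<rho> x"
    and approx_tendsto: "x \<noteq> 0 \<Longrightarrow> (\<lambda>k. \<rho>a k x) \<longlonglongrightarrow> \<rho> x"
    and approx_differentiable: "\<rho>a k differentiable (at x)"
    and approx_continuous_grad: "i \<in> Basis \<Longrightarrow> continuous_on UNIV (\<lambda>x. inner (grad (\<rho>a k) x) i)"
begin

abbreviation E :: "('a \<Rightarrow> real) \<Rightarrow> real" where
  "E \<equiv> energy_norm \<rho> \<Omega>"

abbreviation tests :: "('a \<Rightarrow> real) set" where
  "tests \<equiv> test_functions \<Omega>"

lemma approx_continuous: "continuous_on UNIV (\<rho>a k)"
  using approx_differentiable by (simp add: continuous_on_eq_continuous_at differentiable_imp_continuous_within)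

lemma AE_approx_le: "AE x in lborel. 0 \<le> \<rho>a k x \<and> \<rho>a k x \<le> \<rho> x"
proof -
  note AE_lborel_singleton[of "0::'a"]
  then show ?thesis by eventually_elim (simp add: approx_nonneg approx_le)
qed

lemma weighted_integrable:
  fixes f :: "'a \<Rightarrow> real"
  assumes "continuous_on UNIV f" "compact K" "\<And>x. x \<notin> K \<Longrightarrow> f x = 0"
  shows "integrable lborel (\<lambda>x. \<rho> x * f x)"
proof -
  obtain C where C: "\<And>x. norm (f x) \<le> C"
    using continuous_compact_support(2)[OF assms] by blast
  have [measurable]: "f \<in> borel_measurable borel"
    using assms(1) by (rule borel_measurable_continuous_onI)
  show ?thesis
  proof (rule Bochner_Integration.integrable_bound)
    show "integrable lborel (\<lambda>x. C * (indicator K x * \<rho> x))"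
      by (intro integrable_mult_right weight_integrable assms)
    show "AE x in lborel. norm (\<rho> x * f x) \<le> norm (C * (indicator K x * \<rho> x))"
    proof (intro AE_I2)
      fix x
      have "norm (\<rho> x * f x) = \<rho> x * norm (f x)" using weight_nonneg[of x] by (simp add: abs_mult)
      also have "\<dots> \<le> C * (indicator K x * \<rho> x)"
        using C[of x] weight_nonneg[of x] assms(3)[of x]
        by (cases "x \<in> K") (auto simp: mult.commute[of C] intro: mult_left_mono)
      finally show "norm (\<rho> x * f x) \<le> norm (C * (indicator K x * \<rho> x))" by simp
    qed
  qed measurable
qed

lemma approx_weighted_integrable:
  fixes f :: "'a \<Rightarrow> real"
  assumes "continuous_on UNIV f" "compact K" "\<And>x. x \<notin> K \<Longrightarrow> f x = 0"
  shows "integrable lborel (\<lambda>x. \<rho>a k x * f x)"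
  using assms
  by (intro continuous_compact_support(1)[OF _ assms(2)] continuous_intros approx_continuous) auto

lemma
  assumes "\<phi> \<in> tests" "\<psi> \<in> tests"
  shows energy_integrable: "integrable lborel (\<lambda>x. \<rho> x * inner (grad \<phi> x) (grad \<psi> x))"
    and approx_energy_integrable: "integrable lborel (\<lambda>x. \<rho>a k x * inner (grad \<phi> x) (grad \<psi> x))"
proof -
  obtain K where K: "compact K" "\<And>x. x \<notin> K \<Longrightarrow> grad \<phi> x = 0"
    using test_fun_support[OF assms(1)] by metis
  show "integrable lborel (\<lambda>x. \<rho> x * inner (grad \<phi> x) (grad \<psi> x))"
    by (intro weighted_integrable[OF _ K(1)] continuous_intros test_fun_continuous_grad[OF assms(1)]
         test_fun_continuous_grad[OF assms(2)]) (simp add: K)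
  show "integrable lborel (\<lambda>x. \<rho>a k x * inner (grad \<phi> x) (grad \<psi> x))"
    by (intro approx_weighted_integrable[OF _ K(1)] continuous_intros test_fun_continuous_grad[OF assms(1)]
         test_fun_continuous_grad[OF assms(2)]) (simp add: K)
qed

lemma
  assumes "\<phi> \<in> tests"
  shows energy_integrable_norm: "integrable lborel (\<lambda>x. \<rho> x * (norm (grad \<phi> x))\<^sup>2)"
    and approx_energy_integrable_norm: "integrable lborel (\<lambda>x. \<rho>a k x * (norm (grad \<phi> x))\<^sup>2)"
  using energy_integrable[OF assms assms] approx_energy_integrable[OF assms assms]
  by (simp_all add: power2_norm_eq_inner)

text \<open>The gradient of a test function vanishes outside a compact subset of
  \<open>\<Omega>\<close>, so the restriction to \<open>\<Omega>\<close> and the completion of the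
  measure can both be dropped.\<close>

lemma energy_norm_eq:
  assumes "\<phi> \<in> tests"
  shows "E \<phi> = sqrt (LINT x|lborel. \<rho> x * (norm (grad \<phi> x))\<^sup>2)"
proof -
  obtain K where K: "K \<subseteq> \<Omega>" "\<And>x. x \<notin> K \<Longrightarrow> grad \<phi> x = 0"
    using test_fun_support[OF assms] by metis
  have *: "indicator \<Omega> x *\<^sub>R (\<rho> x * (norm (grad \<phi> x))\<^sup>2) = \<rho> x * (norm (grad \<phi> x))\<^sup>2" for x
    using K by (cases "x \<in> \<Omega>") auto
  have "(\<lambda>x. \<rho> x * (norm (grad \<phi> x))\<^sup>2) \<in> borel_measurable lborel"
    using energy_integrable_norm[OF assms] by blast
  then show ?thesis
    unfolding energy_norm_def set_lebesgue_integral_def * by (simp add: integral_completion)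
qed

lemma energy_norm_triangle:
  assumes "\<phi> \<in> tests" "\<psi> \<in> tests"
  shows "E (\<lambda>x. \<phi> x - \<psi> x) \<le> E \<phi> + E \<psi>"
  unfolding energy_norm_eq[OF assms(1)] energy_norm_eq[OF assms(2)]
    energy_norm_eq[OF test_functions_diff[OF assms]] grad_test_functions_diff[OF assms]
  by (intro weighted_norm_triangle energy_integrable energy_integrable_norm assms)
     (simp add: weight_nonneg)

lemma energy_norm_diff_commute:
  assumes "\<phi> \<in> tests" "\<psi> \<in> tests"
  shows "E (\<lambda>x. \<phi> x - \<psi> x) = E (\<lambda>x. \<psi> x - \<phi> x)"
  unfolding energy_norm_eq[OF test_functions_diff[OF assms]] grad_test_functions_diff[OF assms]
    energy_norm_eq[OF test_functions_diff[OF assms(2,1)]] grad_test_functions_diff[OF assms(2,1)]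
  by (simp add: norm_minus_commute)

lemma energy_norm_reverse_triangle:
  assumes "\<phi> \<in> tests" "\<psi> \<in> tests"
  shows "\<bar>E \<phi> - E \<psi>\<bar> \<le> E (\<lambda>x. \<phi> x - \<psi> x)"
proof -
  have *: "E f \<le> E (\<lambda>x. f x - g x) + E g"
    if "f \<in> tests" "g \<in> tests" for f g
  proof -
    have z: "(\<lambda>x. 0) \<in> tests"
      using test_functions_diff[OF that(2) that(2)] by simp
    have mg: "(\<lambda>x. 0 - g x) \<in> tests"
      by (rule test_functions_diff[OF z that(2)])
    have "E (\<lambda>x. 0 - g x) = E g"
      using energy_norm_diff_commute[OF z that(2)] by simp
    then show ?thesis
      using energy_norm_triangle[OF test_functions_diff[OF that] mg] by simp
  qed
  show ?thesis
    using *[OF assms] *[OF assms(2,1)] energy_norm_diff_commute[OF assms] by linarith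
qed

text \<open>By parts, the form equals minus the integral of \<open>\<zeta> n\<close> against the
  divergence of \<open>\<rho>a k\<close> times the gradient of \<open>\<psi>\<close>. That
  divergence is continuous and supported in the fixed compact support of \<open>\<psi>\<close>, so
  L1 convergence of \<open>\<zeta> n\<close> there suffices.\<close>

lemma approx_form_tendsto_0:
  assumes \<zeta>: "\<And>n. \<zeta> n \<in> tests" and \<psi>: "\<psi> \<in> tests"
    and lim: "\<And>K. compact K \<Longrightarrow> K \<subseteq> \<Omega> \<Longrightarrow> (\<lambda>n. LINT x:K|lebesgue. \<bar>\<zeta> n x\<bar>) \<longlonglongrightarrow> 0"
  shows "(\<lambda>n. LINT x|lborel. \<rho>a k x * inner (grad (\<zeta> n) x) (grad \<psi> x)) \<longlonglongrightarrow> 0"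
proof -
  obtain K where K: "compact K" "K \<subseteq> \<Omega>" "\<And>x. x \<notin> K \<Longrightarrow> \<psi> x = 0" "\<And>x. x \<notin> K \<Longrightarrow> grad \<psi> x = 0"
    using test_fun_support[OF \<psi>] by metis
  define G where "G i x = \<rho>a k x * inner (grad \<psi> x) i" for i x
  define \<psi>i where "\<psi>i i x = inner (grad \<psi> x) i" for i x
  have \<psi>i: "\<psi>i i differentiable (at x)" "continuous_on UNIV (\<lambda>x. inner (grad (\<psi>i i) x) j)"
    if "i \<in> Basis" "j \<in> Basis" for i j x
    using test_fun_C_k[OF \<psi>, of 2] that by (auto simp: \<psi>i_def[abs_def] numeral_2_eq_2)
  have gradG: "GDERIV (G i) x :> \<rho>a k x *\<^sub>R grad (\<psi>i i) x + \<psi>i i x *\<^sub>R grad (\<rho>a k) x" if "i \<in> Basis" for i x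
    using that unfolding G_def \<psi>i_def[symmetric]
    by (intro GDERIV_mult GDERIV_grad approx_differentiable \<psi>i)
  have dG: "G i differentiable (at x)" if "i \<in> Basis" for i x
    using gradG[OF that] by (rule gderiv_differentiable)
  have cont\<psi>i: "continuous_on UNIV (\<psi>i i)" for i
    unfolding \<psi>i_def[abs_def] by (intro continuous_intros test_fun_continuous_grad[OF \<psi>])
  have cG: "continuous_on UNIV (\<lambda>x. inner (grad (G i) x) i)" if "i \<in> Basis" for i
    using that unfolding grad_eq[OF gradG[OF that]] inner_add_left inner_scaleR_left
    by (intro continuous_intros approx_continuous \<psi>i cont\<psi>i approx_continuous_grad)
  have zG0: "G i x = 0" if "x \<notin> K" for i x using that K by (simp add: G_def)
  have zG: "G i x = 0" "grad (G i) x = 0" if "x \<notin> K" for i x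
    using zG0 grad_eq_0_off_closed[OF compact_imp_closed[OF K(1)] zG0 that] that by auto
  \<comment> \<open>The functions \<open>G i\<close> are the components of the weighted gradient of
    \<open>\<psi>\<close>; \<open>D\<close> is the divergence of this field.\<close>
  define D where "D x = (\<Sum>i\<in>Basis. inner (grad (G i) x) i)" for x
  have contD: "continuous_on UNIV D"
    unfolding D_def by (intro continuous_on_sum cG)
  have zD: "D x = 0" if "x \<notin> K" for x
    using zG that by (simp add: D_def)
  obtain C where C: "\<And>x. norm (D x) \<le> C"
    using continuous_compact_support(2)[OF contD K(1) zD] by blast
  have int: "integrable lborel (\<lambda>x. f x * inner (grad (G i) x) i)"
    if "i \<in> Basis" "continuous_on UNIV f" for i f
    using zG that by (intro continuous_compact_support(1)[OF _ K(1)] continuous_on_mult cG) auto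
  have eq: "(LINT x|lborel. \<rho>a k x * inner (grad (\<zeta> n) x) (grad \<psi> x)) = - (LINT x|lborel. \<zeta> n x * D x)" for n
  proof -
    have "\<rho>a k x * inner (grad (\<zeta> n) x) (grad \<psi> x) = (\<Sum>i\<in>Basis. inner (grad (\<zeta> n) x) i * G i x)" for x
      by (subst euclidean_inner) (simp add: G_def sum_distrib_left mult_ac)
    then have "(LINT x|lborel. \<rho>a k x * inner (grad (\<zeta> n) x) (grad \<psi> x)) =
       (\<Sum>i\<in>Basis. LINT x|lborel. inner (grad (\<zeta> n) x) i * G i x)"
    proof (simp, intro Bochner_Integration.integral_sum)
      fix i :: 'a assume "i \<in> Basis"
      then show "integrable lborel (\<lambda>x. inner (grad (\<zeta> n) x) i * G i x)"
        unfolding G_def using K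
        by (intro continuous_compact_support(1)[OF _ K(1)] continuous_intros
            test_fun_continuous_grad[OF \<zeta>] test_fun_continuous_grad[OF \<psi>] approx_continuous) auto
    qed
    also have "\<dots> = (\<Sum>i\<in>Basis. - (LINT x|lborel. \<zeta> n x * inner (grad (G i) x) i))"
      using zG
      by (intro sum.cong refl integration_by_parts[OF _ _ _ _ _ K(1)] continuous_intros
          test_fun_differentiable[OF \<zeta>] test_fun_continuous_grad[OF \<zeta>] dG cG) auto
    also have "\<dots> = - (LINT x|lborel. (\<Sum>i\<in>Basis. \<zeta> n x * inner (grad (G i) x) i))"
      by (subst Bochner_Integration.integral_sum) 
         (auto simp: sum_negf intro!: int test_fun_continuous[OF \<zeta>])
    finally show ?thesis by (simp add: D_def sum_distrib_left)
  qed
  have "(\<lambda>n. LINT x|lborel. \<zeta> n x * D x) \<longlonglongrightarrow> 0"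
  proof (rule Lim_null_comparison)
    show "\<forall>\<^sub>F n in sequentially. norm (LINT x|lborel. \<zeta> n x * D x) \<le> C * (LINT x:K|lebesgue. \<bar>\<zeta> n x\<bar>)"
    proof (intro always_eventually allI)
      fix n
      have c: "continuous_on UNIV (\<zeta> n)" by (rule test_fun_continuous[OF \<zeta>])
      then have [measurable]: "\<zeta> n \<in> borel_measurable borel" by (rule borel_measurable_continuous_onI)
      have [measurable]: "K \<in> sets borel" using K(1) by (simp add: borel_compact)
      have "norm (LINT x|lborel. \<zeta> n x * D x) \<le> (LINT x|lborel. indicator K x *\<^sub>R (C * \<bar>\<zeta> n x\<bar>))"
      proof (intro order_trans[OF integral_norm_bound integral_mono] integrable_norm)
        show "integrable lborel (\<lambda>x. \<zeta> n x * D x)"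
          using zD by (intro continuous_compact_support(1)[OF _ K(1)] continuous_intros c contD) auto
        show "integrable lborel (\<lambda>x. indicator K x *\<^sub>R (C * \<bar>\<zeta> n x\<bar>))"
          by (intro borel_integrable_compact K continuous_intros continuous_on_subset[OF c]) auto
        show "norm (\<zeta> n x * D x) \<le> indicator K x *\<^sub>R (C * \<bar>\<zeta> n x\<bar>)" for x
          using zD[of x] C[of x]
          by (cases "x \<in> K") (auto simp: abs_mult mult.commute intro: mult_right_mono)
      qed
      also have "\<dots> = C * (LINT x:K|lebesgue. \<bar>\<zeta> n x\<bar>)"
        by (simp add: set_lebesgue_integral_def integral_completion mult.left_commute)
      finally show "norm (LINT x|lborel. \<zeta> n x * D x) \<le> C * (LINT x:K|lebesgue. \<bar>\<zeta> n x\<bar>)" .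
    qed
    show "(\<lambda>n. C * (LINT x:K|lebesgue. \<bar>\<zeta> n x\<bar>)) \<longlonglongrightarrow> 0"
      using tendsto_mult_right_zero[OF lim[OF K(1,2)]] .
  qed
  then show ?thesis unfolding eq using tendsto_minus[of _ 0] by fastforce
qed

text \<open>Pairing a late member \<open>\<zeta> m\<close> with the whole sequence: the form tends to \<open>0\<close> by integration by
  parts, while by Cauchy-Schwarz it stays close to the energy of \<open>\<zeta> m\<close>.\<close>

lemma gradient_closable:
  assumes \<zeta>: "\<And>n. \<zeta> n \<in> tests"
    and cauchy: "\<And>e. e > 0 \<Longrightarrow> \<exists>M. \<forall>m\<ge>M. \<forall>n\<ge>M. E (\<lambda>x. \<zeta> m x - \<zeta> n x) < e"
    and lim: "\<And>K. compact K \<Longrightarrow> K \<subseteq> \<Omega> \<Longrightarrow> (\<lambda>n. LINT x:K|lebesgue. \<bar>\<zeta> n x\<bar>) \<longlonglongrightarrow> 0"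
  shows "(\<lambda>n. E (\<zeta> n)) \<longlonglongrightarrow> 0"
proof (rule LIMSEQ_I)
  fix r :: real assume "r > 0"
  \<comment> \<open>The limit passages below preserve only a weak inequality; taking half of
    \<open>r\<close> restores strictness.\<close>
  define e where "e = r / 2"
  have e: "e > 0" using \<open>r > 0\<close> by (simp add: e_def)
  obtain M where M: "\<And>m n. m \<ge> M \<Longrightarrow> n \<ge> M \<Longrightarrow> E (\<lambda>x. \<zeta> m x - \<zeta> n x) < e"
    using cauchy[OF e] by blast
  have le_e: "E (\<zeta> m) \<le> e" if m: "m \<ge> M" for m
  proof -
    define b where "b k = (LINT x|lborel. \<rho>a k x * (norm (grad (\<zeta> m) x))\<^sup>2)" for k
    have b_nonneg: "b k \<ge> 0" for k
      unfolding b_def by (intro Bochner_Integration.integral_nonneg) (simp add: approx_nonneg)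
    have "b k \<le> e\<^sup>2" for k
    proof -
      let ?B = "\<lambda>n. LINT x|lborel. \<rho>a k x * inner (grad (\<zeta> n) x) (grad (\<zeta> m) x)"
      have "b k \<le> \<bar>?B n\<bar> + sqrt (b k) * e" if n: "n \<ge> M" for n
      proof -
        let ?d = "\<lambda>x. \<zeta> m x - \<zeta> n x"
        have d: "?d \<in> tests" by (intro test_functions_diff \<zeta>)
        have "b k - ?B n = (LINT x|lborel. \<rho>a k x * inner (grad (\<zeta> m) x) (grad ?d x))"
          unfolding grad_test_functions_diff[OF \<zeta> \<zeta>] b_def inner_diff_right right_diff_distrib
          using approx_energy_integrable[OF \<zeta> \<zeta>]
          by (subst Bochner_Integration.integral_diff) (auto simp: power2_norm_eq_inner inner_commute)
        also have "\<bar>\<dots>\<bar> \<le> sqrt (b k * (LINT x|lborel. \<rho>a k x * (norm (grad ?d x))\<^sup>2))"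
          unfolding b_def
          by (intro real_le_rsqrt, subst power2_abs, intro weighted_Cauchy_Schwarz
               approx_energy_integrable approx_energy_integrable_norm \<zeta> d) (simp add: approx_nonneg)
        also have "\<dots> \<le> sqrt (b k) * e"
          unfolding real_sqrt_mult
        proof (intro mult_left_mono)
          \<comment> \<open>Because \<open>\<rho>a k\<close> lies below \<open>\<rho>\<close> off
            the origin, the index \<open>M\<close> chosen for the true energy works for every
            \<open>k\<close>.\<close>
          have "(LINT x|lborel. \<rho>a k x * (norm (grad ?d x))\<^sup>2) \<le> (LINT x|lborel. \<rho> x * (norm (grad ?d x))\<^sup>2)"
          proof (intro integral_mono_AE approx_energy_integrable_norm energy_integrable_norm d)
            show "AE x in lborel. \<rho>a k x * (norm (grad ?d x))\<^sup>2 \<le> \<rho> x * (norm (grad ?d x))\<^sup>2"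
              using AE_approx_le[of k] by eventually_elim (auto intro: mult_right_mono)
          qed
          then have "sqrt (LINT x|lborel. \<rho>a k x * (norm (grad ?d x))\<^sup>2) \<le> E ?d"
            by (simp add: energy_norm_eq[OF d])
          with M[OF m n] show "sqrt (LINT x|lborel. \<rho>a k x * (norm (grad ?d x))\<^sup>2) \<le> e" by simp
        qed (use b_nonneg in simp)
        finally show ?thesis by linarith
      qed
      \<comment> \<open>Let \<open>n\<close> tend to infinity with \<open>m\<close> and
        \<open>k\<close> fixed; the form then disappears.\<close>
      moreover have "(\<lambda>n. \<bar>?B n\<bar> + sqrt (b k) * e) \<longlonglongrightarrow> \<bar>0\<bar> + sqrt (b k) * e"
        by (intro tendsto_intros approx_form_tendsto_0 \<zeta> lim)
      ultimately have "b k \<le> sqrt (b k) * e"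
        by (intro tendsto_lowerbound[of _ "\<bar>0\<bar> + sqrt (b k) * e" sequentially, simplified])
           (auto simp: eventually_sequentially)
      then have "sqrt (b k) * sqrt (b k) \<le> sqrt (b k) * e"
        using b_nonneg[of k] by simp
      then have "sqrt (b k) \<le> e"
        using e b_nonneg[of k] mult_le_cancel_left_pos[of "sqrt (b k)" "sqrt (b k)" e]
        by (cases "b k = 0") auto
      then show ?thesis by (metis b_nonneg real_sqrt_pow2 power_mono real_sqrt_ge_zero)
    qed
    \<comment> \<open>Now \<open>k\<close> tends to infinity; the true weight provides the
      dominating integrand.\<close>
    moreover have "b \<longlonglongrightarrow> (LINT x|lborel. \<rho> x * (norm (grad (\<zeta> m) x))\<^sup>2)"
      unfolding b_def
    proof (rule integral_dominated_convergence)
      show "integrable lborel (\<lambda>x. \<rho> x * (norm (grad (\<zeta> m) x))\<^sup>2)" by (rule energy_integrable_norm[OF \<zeta>])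
      then show "(\<lambda>x. \<rho> x * (norm (grad (\<zeta> m) x))\<^sup>2) \<in> borel_measurable lborel" by blast
      show "(\<lambda>x. \<rho>a k x * (norm (grad (\<zeta> m) x))\<^sup>2) \<in> borel_measurable lborel" for k
        using approx_energy_integrable_norm[OF \<zeta>] by blast
      note AE_lborel_singleton[of "0::'a"]
      then show "AE x in lborel. (\<lambda>k. \<rho>a k x * (norm (grad (\<zeta> m) x))\<^sup>2) \<longlonglongrightarrow> \<rho> x * (norm (grad (\<zeta> m) x))\<^sup>2"
        by eventually_elim (intro tendsto_intros approx_tendsto)
      show "AE x in lborel. norm (\<rho>a k x * (norm (grad (\<zeta> m) x))\<^sup>2) \<le> \<rho> x * (norm (grad (\<zeta> m) x))\<^sup>2" for k
        using AE_approx_le[of k] by eventually_elim (simp add: abs_mult mult_right_mono)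
    qed
    ultimately have "(LINT x|lborel. \<rho> x * (norm (grad (\<zeta> m) x))\<^sup>2) \<le> e\<^sup>2"
      by (intro LIMSEQ_le_const2) auto
    then show ?thesis
      unfolding energy_norm_eq[OF \<zeta>] using e by (intro real_le_lsqrt) auto
  qed
  have "norm (E (\<zeta> m) - 0) < r" if "m \<ge> M" for m
  proof -
    have "E (\<zeta> m) \<ge> 0"
      unfolding energy_norm_eq[OF \<zeta>] by (intro real_sqrt_ge_zero Bochner_Integration.integral_nonneg) (simp add: weight_nonneg)
    then show ?thesis using \<open>r > 0\<close> le_e[OF that] by (simp add: e_def)
  qed
  then show "\<exists>no. \<forall>n\<ge>no. norm (E (\<zeta> n) - 0) < r" by blast
qed

lemma representsD:
  assumes "represents \<rho> \<Omega> \<phi> u"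
  shows "\<phi> n \<in> tests"
    and "e > 0 \<Longrightarrow> \<exists>M. \<forall>m\<ge>M. \<forall>n\<ge>M. E (\<lambda>x. \<phi> m x - \<phi> n x) < e"
    and "compact K \<Longrightarrow> K \<subseteq> \<Omega> \<Longrightarrow> set_integrable lebesgue K u"
    and "compact K \<Longrightarrow> K \<subseteq> \<Omega> \<Longrightarrow> (\<lambda>n. L1_dist K (\<phi> n) u) \<longlonglongrightarrow> 0"
  using assms by (simp_all add: represents_def locally_integrable_on_def)

lemma test_fun_set_integrable:
  assumes "\<phi> \<in> tests" "compact K"
  shows "set_integrable lebesgue K \<phi>"
proof -
  have "integrable lborel (\<lambda>x. indicator K x *\<^sub>R \<phi> x)"
    by (intro borel_integrable_compact assms(2)
         continuous_on_subset[OF test_fun_continuous[OF assms(1)]]) auto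
  then show ?thesis
    unfolding set_integrable_def by (subst integrable_completion) auto
qed

text \<open>The differences of the two sequences are Cauchy in energy and tend to 0 in L1 on compact
  sets, so closability makes their energy vanish.\<close>

lemma represents_energy_limit_unique:
  assumes \<phi>: "represents \<rho> \<Omega> \<phi> u" and \<psi>: "represents \<rho> \<Omega> \<psi> u"
  shows "(\<lambda>n. E (\<phi> n) - E (\<psi> n)) \<longlonglongrightarrow> 0"
proof -
  note tf = representsD(1)[OF \<phi>] representsD(1)[OF \<psi>]
  let ?\<zeta> = "\<lambda>n x. \<phi> n x - \<psi> n x"
  have \<zeta>: "?\<zeta> n \<in> tests" for n by (intro test_functions_diff tf)
  have "(\<lambda>n. E (?\<zeta> n)) \<longlonglongrightarrow> 0"
  proof (rule gradient_closable[OF \<zeta>])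
    fix e :: real assume "e > 0"
    then obtain M1 M2 where
      M1: "\<And>m n. m \<ge> M1 \<Longrightarrow> n \<ge> M1 \<Longrightarrow> E (\<lambda>x. \<phi> m x - \<phi> n x) < e / 2" and
      M2: "\<And>m n. m \<ge> M2 \<Longrightarrow> n \<ge> M2 \<Longrightarrow> E (\<lambda>x. \<psi> m x - \<psi> n x) < e / 2"
      using representsD(2)[OF \<phi> half_gt_zero] representsD(2)[OF \<psi> half_gt_zero] by metis
    have "E (\<lambda>x. ?\<zeta> m x - ?\<zeta> n x) < e" if "m \<ge> max M1 M2" "n \<ge> max M1 M2" for m n
    proof -
      have e: "(\<lambda>x. ?\<zeta> m x - ?\<zeta> n x) = (\<lambda>x. (\<phi> m x - \<phi> n x) - (\<psi> m x - \<psi> n x))" by auto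
      have "E (\<lambda>x. ?\<zeta> m x - ?\<zeta> n x) \<le> E (\<lambda>x. \<phi> m x - \<phi> n x) + E (\<lambda>x. \<psi> m x - \<psi> n x)"
        unfolding e by (intro energy_norm_triangle test_functions_diff tf)
      then show ?thesis using M1[of m n] M2[of m n] that by auto
    qed
    then show "\<exists>M. \<forall>m\<ge>M. \<forall>n\<ge>M. E (\<lambda>x. ?\<zeta> m x - ?\<zeta> n x) < e" by blast
  next
    fix K assume K: "compact K" "K \<subseteq> \<Omega>"
    note si = representsD(3)[OF \<phi> K] test_fun_set_integrable[OF tf(1) K(1)] test_fun_set_integrable[OF tf(2) K(1)]
    show "(\<lambda>n. LINT x:K|lebesgue. \<bar>?\<zeta> n x\<bar>) \<longlonglongrightarrow> 0"
    proof (rule tendsto_sandwich[OF _ _ tendsto_const])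
      show "(\<lambda>n. L1_dist K (\<phi> n) u + L1_dist K (\<psi> n) u) \<longlonglongrightarrow> 0"
        using tendsto_add[OF representsD(4)[OF \<phi> K] representsD(4)[OF \<psi> K]] by simp
      show "\<forall>\<^sub>F n in sequentially. 0 \<le> (LINT x:K|lebesgue. \<bar>?\<zeta> n x\<bar>)"
        by (intro always_eventually allI) (simp add: set_lebesgue_integral_def)
      have i1: "set_integrable lebesgue K (\<lambda>x. \<bar>\<phi> n x - u x\<bar>)" "set_integrable lebesgue K (\<lambda>x. \<bar>\<psi> n x - u x\<bar>)"
        "set_integrable lebesgue K (\<lambda>x. \<bar>?\<zeta> n x\<bar>)" for n
        by (intro set_integrable_abs set_integral_diff si)+
      show "\<forall>\<^sub>F n in sequentially. (LINT x:K|lebesgue. \<bar>?\<zeta> n x\<bar>) \<le>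
          L1_dist K (\<phi> n) u + L1_dist K (\<psi> n) u"
        by (intro always_eventually allI, subst set_integral_add(2)[symmetric])
           (auto intro!: set_integral_mono i1 set_integral_add(1))
    qed
  qed
  then show ?thesis
    by (rule Lim_null_comparison[rotated])
       (simp add: energy_norm_reverse_triangle[OF tf(1) tf(2)])
qed

text \<open>Uniqueness of the limit turns the definite description in \<open>completion_norm\<close>
  into a value that any one representing sequence computes.\<close>

theorem completion_norm_eqI:
  assumes "represents \<rho> \<Omega> \<phi> u" "(\<lambda>n. E (\<phi> n)) \<longlonglongrightarrow> l"
  shows "completion_norm \<rho> \<Omega> u = l"
  unfolding completion_norm_def
proof (rule the_equality)
  show "\<exists>\<phi>. represents \<rho> \<Omega> \<phi> u \<and> (\<lambda>n. E (\<phi> n)) \<longlonglongrightarrow> l"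
    using assms by blast
  fix l' assume "\<exists>\<phi>. represents \<rho> \<Omega> \<phi> u \<and> (\<lambda>n. E (\<phi> n)) \<longlonglongrightarrow> l'"
  then obtain \<psi> where \<psi>: "represents \<rho> \<Omega> \<psi> u" "(\<lambda>n. E (\<psi> n)) \<longlonglongrightarrow> l'" by blast
  have "(\<lambda>n. E (\<psi> n) - E (\<phi> n)) \<longlonglongrightarrow> l' - l"
    by (intro tendsto_diff assms \<psi>)
  with represents_energy_limit_unique[OF \<psi>(1) assms(1)] show "l' = l"
    using LIMSEQ_unique by fastforce
qed

end

section \<open>Smooth radial approximation\<close>

text \<open>For \<open>k = 0\<close> this is the standard smooth function that is flat at 0. The
  powers of \<open>s\<close> in the denominator make the family closed under differentiation up to
  linear combinations.\<close>

definition flat :: "nat \<Rightarrow> real \<Rightarrow> real" where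
  "flat k s = (if s > 0 then exp (- (1 / s)) / s ^ k else 0)"

lemma flat_tendsto_0: "((\<lambda>s. exp (- (1 / s)) / s ^ k) \<longlongrightarrow> (0::real)) (at_right 0)"
proof -
  have "((\<lambda>s. inverse s ^ k / exp (inverse s)) \<longlongrightarrow> (0::real)) (at_right 0)"
    by (rule filterlim_compose[OF tendsto_power_div_exp_0 filterlim_inverse_at_top_right])
  then show ?thesis
    by (simp add: exp_minus inverse_eq_divide power_divide mult.commute)
qed

lemma DERIV_flat: "DERIV (flat k) s :> flat (k + 2) s - real k * flat (k + 1) s"
proof -
  consider "s > 0" | "s < 0" | "s = 0" by linarith
  then show ?thesis
  proof cases
    case 1
    have "DERIV (\<lambda>s. exp (- (1 / s)) / s ^ k) s :> flat (k + 2) s - real k * flat (k + 1) s"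
    proof -
      have pk: "real k * s ^ (k - Suc 0) * s = real k * s ^ k" by (cases k) auto
      have "DERIV (\<lambda>s. exp (- (1 / s)) / s ^ k) s :>
         (exp (- (1 / s)) * (1 / s\<^sup>2) * s ^ k - exp (- (1 / s)) * (real k * s ^ (k - Suc 0))) / (s ^ k * s ^ k)"
        using 1 by (auto intro!: derivative_eq_intros simp: power2_eq_square)
      moreover have "(exp (- (1 / s)) * (1 / s\<^sup>2) * s ^ k - exp (- (1 / s)) * (real k * s ^ (k - Suc 0))) / (s ^ k * s ^ k)
         = exp (- (1 / s)) / s ^ (k + 2) - real k * (exp (- (1 / s)) / s ^ (k + 1))"
        using 1 pk by (cases k) (simp_all add: divide_simps power2_eq_square, simp_all add: algebra_simps)
      ultimately show ?thesis using 1 by (simp add: flat_def)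
    qed
    then show ?thesis
      by (rule has_field_derivative_transform_within_open[where S = "{0<..}"])
         (use 1 in \<open>auto simp: flat_def\<close>)
  next
    case 2
    have "DERIV (\<lambda>s. 0) s :> flat (k + 2) s - real k * flat (k + 1) s"
      using 2 by (simp add: flat_def)
    then show ?thesis
      by (rule has_field_derivative_transform_within_open[where S = "{..<0}"])
         (use 2 in \<open>auto simp: flat_def\<close>)
  next
    case 3
    have "((\<lambda>y. flat k y / y) \<longlongrightarrow> 0) (at 0)"
    proof (rule filterlim_split_at)
      show "((\<lambda>y. flat k y / y) \<longlongrightarrow> 0) (at_left 0)"
        by (rule tendsto_eventually) (auto simp: flat_def eventually_at_left[of "-1"] intro!: exI[of _ "-1"])
      \<comment> \<open>The right-hand difference quotient of \<open>flat k\<close> at 0 is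
        \<open>flat (k + 1)\<close>.\<close>
      show "((\<lambda>y. flat k y / y) \<longlongrightarrow> 0) (at_right 0)"
        using flat_tendsto_0[of "k + 1"]
        by (rule Lim_transform_eventually)
           (auto simp: flat_def eventually_at_right[of _ 1] mult.commute intro!: exI[of _ 1])
    qed
    then show ?thesis
      using 3 by (simp add: has_field_derivative_iff flat_def)
  qed
qed

lemma continuous_on_flat [continuous_intros]:
  assumes "continuous_on S f"
  shows "continuous_on S (\<lambda>x. flat k (f x))"
proof -
  have "continuous_on UNIV (flat k)"
    by (rule DERIV_continuous_on) (rule has_field_derivative_at_within[OF DERIV_flat])
  then show ?thesis using assms by (rule continuous_on_compose2) simp
qed

lemma flat_pos: "s > 0 \<Longrightarrow> flat 0 s > 0"
  and flat_nonneg: "0 \<le> flat 0 s"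
  and flat_le_1: "flat 0 s \<le> 1"
  and flat_eq_0: "s \<le> 0 \<Longrightarrow> flat k s = 0"
  by (auto simp: flat_def)

text \<open>A class of functions large enough for our radial approximants and closed under partial
  derivatives; hence all its members satisfy every \<open>C_k\<close>.\<close>

inductive smooth :: "('a::euclidean_space \<Rightarrow> real) \<Rightarrow> bool" where
  const: "smooth (\<lambda>x. c)"
| coord: "smooth (\<lambda>x. inner x i)"
| flat: "smooth (\<lambda>x. flat k (c + d * inner x x))"
| prim: "smooth (\<lambda>x. \<gamma> (inner x x)) \<Longrightarrow> (\<And>s. DERIV \<Gamma> s :> \<gamma> s) \<Longrightarrow> smooth (\<lambda>x. \<Gamma> (inner x x))"
| add: "smooth f \<Longrightarrow> smooth g \<Longrightarrow> smooth (\<lambda>x. f x + g x)"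
| mult: "smooth f \<Longrightarrow> smooth g \<Longrightarrow> smooth (\<lambda>x. f x * g x)"

lemmas smooth_intros = smooth.const smooth.coord smooth.flat smooth.add smooth.mult

lemma smooth_minus: "smooth f \<Longrightarrow> smooth (\<lambda>x. - f x)"
  using smooth.mult[OF smooth.const[of "-1"]] by fastforce

lemma smooth_sum:
  assumes "finite A" "\<And>i. i \<in> A \<Longrightarrow> smooth (f i)"
  shows "smooth (\<lambda>x. \<Sum>i\<in>A. f i x)"
  using assms by (induction A rule: finite_induct) (auto intro: smooth_intros)

lemma smooth_inner_self: "smooth (\<lambda>x. inner x x)"
proof -
  have "(\<lambda>x::'a. inner x x) = (\<lambda>x. \<Sum>i\<in>Basis. inner x i * inner x i)"
    by (rule ext) (rule euclidean_inner)
  then show ?thesis by (simp only:) (intro smooth_sum smooth.mult smooth.coord finite_Basis)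
qed

lemma smooth_polynomial:
  fixes q :: "real \<Rightarrow> real"
  assumes "real_polynomial_function q"
  shows "smooth (\<lambda>x. q (inner x x))"
  using assms
proof (induction rule: real_polynomial_function.induct)
  case (linear f)
  then obtain c where "f = (\<lambda>x. x * c)" by (auto simp: real_bounded_linear)
  then show ?case by (auto intro: smooth_intros smooth_inner_self)
qed (auto intro: smooth_intros)

lemma GDERIV_inner_self: "GDERIV (\<lambda>x. inner x x) x :> 2 *\<^sub>R x"
  unfolding gderiv_def
  by (rule has_derivative_eq_rhs, (rule derivative_intros)+) (auto simp: inner_commute)

lemma smooth_GDERIV:
  fixes f :: "'a::euclidean_space \<Rightarrow> real"
  assumes "smooth f"
  shows "\<exists>D. (\<forall>x. GDERIV f x :> D x) \<and> (\<forall>i\<in>Basis. smooth (\<lambda>x. inner (D x) i))"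
  using assms
proof (induction rule: smooth.induct)
  case (const c)
  show ?case
    by (intro exI[of _ "\<lambda>_. 0"] conjI allI GDERIV_const) (auto intro: smooth.const)
next
  case (coord i)
  show ?case
    by (rule exI[of _ "\<lambda>_. i"])
       (auto intro: smooth.const simp: gderiv_def intro!: derivative_eq_intros)
next
  case (flat k c d)
  let ?D = "\<lambda>x::'a. (flat (k + 2) (c + d * inner x x) - real k * flat (k + 1) (c + d * inner x x)) *\<^sub>R (0 + (d *\<^sub>R (2 *\<^sub>R x) + inner x x *\<^sub>R 0))"
  have "GDERIV (\<lambda>x. flat k (c + d * inner x x)) x :> ?D x" for x
    by (intro GDERIV_DERIV_compose DERIV_flat GDERIV_add GDERIV_const GDERIV_mult GDERIV_inner_self)
  moreover have "smooth (\<lambda>x. inner (?D x) i)" for i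
  proof -
    have "smooth (\<lambda>x::'a. (flat (k + 2) (c + d * inner x x) + (- real k) * flat (k + 1) (c + d * inner x x)) * ((2 * d) * inner x i))"
      by (intro smooth_intros)
    moreover have "inner (?D x) i = (flat (k + 2) (c + d * inner x x) + (- real k) * flat (k + 1) (c + d * inner x x)) * ((2 * d) * inner x i)" for x
      by (simp add: algebra_simps)
    ultimately show ?thesis by (simp only:)
  qed
  ultimately show ?case by (intro exI[of _ ?D] conjI allI ballI)
next
  case (prim \<gamma> \<Gamma>)
  have "GDERIV (\<lambda>x. \<Gamma> (inner x x)) x :> \<gamma> (inner x x) *\<^sub>R (2 *\<^sub>R x)" for x :: 'a
    by (intro GDERIV_DERIV_compose prim GDERIV_inner_self)
  moreover have "smooth (\<lambda>x::'a. inner (\<gamma> (inner x x) *\<^sub>R (2 *\<^sub>R x)) i)" for i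
    by (simp add: mult.assoc, intro smooth_intros prim)
  ultimately show ?case
    by (intro exI[of _ "\<lambda>x. \<gamma> (inner x x) *\<^sub>R (2 *\<^sub>R x)"] conjI allI ballI)
next
  case (add f g)
  then obtain D E where
    "\<And>x. GDERIV f x :> D x" "\<And>i. i \<in> Basis \<Longrightarrow> smooth (\<lambda>x. inner (D x) i)"
    "\<And>x. GDERIV g x :> E x" "\<And>i. i \<in> Basis \<Longrightarrow> smooth (\<lambda>x. inner (E x) i)" by blast
  then show ?case
    by (intro exI[of _ "\<lambda>x. D x + E x"]) (auto intro!: GDERIV_add smooth.add simp: inner_add_left)
next
  case (mult f g)
  then obtain D E where
    "\<And>x. GDERIV f x :> D x" "\<And>i. i \<in> Basis \<Longrightarrow> smooth (\<lambda>x. inner (D x) i)"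
    "\<And>x. GDERIV g x :> E x" "\<And>i. i \<in> Basis \<Longrightarrow> smooth (\<lambda>x. inner (E x) i)" by blast
  with mult(1,2) show ?case
    by (intro exI[of _ "\<lambda>x. f x *\<^sub>R E x + g x *\<^sub>R D x"])
       (auto intro!: GDERIV_mult smooth.add smooth.mult simp: inner_add_left)
qed

lemma smooth_C_k: "smooth f \<Longrightarrow> C_k k f"
proof (induction k arbitrary: f)
  case 0
  from smooth_GDERIV[OF this] have "f differentiable (at x)" for x
    using gderiv_differentiable by blast
  then show ?case
    by (simp add: continuous_on_eq_continuous_at differentiable_imp_continuous_within)
next
  case (Suc k)
  obtain D where D: "\<And>x. GDERIV f x :> D x" "\<And>i. i \<in> Basis \<Longrightarrow> smooth (\<lambda>x. inner (D x) i)"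
    using smooth_GDERIV[OF Suc.prems] by blast
  then have "grad f x = D x" for x by (intro grad_eq)
  then show ?case
    using D Suc.IH gderiv_differentiable[OF D(1)] by simp
qed

section \<open>Compactly supported profiles and their primitives\<close>

text \<open>Here \<open>g\<close> plays the role of the derivative of a radial function. Support in
  \<open>{a..b}\<close> with \<open>0 < a\<close> makes the primitive constant near the origin, and
  \<open>b < T\<close> makes it vanish near the boundary; the extended real \<open>T\<close> admits
  an infinite radius.\<close>

definition Cc :: "ereal \<Rightarrow> (real \<Rightarrow> real) set" where
  "Cc T = {g. continuous_on UNIV g \<and> (\<exists>a b. 0 < a \<and> a < b \<and> ereal b < T \<and> (\<forall>s. s \<notin> {a..b} \<longrightarrow> g s = 0))}"

text \<open>Integrating from the outer end builds in the zero boundary value at \<open>T\<close>;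
  the function with derivative \<open>g\<close> is \<open>- tail g\<close>.\<close>

definition tail :: "(real \<Rightarrow> real) \<Rightarrow> real \<Rightarrow> real" where
  "tail g r = (LINT s:{r..}|lborel. g s)"

definition wenergy :: "(real \<Rightarrow> real) \<Rightarrow> (real \<Rightarrow> real) \<Rightarrow> real" where
  "wenergy p g = (LINT s|lborel. p s * (g s)\<^sup>2)"

abbreviation wnorm :: "(real \<Rightarrow> real) \<Rightarrow> (real \<Rightarrow> real) \<Rightarrow> real" where
  "wnorm p f \<equiv> sqrt (wenergy p f)"

abbreviation wdist :: "(real \<Rightarrow> real) \<Rightarrow> (real \<Rightarrow> real) \<Rightarrow> (real \<Rightarrow> real) \<Rightarrow> real" where
  "wdist p f h \<equiv> wnorm p (\<lambda>s. f s - h s)"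

lemma CcD:
  assumes "g \<in> Cc T"
  shows "continuous_on UNIV g" and "\<exists>a b. 0 < a \<and> a < b \<and> ereal b < T \<and> (\<forall>s. s \<notin> {a..b} \<longrightarrow> g s = 0)"
  using assms by (auto simp: Cc_def)

lemma Cc_eventually_0:
  assumes "g \<in> Cc T"
  obtains b where "\<And>s. s > b \<Longrightarrow> g s = 0"
  using CcD(2)[OF assms] by (metis atLeastAtMost_iff not_le)

lemma Cc_measurable: "g \<in> Cc T \<Longrightarrow> g \<in> borel_measurable borel"
  by (auto dest!: CcD(1) intro: borel_measurable_continuous_onI)

lemma Cc_integrable:
  assumes "g \<in> Cc T" "continuous_on UNIV p"
  shows "integrable lborel (\<lambda>s. p s * g s)"
proof -
  obtain a b where ab: "\<And>s. s \<notin> {a..b} \<Longrightarrow> g s = 0" using CcD(2)[OF assms(1)] by blast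
  show ?thesis
    by (rule continuous_compact_support(1)[of _ "{a..b}"])
       (auto intro!: continuous_intros assms CcD[OF assms(1)] simp: ab)
qed

lemma Cc_integrable_mult:
  assumes "g \<in> Cc T" "h \<in> Cc T" "continuous_on UNIV p"
  shows "integrable lborel (\<lambda>s. p s * (g s * h s))"
proof -
  have "integrable lborel (\<lambda>s. (p s * h s) * g s)"
    by (intro Cc_integrable[OF assms(1)] continuous_intros assms CcD[OF assms(2)])
  then show ?thesis by (simp add: mult_ac)
qed

lemma Cc_diff:
  assumes "g \<in> Cc T" "h \<in> Cc T"
  shows "(\<lambda>s. g s - h s) \<in> Cc T"
proof -
  obtain a b where ab: "0 < a" "a < b" "ereal b < T" "\<And>s. s \<notin> {a..b} \<Longrightarrow> g s = 0"
    using CcD(2)[OF assms(1)] by blast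
  obtain c d where cd: "0 < c" "c < d" "ereal d < T" "\<And>s. s \<notin> {c..d} \<Longrightarrow> h s = 0"
    using CcD(2)[OF assms(2)] by blast
  have "g s - h s = 0" if "s \<notin> {min a c..max b d}" for s
    using ab(4)[of s] cd(4)[of s] that by (auto simp: min_le_iff_disj le_max_iff_disj)
  moreover have "0 < min a c" "min a c < max b d" "ereal (max b d) < T"
    using ab cd by (auto simp: max_def)
  moreover have "continuous_on UNIV (\<lambda>s. g s - h s)"
    by (intro continuous_intros CcD[OF assms(1)] CcD[OF assms(2)])
  ultimately show ?thesis unfolding Cc_def by blast
qed

lemma
  assumes "continuous_on UNIV g" "\<And>s. s > b \<Longrightarrow> g s = 0"
  shows tail_eq_integral: "b \<le> c \<Longrightarrow> tail g r = integral {r..c} g"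
    and tail_integrable: "set_integrable lborel {r..} g"
    and tail_eq_0: "r > b \<Longrightarrow> tail g r = 0"
proof -
  have eq: "indicator {r..} s *\<^sub>R g s = indicator {r..c} s *\<^sub>R g s" if "b \<le> c" for s c
    using assms(2)[of s] that by (auto simp: indicator_def)
  have si: "set_integrable lborel {r..c} g" for c
    by (intro borel_integrable_atLeastAtMost' continuous_on_subset[OF assms(1)]) auto
  show "tail g r = integral {r..c} g" if "b \<le> c"
    using set_borel_integral_eq_integral(2)[OF si, of c]
    by (simp only: tail_def set_lebesgue_integral_def eq[OF that])
  show "set_integrable lborel {r..} g"
    using si[of b] by (simp only: set_integrable_def eq[OF order_refl])
  show "tail g r = 0" if "r > b"
    using that unfolding tail_def set_lebesgue_integral_def eq[OF order_refl] by simp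
qed

lemma DERIV_tail:
  assumes "continuous_on UNIV g" "\<And>s. s > b \<Longrightarrow> g s = 0"
  shows "DERIV (tail g) r :> - g r"
proof -
  let ?c = "max b r + 1"
  have "((\<lambda>x. integral {x..?c} g) has_real_derivative - g r) (at r within {r - 1..?c})"
    by (intro integral_has_real_derivative' continuous_on_subset[OF assms(1)]) auto
  then have "((\<lambda>x. integral {x..?c} g) has_real_derivative - g r) (at r)"
    by (subst (asm) at_within_interior) auto
  moreover have "tail g = (\<lambda>x. integral {x..?c} g)"
    using tail_eq_integral[OF assms, of ?c] by fastforce
  ultimately show ?thesis by simp
qed

lemma tail_diff:
  assumes "g \<in> Cc T" "h \<in> Cc T"
  shows "tail (\<lambda>s. g s - h s) r = tail g r - tail h r"
proof -
  obtain b where ab: "\<And>s. s > b \<Longrightarrow> g s = 0" using Cc_eventually_0[OF assms(1)] by blast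
  obtain d where cd: "\<And>s. s > d \<Longrightarrow> h s = 0" using Cc_eventually_0[OF assms(2)] by blast
  show ?thesis unfolding tail_def
    by (intro set_integral_diff tail_integrable[OF _ ab] tail_integrable[OF _ cd] CcD[OF assms(1)] CcD[OF assms(2)])
qed

text \<open>Both sides have derivative \<open>- 2 * r * \<gamma> (r\<^sup>2)\<close> for
  \<open>r \<ge> 0\<close>, and both vanish for large \<open>r\<close>. The \<open>max\<close> keeps
  the integrand continuous and makes it zero for negative \<open>s\<close>.\<close>

lemma tail_square_substitution:
  assumes "continuous_on UNIV \<gamma>" "\<And>s. s > b \<Longrightarrow> \<gamma> s = 0" "0 \<le> r"
  shows "tail (\<lambda>s. 2 * max s 0 * \<gamma> (s\<^sup>2)) r = tail \<gamma> (r\<^sup>2)"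
proof -
  let ?g = "\<lambda>s. 2 * max s 0 * \<gamma> (s\<^sup>2)"
  define c where "c = max b 0 + 1"
  have cont: "continuous_on UNIV ?g"
    by (intro continuous_intros continuous_on_compose2[OF assms(1)]) auto
  have z: "?g s = 0" if "s > c" for s
  proof -
    have "s \<ge> 1" "s > b" using that by (auto simp: c_def)
    then have "s\<^sup>2 > b" using self_le_power[of s 2] by auto
    then show ?thesis using assms(2) by simp
  qed
  have "\<exists>k. \<forall>x\<in>{0..}. tail ?g x - tail \<gamma> (x\<^sup>2) = k"
  proof (rule has_field_derivative_zero_constant)
    fix x :: real assume "x \<in> {0..}"
    then have "DERIV (\<lambda>x. tail ?g x - tail \<gamma> (x\<^sup>2)) x :> 0"
      by (auto intro!: derivative_eq_intros DERIV_tail[OF cont z] DERIV_chain2[OF DERIV_tail[OF assms(1,2)]])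
    then show "((\<lambda>x. tail ?g x - tail \<gamma> (x\<^sup>2)) has_real_derivative 0) (at x within {0..})"
      by (rule has_field_derivative_at_within)
  qed auto
  then obtain k where k: "\<And>x. x \<ge> 0 \<Longrightarrow> tail ?g x - tail \<gamma> (x\<^sup>2) = k" by auto
  \<comment> \<open>Since \<open>c + 1\<close> is at least 1, squaring it does not bring it below
    \<open>b\<close>.\<close>
  have "c + 1 \<ge> 1" "c + 1 > b" by (auto simp: c_def)
  then have "(c + 1)\<^sup>2 > b" using self_le_power[of "c + 1" 2] by auto
  then have "tail \<gamma> ((c + 1)\<^sup>2) = 0" by (intro tail_eq_0[OF assms(1,2)])
  moreover have "tail ?g (c + 1) = 0" by (rule tail_eq_0[OF cont z]) auto
  ultimately have "k = 0"
    using k[of "c + 1"] \<open>c + 1 \<ge> 1\<close> by simp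
  then show ?thesis using k assms(3) by simp
qed

text \<open>Dividing \<open>g\<close> by \<open>2 * s\<close> and by a bump in
  \<open>s\<^sup>2\<close> leaves a continuous function of \<open>s\<^sup>2\<close>, which a
  polynomial approximates uniformly. The interval \<open>{a..b}\<close> is fixed before
  \<open>\<epsilon>\<close>, so a small sup norm of the error also means small weighted
  energy.\<close>

lemma Cc_smooth_approx:
  assumes g: "g \<in> Cc T"
  obtains a b where "0 < a" "a < b" "ereal b < T"
    "\<And>\<epsilon>. \<epsilon> > 0 \<Longrightarrow> \<exists>h\<in>Cc T. (\<forall>s. \<bar>g s - h s\<bar> \<le> \<epsilon>) \<and> (\<forall>s. s \<notin> {a..b} \<longrightarrow> g s - h s = 0) \<and>
        smooth (\<lambda>x::'a::euclidean_space. tail h (norm x))"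
proof -
  obtain a0 b0 where ab0: "0 < a0" "a0 < b0" "ereal b0 < T" "\<And>s. s \<notin> {a0..b0} \<Longrightarrow> g s = 0"
    using CcD(2)[OF g] by blast
  \<comment> \<open>The support is enlarged on both sides, so that the bump, which lives on
    \<open>{a\<^sup>2..b\<^sup>2}\<close>, is strictly positive on the squares of the old
    support.\<close>
  obtain b where b: "b0 < b" "ereal b < T"
    using ereal_dense2[OF ab0(3)] by auto
  define a where "a = a0 / 2"
  have a: "0 < a" "a < a0" using ab0 by (auto simp: a_def)
  have sq: "s\<^sup>2 \<in> {c\<^sup>2..d\<^sup>2} \<longleftrightarrow> s \<in> {c..d}" if "s \<ge> 0" "c \<ge> 0" "d \<ge> 0" for s c d :: real
    using that by (auto simp: power_mono_iff)
  define bump where "bump \<tau> = flat 0 (- a\<^sup>2 + \<tau>) * flat 0 (b\<^sup>2 - \<tau>)" for \<tau>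
  have bump: "0 \<le> bump \<tau>" "bump \<tau> \<le> 1" for \<tau>
    unfolding bump_def using flat_nonneg flat_le_1 by (auto intro: mult_le_one)
  have bump0: "bump \<tau> = 0" if "\<tau> \<notin> {a\<^sup>2..b\<^sup>2}" for \<tau>
    using that by (auto simp: bump_def flat_eq_0)
  have cbump: "continuous_on S bump" for S
    unfolding bump_def by (intro continuous_intros)
  have "\<exists>\<tau>0\<in>{a0\<^sup>2..b0\<^sup>2}. \<forall>\<tau>\<in>{a0\<^sup>2..b0\<^sup>2}. bump \<tau>0 \<le> bump \<tau>"
    using ab0 by (intro continuous_attains_inf cbump) auto
  then obtain \<tau>0 where \<tau>0: "\<tau>0 \<in> {a0\<^sup>2..b0\<^sup>2}" "\<And>\<tau>. \<tau> \<in> {a0\<^sup>2..b0\<^sup>2} \<Longrightarrow> bump \<tau>0 \<le> bump \<tau>" by blast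
  define m where "m = bump \<tau>0"
  have "a\<^sup>2 < a0\<^sup>2" "b0\<^sup>2 < b\<^sup>2" using a b ab0 by (auto intro!: power_strict_mono)
  then have m: "m > 0" using \<tau>0(1) unfolding m_def bump_def by (intro mult_pos_pos flat_pos) auto
  \<comment> \<open>The floor \<open>m\<close>, the minimum of the bump over
    \<open>{a0\<^sup>2..b0\<^sup>2}\<close>, changes nothing where \<open>g\<close> is nonzero and
    avoids division by 0 at the ends of the larger interval.\<close>
  define f where "f \<tau> = g (sqrt \<tau>) / (2 * sqrt \<tau>) / max (bump \<tau>) m" for \<tau>
  have cf: "continuous_on {a\<^sup>2..b\<^sup>2} f"
  proof -
    have "sqrt \<tau> \<noteq> 0" if "\<tau> \<in> {a\<^sup>2..b\<^sup>2}" for \<tau>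
      using that a by (auto dest: order.strict_trans2[of 0 "a\<^sup>2"])
    then show ?thesis
      unfolding f_def using m
      by (intro continuous_intros cbump continuous_on_compose2[OF CcD(1)[OF g]]) 
         (auto simp: max_def)
  qed
  have fg: "2 * s * (f (s\<^sup>2) * bump (s\<^sup>2)) = g s" if "s > 0" for s
  proof (cases "s \<in> {a0..b0}")
    case True
    then have "s\<^sup>2 \<in> {a0\<^sup>2..b0\<^sup>2}" using ab0 by (auto simp: power_mono_iff)
    from \<tau>0(2)[OF this] have "max (bump (s\<^sup>2)) m = bump (s\<^sup>2)" "bump (s\<^sup>2) > 0"
      using m by (simp_all add: m_def max_absorb1)
    then show ?thesis using that by (simp add: f_def)
  next
    case False
    then show ?thesis using that ab0 by (simp add: f_def)
  qed
  show ?thesis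
  proof (rule that[of a b])
    show "0 < a" "a < b" "ereal b < T" using a b ab0 by auto
    have bpos: "b > 0" using a b ab0 by auto
    fix \<epsilon> :: real assume \<epsilon>: "\<epsilon> > 0"
    \<comment> \<open>The factor \<open>2 * b\<close> is the largest value of \<open>2 * s\<close>
      in \<open>{a..b}\<close>, and the bump is at most 1.\<close>
    obtain q where q: "real_polynomial_function q" "\<And>\<tau>. \<tau> \<in> {a\<^sup>2..b\<^sup>2} \<Longrightarrow> \<bar>f \<tau> - q \<tau>\<bar> < \<epsilon> / (2 * b)"
      using Stone_Weierstrass_real_polynomial_function[OF compact_Icc cf, of "\<epsilon> / (2 * b)"] \<epsilon> bpos by auto
    define \<gamma> where "\<gamma> \<tau> = q \<tau> * bump \<tau>" for \<tau>
    define h where "h s = 2 * max s 0 * \<gamma> (s\<^sup>2)" for s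
    have cq: "continuous_on UNIV q"
      using q(1) by (simp add: continuous_on_polymonial_function real_polynomial_function_eq)
    have c\<gamma>: "continuous_on UNIV \<gamma>"
      unfolding \<gamma>_def by (intro continuous_intros cq cbump)
    have z\<gamma>: "\<gamma> \<tau> = 0" if "\<tau> > b\<^sup>2" for \<tau> using that bump0 by (simp add: \<gamma>_def)
    have h0: "h s = 0" if "s \<notin> {a..b}" for s
    proof (cases "s > 0")
      case True
      then have "s\<^sup>2 \<notin> {a\<^sup>2..b\<^sup>2}" using that sq[of s a b] a bpos by auto
      then show ?thesis by (simp add: h_def \<gamma>_def bump0)
    qed (simp add: h_def)
    have hCc: "h \<in> Cc T"
    proof -
      have "continuous_on UNIV h"
        unfolding h_def by (intro continuous_intros continuous_on_compose2[OF c\<gamma>]) auto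
      then show ?thesis using h0 a b ab0 unfolding Cc_def
        by (intro CollectI conjI exI[of _ a] exI[of _ b]) auto
    qed
    have g0: "g s = 0" if "s \<notin> {a..b}" for s
      using that a b ab0(4)[of s] by auto
    have "\<bar>g s - h s\<bar> \<le> \<epsilon>" for s
    proof (cases "s \<in> {a..b}")
      case True
      then have s: "s > 0" "s \<le> b" using a by auto
      have "s\<^sup>2 \<in> {a\<^sup>2..b\<^sup>2}" using True sq[of s a b] a s by auto
      note qs = q(2)[OF this]
      have "g s - h s = 2 * s * bump (s\<^sup>2) * (f (s\<^sup>2) - q (s\<^sup>2))"
        using fg[OF s(1), symmetric] s by (simp add: h_def \<gamma>_def max_def algebra_simps)
      also have "\<bar>\<dots>\<bar> = 2 * s * bump (s\<^sup>2) * \<bar>f (s\<^sup>2) - q (s\<^sup>2)\<bar>"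
        using s bump(1)[of "s\<^sup>2"] by (simp add: abs_mult)
      also have "\<dots> \<le> 2 * b * 1 * (\<epsilon> / (2 * b))"
        using s bump[of "s\<^sup>2"] qs \<epsilon> bpos by (intro mult_mono) auto
      also have "\<dots> = \<epsilon>" using bpos by simp
      finally show ?thesis .
    next
      case False
      then show ?thesis using g0 h0 \<epsilon> by simp
    qed
    moreover have "smooth (\<lambda>x::'a. tail h (norm x))"
    proof -
      have "smooth (\<lambda>x::'a. \<gamma> (inner x x))"
      proof -
        have "smooth (\<lambda>x::'a. flat 0 (b\<^sup>2 + (- 1) * inner x x))" by (rule smooth.flat)
        moreover have "smooth (\<lambda>x::'a. flat 0 (- a\<^sup>2 + 1 * inner x x))" by (rule smooth.flat)
        ultimately show ?thesis
          unfolding \<gamma>_def bump_def using smooth_polynomial[OF q(1)]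
          by (intro smooth.mult) auto
      qed
      then have "smooth (\<lambda>x::'a. - \<gamma> (inner x x))" by (rule smooth_minus)
      then have "smooth (\<lambda>x::'a. tail \<gamma> (inner x x))"
        by (rule smooth.prim[where \<gamma> = "\<lambda>s. - \<gamma> s"]) (rule DERIV_tail[OF c\<gamma> z\<gamma>])
      moreover have "tail h (norm x) = tail \<gamma> (inner x x)" for x :: 'a
        unfolding h_def power2_norm_eq_inner[symmetric]
        by (rule tail_square_substitution[OF c\<gamma> z\<gamma>]) auto
      ultimately show ?thesis by simp
    qed
    ultimately show "\<exists>h\<in>Cc T. (\<forall>s. \<bar>g s - h s\<bar> \<le> \<epsilon>) \<and> (\<forall>s. s \<notin> {a..b} \<longrightarrow> g s - h s = 0) \<and>
        smooth (\<lambda>x::'a. tail h (norm x))"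
      using hCc g0 h0 by (intro bexI[of _ h]) auto
  qed
qed

section \<open>Radial profiles generate elements of the completion\<close>

text \<open>Completeness is what makes this true, since \<open>g\<close> may differ from
  \<open>f\<close> arbitrarily on a null set. It is meant for a function that is known merely as an
  almost everywhere limit of test functions.\<close>

lemma borel_measurable_completion_cong_AE:
  fixes f g :: "'c \<Rightarrow> real"
  assumes f: "f \<in> borel_measurable M" and eq: "AE x in M. f x = g x"
  shows "g \<in> borel_measurable (completion M)"
proof (rule measurableI)
  fix S :: "real set" assume S: "S \<in> sets borel"
  have A: "f -` S \<inter> space M \<in> sets (completion M)"
    using measurable_sets[OF f S] by (rule sets_completionI_sets)
  have ae: "AE x in completion M. x \<in> f -` S \<inter> space M \<longleftrightarrow> x \<in> g -` S \<inter> space M"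
    using AE_completion[OF eq] by eventually_elim auto
  have "g -` S \<inter> space M \<in> sets (completion M)"
    by (rule completion.in_sets_AE[OF ae A]) simp
  then show "g -` S \<inter> space (completion M) \<in> sets (completion M)" by simp
qed auto

lemma Cc_square_integrable:
  assumes "g \<in> Cc T" "continuous_on UNIV p"
  shows "integrable lborel (\<lambda>s. p s * (g s)\<^sup>2)"
  using Cc_integrable_mult[OF assms(1,1,2)] by (simp add: power2_eq_square)

text \<open>Radial derivatives of spherical means end at a finite radius but need not vanish near 0,
  so they may lie outside \<open>Cc\<close>. The energy estimates are proved for this larger class,
  with a weight that is 0 on the negative axis.\<close>

definition vanishing :: "(real \<Rightarrow> real) set" where
  "vanishing = {f. continuous_on UNIV f \<and> (\<exists>b. \<forall>s>b. f s = 0)}"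

lemma vanishing_diff:
  assumes "f \<in> vanishing" "h \<in> vanishing"
  shows "(\<lambda>s. f s - h s) \<in> vanishing"
proof -
  obtain b c where "\<forall>s>b. f s = 0" "\<forall>s>c. h s = 0" using assms by (auto simp: vanishing_def)
  then have "\<forall>s>max b c. f s - h s = 0" by simp
  moreover have "continuous_on UNIV (\<lambda>s. f s - h s)"
    using assms by (auto simp: vanishing_def intro!: continuous_intros)
  ultimately show ?thesis unfolding vanishing_def by blast
qed

lemma Cc_vanishing: "g \<in> Cc T \<Longrightarrow> g \<in> vanishing"
  unfolding vanishing_def using CcD(1) Cc_eventually_0 by blast

lemma wenergy_nonneg: "(\<And>s. 0 \<le> p s) \<Longrightarrow> 0 \<le> wenergy p g"
  unfolding wenergy_def by (intro Bochner_Integration.integral_nonneg) simp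

lemma wenergy_diff_commute: "wenergy p (\<lambda>s. g s - h s) = wenergy p (\<lambda>s. h s - g s)"
  by (simp add: wenergy_def power2_commute)

definition wcauchy :: "(real \<Rightarrow> real) \<Rightarrow> (nat \<Rightarrow> real \<Rightarrow> real) \<Rightarrow> bool" where
  "wcauchy p g \<longleftrightarrow> (\<forall>e>0. \<exists>M. \<forall>m\<ge>M. \<forall>n\<ge>M. wdist p (g m) (g n) < e)"

context
  fixes p :: "real \<Rightarrow> real"
  assumes p_cont: "continuous_on UNIV p" and p_nonneg: "\<And>s. 0 \<le> p s"
    and p_zero: "\<And>s. s \<le> 0 \<Longrightarrow> p s = 0"
begin

lemma vanishing_integrable:
  assumes "f \<in> vanishing" "h \<in> vanishing"
  shows "integrable lborel (\<lambda>s. p s * (f s * h s))"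
proof -
  obtain b where "\<And>s. s > b \<Longrightarrow> f s = 0" using assms(1) by (auto simp: vanishing_def)
  then show ?thesis using assms
    by (intro continuous_compact_support(1)[of _ "{0..b}"] continuous_intros p_cont)
       (auto simp: vanishing_def not_le p_zero)
qed

lemma vanishing_square_integrable: "f \<in> vanishing \<Longrightarrow> integrable lborel (\<lambda>s. p s * (f s)\<^sup>2)"
  using vanishing_integrable[of f f] by (simp add: power2_eq_square)

lemma sqrt_wenergy_diff_le:
  assumes "g \<in> vanishing" "h \<in> vanishing"
  shows "wdist p g h \<le> wnorm p g + wnorm p h"
  using weighted_norm_triangle[of lborel p g h] vanishing_square_integrable[OF assms(1)]
    vanishing_square_integrable[OF assms(2)] vanishing_integrable[OF assms]
  by (simp add: wenergy_def p_nonneg)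

lemma sqrt_wenergy_triangle:
  assumes "g \<in> vanishing" "h \<in> vanishing" "k \<in> vanishing"
  shows "wdist p g k \<le> wdist p g h + wdist p h k"
  using sqrt_wenergy_diff_le[OF vanishing_diff[OF assms(1,2)] vanishing_diff[OF assms(3,2)]]
    wenergy_diff_commute[of p k h] by simp

lemma sqrt_wenergy_reverse_triangle:
  assumes "g \<in> vanishing" "h \<in> vanishing"
  shows "\<bar>wnorm p g - wnorm p h\<bar> \<le> wdist p g h"
proof -
  have "sqrt (wenergy p f) \<le> wdist p f k + wnorm p k"
    if "f \<in> vanishing" "k \<in> vanishing" for f k
  proof -
    have z: "(\<lambda>s. 0) \<in> vanishing" using vanishing_diff[OF that(1,1)] by simp
    then show ?thesis using sqrt_wenergy_triangle[OF that z] by simp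
  qed
  from this[OF assms] this[OF assms(2,1)] show ?thesis
    using arg_cong[OF wenergy_diff_commute[of p g h], of sqrt] by linarith
qed

text \<open>A three-term triangle estimate. It serves twice: when profiles are smoothed, and when
  radial derivatives are cut off near the origin.\<close>

lemma wcauchy_perturb:
  assumes f: "\<And>n. f n \<in> vanishing" and h: "\<And>n. h n \<in> vanishing"
    and cauchy: "wcauchy p f" and small: "\<And>n. wdist p (f n) (h n) \<le> 1 / real (Suc n)"
  shows "wcauchy p h"
  unfolding wcauchy_def
proof (intro allI impI)
  have inv0: "(\<lambda>n. 1 / real (Suc n)) \<longlonglongrightarrow> 0" by (rule LIMSEQ_Suc[OF lim_1_over_n])
  fix e :: real assume e: "e > 0"
  obtain M1 where M1: "\<And>m n. m \<ge> M1 \<Longrightarrow> n \<ge> M1 \<Longrightarrow> wdist p (f m) (f n) < e / 3"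
    using cauchy e unfolding wcauchy_def by (meson divide_pos_pos zero_less_numeral)
  have "\<forall>\<^sub>F n in sequentially. 1 / real (Suc n) < e / 3"
    using order_tendstoD(2)[OF inv0, of "e / 3"] e by simp
  then obtain M2 where M2: "\<And>n. n \<ge> M2 \<Longrightarrow> 1 / real (Suc n) < e / 3"
    by (auto simp: eventually_sequentially)
  have "wdist p (h m) (h n) < e" if "m \<ge> max M1 M2" "n \<ge> max M1 M2" for m n
  proof -
    have "wdist p (h m) (h n) \<le> wdist p (h m) (f m) + wdist p (f m) (h n)"
      by (rule sqrt_wenergy_triangle[OF h f h])
    moreover have "wdist p (f m) (h n) \<le> wdist p (f m) (f n) + wdist p (f n) (h n)"
      by (rule sqrt_wenergy_triangle[OF f f h])
    moreover have "wenergy p (\<lambda>s. h m s - f m s) = wenergy p (\<lambda>s. f m s - h m s)"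
      by (rule wenergy_diff_commute)
    ultimately show ?thesis
      using small[of m] small[of n] M1[of m n] M2[of m] M2[of n] that by simp
  qed
  then show "\<exists>M. \<forall>m\<ge>M. \<forall>n\<ge>M. wdist p (h m) (h n) < e" by blast
qed

lemma wenergy_le_sup_bound:
  assumes g: "g \<in> Cc T" and e: "\<And>s. \<bar>g s\<bar> \<le> e" and z: "\<And>s. s \<notin> {a..b} \<Longrightarrow> g s = 0"
  shows "wenergy p g \<le> e\<^sup>2 * (LINT s:{a..b}|lborel. p s)"
proof -
  have i: "set_integrable lborel {a..b} p"
    by (intro borel_integrable_atLeastAtMost' continuous_on_subset[OF p_cont]) auto
  have "wenergy p g \<le> (LINT s|lborel. e\<^sup>2 * (indicator {a..b} s *\<^sub>R p s))"
    unfolding wenergy_def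
  proof (intro integral_mono Cc_square_integrable[OF g p_cont] integrable_mult_right i[unfolded set_integrable_def])
    fix s
    have "(g s)\<^sup>2 \<le> e\<^sup>2" using e[of s] by (metis abs_ge_zero power2_abs power_mono)
    then show "p s * (g s)\<^sup>2 \<le> e\<^sup>2 * (indicator {a..b} s *\<^sub>R p s)"
      using z[of s] p_nonneg[of s] by (cases "s \<in> {a..b}") (auto simp: mult.commute[of "e\<^sup>2"] intro: mult_left_mono)
  qed
  then show ?thesis by (simp add: set_lebesgue_integral_def)
qed

lemma Cc_smooth_wenergy_approx:
  assumes "g \<in> Cc T" "e > 0"
  obtains h where "h \<in> Cc T" "wenergy p (\<lambda>s. g s - h s) \<le> e"
    "smooth (\<lambda>x::'a::euclidean_space. tail h (norm x))"
proof (rule Cc_smooth_approx[OF assms(1), where ?'a = 'a])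
  fix a b assume ab: "0 < a" "a < b" "ereal b < T"
    and *: "\<And>\<epsilon>. \<epsilon> > 0 \<Longrightarrow> \<exists>h\<in>Cc T. (\<forall>s. \<bar>g s - h s\<bar> \<le> \<epsilon>) \<and> (\<forall>s. s \<notin> {a..b} \<longrightarrow> g s - h s = 0) \<and>
        smooth (\<lambda>x::'a. tail h (norm x))"
  define I where "I = (LINT s:{a..b}|lborel. p s)"
  have I: "I \<ge> 0" unfolding I_def set_lebesgue_integral_def
    by (intro Bochner_Integration.integral_nonneg) (simp add: p_nonneg)
  \<comment> \<open>The added 1 keeps \<open>\<epsilon>\<close> positive when
    \<open>I = 0\<close>.\<close>
  define \<epsilon> where "\<epsilon> = sqrt (e / (I + 1))"
  have \<epsilon>: "\<epsilon> > 0" using I assms(2) by (simp add: \<epsilon>_def)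
  obtain h where h: "h \<in> Cc T" "\<And>s. \<bar>g s - h s\<bar> \<le> \<epsilon>" "\<And>s. s \<notin> {a..b} \<Longrightarrow> g s - h s = 0"
    "smooth (\<lambda>x::'a. tail h (norm x))" using *[OF \<epsilon>] by blast
  have "wenergy p (\<lambda>s. g s - h s) \<le> \<epsilon>\<^sup>2 * I"
    unfolding I_def by (intro wenergy_le_sup_bound[OF Cc_diff[OF assms(1) h(1)]] h)
  also have "\<dots> \<le> e" using I assms(2) by (simp add: \<epsilon>_def field_simps)
  finally show thesis using h that by blast
qed

end

text \<open>Membership in the completion determines \<open>U\<close> only up to a null set of radii,
  so the limit can be asked for almost every \<open>r\<close> only.\<close>

abbreviation profile_limit :: "ereal \<Rightarrow> (nat \<Rightarrow> real \<Rightarrow> real) \<Rightarrow> (real \<Rightarrow> real) \<Rightarrow> bool" where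
  "profile_limit T g U \<equiv>
     (AE r in lborel. 0 < r \<longrightarrow> ereal r < T \<longrightarrow> (\<lambda>n. - tail (g n) r) \<longlonglongrightarrow> U r)"

text \<open>\<open>p\<close> is \<open>\<rho>\<close> times the Jacobian of polar coordinates.
  \<open>q\<close> bounds the squared value of a primitive at a radius by its energy, which turns
  energy convergence into convergence at every radius. The last assumption makes
  \<open>sqrt (q (norm x))\<close> integrable on closed balls around the origin inside
  \<open>\<Omega>\<close>, where it dominates the approximation error.\<close>

locale radial_weight = energy_weight \<rho> \<Omega> \<rho>a
  for \<rho> :: "'a::euclidean_space \<Rightarrow> real" and \<Omega> \<rho>a +
  fixes T :: ereal and p q :: "real \<Rightarrow> real"
  assumes domain_eq: "\<Omega> = {x. ereal (norm x) < T}"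
    and T_pos: "0 < T"
    and p_continuous: "continuous_on UNIV p"
    and p_nonneg: "0 \<le> p s"
    and p_zero: "s \<le> 0 \<Longrightarrow> p s = 0"
    and weight_radial: "x \<noteq> 0 \<Longrightarrow> \<rho> x * norm x ^ (DIM('a) - 1) = p (norm x)"
    and q_measurable [measurable]: "q \<in> borel_measurable borel"
    and q_nonneg: "0 < s \<Longrightarrow> ereal s < T \<Longrightarrow> 0 \<le> q s"
    and tail_bound: "g \<in> Cc T \<Longrightarrow> 0 < r \<Longrightarrow> ereal r < T \<Longrightarrow> (tail g r)\<^sup>2 \<le> q r * wenergy p g"
    and q_integrability: "0 < b \<Longrightarrow> ereal b < T \<Longrightarrow> \<exists>C. \<forall>s\<in>{0<..b}. s ^ (DIM('a) - 1) * sqrt (q s) \<le> C"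
begin

definition rad :: "(real \<Rightarrow> real) \<Rightarrow> 'a \<Rightarrow> real" where
  "rad g x = - tail g (norm x)"

lemma compact_subset_domain:
  assumes "compact K" "K \<subseteq> \<Omega>"
  obtains b where "0 < b" "ereal b < T" "K \<subseteq> cball 0 b"
proof -
  obtain b0 where b0: "0 < b0" "ereal b0 < T"
    using ereal_dense2[OF T_pos] by (auto simp: zero_ereal_def)
  show thesis
  proof (cases "K = {}")
    case True
    then show ?thesis using that[of b0] b0 by simp
  next
    case False
    have "\<exists>x\<in>K. \<forall>y\<in>K. norm y \<le> norm x"
      using assms(1) False by (intro continuous_attains_sup continuous_intros) auto
    then obtain x where x: "x \<in> K" "\<And>y. y \<in> K \<Longrightarrow> norm y \<le> norm x" by blast
    have "ereal (norm x) < T" using x assms(2) by (auto simp: domain_eq)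
    then have "ereal (max b0 (norm x)) < T" using b0 by (simp add: max_def)
    moreover have "K \<subseteq> cball 0 (max b0 (norm x))" using x by (auto simp: le_max_iff_disj)
    ultimately show ?thesis using that[of "max b0 (norm x)"] b0 by auto
  qed
qed

lemma GDERIV_rad:
  assumes "g \<in> Cc T" "x \<noteq> 0"
  shows "GDERIV (rad g) x :> g (norm x) *\<^sub>R sgn x"
proof -
  obtain b where "\<And>s. s > b \<Longrightarrow> g s = 0" using Cc_eventually_0[OF assms(1)] by blast
  then have "DERIV (\<lambda>s. - tail g s) (norm x) :> - (- g (norm x))"
    by (intro DERIV_minus DERIV_tail CcD[OF assms(1)])
  then show ?thesis
    using GDERIV_DERIV_compose[OF GDERIV_norm[OF assms(2)]] unfolding rad_def by fastforce
qed

lemma rad_test_function: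
  assumes g: "g \<in> Cc T" and "smooth (\<lambda>x::'a. tail g (norm x))"
  shows "rad g \<in> tests"
proof -
  obtain a b where ab: "0 < a" "a < b" "ereal b < T" "\<And>s. s \<notin> {a..b} \<Longrightarrow> g s = 0"
    using CcD(2)[OF g] by blast
  have "rad g x = 0" if "norm x > b" for x
    using that ab unfolding rad_def by (subst tail_eq_0[OF CcD(1)[OF g], of b]) auto
  then have "{x. rad g x \<noteq> 0} \<subseteq> cball 0 b" by force
  then have sub: "closure {x. rad g x \<noteq> 0} \<subseteq> cball 0 b" by (rule closure_minimal) simp
  moreover have "cball 0 b \<subseteq> \<Omega>"
    using ab(3) by (auto simp: domain_eq intro: le_less_trans[of _ "ereal b"])
  moreover have "compact (closure {x. rad g x \<noteq> 0})"
    using sub by (meson bounded_cball bounded_subset closed_closure compact_eq_bounded_closed)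
  moreover have "C_k k (rad g)" for k
    unfolding rad_def[abs_def] by (intro smooth_C_k smooth_minus assms)
  ultimately show ?thesis by (auto simp: test_functions_def)
qed

lemma rad_diff:
  assumes "g \<in> Cc T" "h \<in> Cc T"
  shows "rad (\<lambda>s. g s - h s) = (\<lambda>x. rad g x - rad h x)"
  by (rule ext) (simp add: rad_def tail_diff[OF assms])

text \<open>Off the origin the gradient is purely radial and \<open>\<rho>\<close> can be written as
  \<open>p (norm x) / norm x ^ (DIM('a) - 1)\<close>, whose denominator cancels against the Jacobian
  of polar coordinates.\<close>

lemma energy_norm_rad:
  assumes g: "g \<in> Cc T" and t: "rad g \<in> tests"
  shows "E (rad g) = sqrt (sphere_area TYPE('a) * wenergy p g)"
proof -
  have [measurable]: "g \<in> borel_measurable borel" "p \<in> borel_measurable borel"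
    using Cc_measurable[OF g] p_continuous by (auto intro: borel_measurable_continuous_onI)
  have [measurable]: "grad (rad g) \<in> borel_measurable borel"
    using test_fun_continuous_grad[OF t] by (rule borel_measurable_continuous_onI)
  have pos: "g s = 0" if "s \<le> 0" for s using CcD(2)[OF g] that by force
  define F where "F r = ennreal (p r / r ^ (DIM('a) - 1) * (g r)\<^sup>2)" for r
  have "ennreal (LINT x|lborel. \<rho> x * (norm (grad (rad g) x))\<^sup>2) =
      (\<integral>\<^sup>+x. ennreal (\<rho> x * (norm (grad (rad g) x))\<^sup>2) \<partial>lborel)"
    by (intro nn_integral_eq_integral[symmetric] energy_integrable_norm t) (simp add: weight_nonneg)
  also have "\<dots> = (\<integral>\<^sup>+x. F (norm x) \<partial>(lborel :: 'a measure))"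
  proof (rule nn_integral_cong_AE)
    note AE_lborel_singleton[of "0::'a"]
    then show "AE x in lborel. ennreal (\<rho> x * (norm (grad (rad g) x))\<^sup>2) = F (norm (x::'a))"
    proof eventually_elim
      fix x :: 'a assume "x \<noteq> 0"
      show "ennreal (\<rho> x * (norm (grad (rad g) x))\<^sup>2) = F (norm x)"
      proof -
        have "\<rho> x = p (norm x) / norm x ^ (DIM('a) - 1)"
          using weight_radial[OF \<open>x \<noteq> 0\<close>] \<open>x \<noteq> 0\<close> by (simp add: eq_divide_eq)
        then show ?thesis
          using \<open>x \<noteq> 0\<close> by (simp add: grad_eq[OF GDERIV_rad[OF g]] F_def norm_sgn)
      qed
    qed
  qed
  also have "\<dots> = (\<integral>\<^sup>+r. shell TYPE('a) r * F r \<partial>lborel)"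
    by (rule nn_integral_radial) (simp add: F_def)
  also have "\<dots> = (\<integral>\<^sup>+r. ennreal (sphere_area TYPE('a) * (p r * (g r)\<^sup>2)) \<partial>lborel)"
  proof (intro nn_integral_cong)
    fix r :: real
    show "shell TYPE('a) r * F r = ennreal (sphere_area TYPE('a) * (p r * (g r)\<^sup>2))"
    proof (cases "r > 0")
      case True
      then show ?thesis
        using sphere_area_pos[where 'a = 'a] p_nonneg[of r]
        by (simp add: F_def ennreal_mult'[symmetric] field_simps)
    qed (simp add: pos)
  qed
  also have "\<dots> = ennreal (LINT r|lborel. sphere_area TYPE('a) * (p r * (g r)\<^sup>2))"
    using sphere_area_pos[where 'a = 'a]
    by (intro nn_integral_eq_integral integrable_mult_right Cc_square_integrable[OF g p_continuous])
       (simp add: p_nonneg)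
  also have "(LINT r|lborel. sphere_area TYPE('a) * (p r * (g r)\<^sup>2)) = sphere_area TYPE('a) * wenergy p g"
    by (simp add: wenergy_def)
  finally have "(LINT x|lborel. \<rho> x * (norm (grad (rad g) x))\<^sup>2) = sphere_area TYPE('a) * wenergy p g"
    using sphere_area_pos[where 'a = 'a] wenergy_nonneg[OF p_nonneg]
    by (subst (asm) ennreal_inj) (auto intro!: Bochner_Integration.integral_nonneg simp: weight_nonneg)
  then show ?thesis by (simp add: energy_norm_eq[OF t])
qed

lemma tail_bound_abs:
  assumes "g \<in> Cc T" "0 < r" "ereal r < T"
  shows "\<bar>tail g r\<bar> \<le> sqrt (q r) * wnorm p g"
  using tail_bound[OF assms] by (metis real_sqrt_abs real_sqrt_le_mono real_sqrt_mult)

abbreviation sq :: "real \<Rightarrow> 'a \<Rightarrow> real" where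
  "sq b x \<equiv> indicator (cball 0 b) x * sqrt (q (norm x))"

lemma sqrt_q_integrable:
  assumes "0 < b" "ereal b < T"
  shows "integrable lborel (\<lambda>x::'a. indicator (cball 0 b) x * sqrt (q (norm x)))"
proof (rule integrableI_bounded)
  have [measurable]: "cball (0::'a) b \<in> sets borel" by simp
  show "(\<lambda>x::'a. indicator (cball 0 b) x * sqrt (q (norm x))) \<in> borel_measurable lborel" by measurable
  obtain C where C: "\<And>s. 0 < s \<Longrightarrow> s \<le> b \<Longrightarrow> s ^ (DIM('a) - 1) * sqrt (q s) \<le> C"
    using q_integrability[OF assms] by (meson greaterThanAtMost_iff)
  have "0 < sphere_area TYPE('a)" by (rule sphere_area_pos)
  have "ereal s < T" if "s \<le> b" for s
    using assms(2) that by (metis ereal_less_eq(3) le_less_trans)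
  then have q0: "0 \<le> q s" if "0 < s" "s \<le> b" for s using q_nonneg that by blast
  have "(\<integral>\<^sup>+x. ennreal (norm (indicator (cball 0 b) x * sqrt (q (norm x)))) \<partial>(lborel :: 'a measure)) =
     (\<integral>\<^sup>+x. ennreal (norm (indicator {..b} (norm x) * sqrt (q (norm x)))) \<partial>(lborel :: 'a measure))"
    by (simp add: indicator_def)
  also have "\<dots> = (\<integral>\<^sup>+r. shell TYPE('a) r *
       ennreal (norm (indicator {..b} r * sqrt (q r))) \<partial>lborel)"
    by (rule nn_integral_radial) measurable
  also have "\<dots> \<le> (\<integral>\<^sup>+r. ennreal (sphere_area TYPE('a) * C) * indicator {0..b} r \<partial>lborel)"
  proof (intro nn_integral_mono)
    fix r :: real
    show "shell TYPE('a) r *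
       ennreal (norm (indicator {..b} r * sqrt (q r))) \<le> ennreal (sphere_area TYPE('a) * C) * indicator {0..b} r"
    proof (cases "r \<in> {0<..b}")
      case True
      then have "sphere_area TYPE('a) * (r ^ (DIM('a) - 1) * sqrt (q r)) \<le> sphere_area TYPE('a) * C"
        using C[of r] \<open>0 < sphere_area TYPE('a)\<close> by (intro mult_left_mono) auto
      then show ?thesis using True q0[of r] \<open>0 < sphere_area TYPE('a)\<close>
        by (simp add: ennreal_mult'[symmetric] mult.assoc ennreal_leI)
    next
      case False
      then have "indicator {0<..} r * ennreal (norm (indicator {..b} r * sqrt (q r))) = 0"
        by (auto simp: indicator_def)
      then show ?thesis by (simp only: mult.assoc mult_zero_right zero_le)
    qed
  qed
  also have "\<dots> < \<infinity>"
    using assms(1) by (subst nn_integral_cmult_indicator) (auto simp: ennreal_mult_less_top)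
  finally show "(\<integral>\<^sup>+x. ennreal (norm (indicator (cball 0 b) x * sqrt (q (norm x)))) \<partial>(lborel :: 'a measure)) < \<infinity>" .
qed

text \<open>Letting \<open>m\<close> tend to infinity in the bound for
  \<open>tail (\<lambda>s. g m s - g n s)\<close> gives
  \<open>\<bar>rad (g n) x - u x\<bar> \<le> e * sqrt (q (norm x))\<close> for almost every
  \<open>x\<close> in \<open>\<Omega>\<close>. The right-hand side is locally integrable, so both
  the local integrability of \<open>u\<close> and the L1 convergence follow.\<close>

lemma represents_smooth:
  assumes g: "\<And>n. g n \<in> Cc T" and smooth: "\<And>n. smooth (\<lambda>x::'a. tail (g n) (norm x))"
    and cauchy: "wcauchy p g"
    and lim: "profile_limit T g U"
    and u: "\<And>x. x \<in> \<Omega> \<Longrightarrow> x \<noteq> 0 \<Longrightarrow> u x = U (norm x)"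
  shows "represents \<rho> \<Omega> (\<lambda>n. rad (g n)) u"
proof -
  have tf: "rad (g n) \<in> tests" for n
    by (intro rad_test_function g smooth)
  have [measurable]: "rad (g n) \<in> borel_measurable borel" for n
    using test_fun_continuous[OF tf] by (rule borel_measurable_continuous_onI)
  have AElim: "AE x in lborel. x \<in> \<Omega> \<longrightarrow> (x \<noteq> 0 \<and> (\<lambda>n. rad (g n) x) \<longlonglongrightarrow> u x)"
  proof -
    have "AE r in lborel. 0 < r \<longrightarrow> (ereal r < T \<longrightarrow> (\<lambda>n. - tail (g n) r) \<longlonglongrightarrow> U r)"
      using lim by eventually_elim auto
    from AE_radial[OF this, where 'a = 'a] AE_lborel_singleton[of "0::'a"]
    show ?thesis by eventually_elim (auto simp: domain_eq u rad_def)
  qed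
  have bound: "AE x in lborel. x \<in> \<Omega> \<longrightarrow> \<bar>rad (g n) x - u x\<bar> \<le> e * sqrt (q (norm x))"
    if M: "\<And>m. m \<ge> M \<Longrightarrow> wdist p (g m) (g n) \<le> e" for e M n
    using AElim
  proof (eventually_elim, intro impI)
    fix x assume "x \<in> \<Omega> \<longrightarrow> (x \<noteq> 0 \<and> (\<lambda>n. rad (g n) x) \<longlonglongrightarrow> u x)" "x \<in> \<Omega>"
    then have x: "x \<noteq> 0" "ereal (norm x) < T" "(\<lambda>n. rad (g n) x) \<longlonglongrightarrow> u x" by (auto simp: domain_eq)
    have "\<bar>rad (g n) x - rad (g m) x\<bar> \<le> e * sqrt (q (norm x))" if "m \<ge> M" for m
    proof -
      have "\<bar>rad (g n) x - rad (g m) x\<bar> = \<bar>tail (\<lambda>s. g m s - g n s) (norm x)\<bar>"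
        by (simp add: rad_def tail_diff[OF g g])
      also have "\<dots> \<le> sqrt (q (norm x)) * wdist p (g m) (g n)"
        using x by (intro tail_bound_abs Cc_diff g) auto
      also have "\<dots> \<le> sqrt (q (norm x)) * e"
        using x q_nonneg[of "norm x"] M[OF that] by (intro mult_left_mono) auto
      finally show ?thesis by (simp add: mult.commute)
    qed
    moreover have "(\<lambda>m. \<bar>rad (g n) x - rad (g m) x\<bar>) \<longlonglongrightarrow> \<bar>rad (g n) x - u x\<bar>"
      by (intro tendsto_intros x)
    ultimately show "\<bar>rad (g n) x - u x\<bar> \<le> e * sqrt (q (norm x))"
      by (intro LIMSEQ_le_const2) auto
  qed
  have sub: "x \<in> \<Omega>" if "x \<in> K" "K \<subseteq> \<Omega>" for x K using that by blast
  \<comment> \<open>Measurability of \<open>u\<close> has to be derived: on \<open>K\<close> it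
    agrees almost everywhere with a limit of Borel functions.\<close>
  have u_meas: "(\<lambda>x. indicator K x *\<^sub>R u x) \<in> borel_measurable lebesgue" if K: "compact K" "K \<subseteq> \<Omega>" for K
  proof (rule borel_measurable_completion_cong_AE)
    have [measurable]: "K \<in> sets borel" using K by (simp add: borel_compact)
    show "(\<lambda>x. indicator K x *\<^sub>R lim (\<lambda>n. rad (g n) x)) \<in> borel_measurable lborel" by measurable
    show "AE x in lborel. indicator K x *\<^sub>R lim (\<lambda>n. rad (g n) x) = indicator K x *\<^sub>R u x"
      using AElim by eventually_elim (use K in \<open>auto simp: indicator_def limI\<close>)
  qed
  have dom: "integrable lebesgue (\<lambda>x::'a. e * sq b x)"
    if "0 < b" "ereal b < T" for e b
    using sqrt_q_integrable[OF that] by (intro integrable_mult_right) (simp add: integrable_completion)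
  have diff_int: "set_integrable lebesgue K (\<lambda>x. rad (g n) x - u x)"
    and diff_le: "L1_dist K (rad (g n)) u \<le>
        e * (LINT x|lebesgue. sq b x)"
    if K: "compact K" "K \<subseteq> \<Omega>" and b: "0 < b" "ereal b < T" "K \<subseteq> cball 0 b"
      and M: "\<And>m. m \<ge> M \<Longrightarrow> wdist p (g m) (g n) \<le> e" for K b e M n
  proof -
    have [measurable]: "K \<in> sets borel" using K by (simp add: borel_compact)
    have le: "AE x in lebesgue. indicator K x *\<^sub>R \<bar>rad (g n) x - u x\<bar> \<le> e * sq b x"
    proof -
      have e: "e \<ge> 0" using M[of M] wenergy_nonneg[OF p_nonneg]
        by (meson order_refl order_trans real_sqrt_ge_zero)
      have "AE x in lebesgue. x \<in> \<Omega> \<longrightarrow> \<bar>rad (g n) x - u x\<bar> \<le> e * sqrt (q (norm x))"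
        using bound[OF M] by (intro AE_completion) auto
      moreover have "AE x in lebesgue. x \<noteq> (0::'a)" by (intro AE_completion AE_lborel_singleton)
      ultimately show ?thesis
      proof eventually_elim
        fix x assume x: "x \<in> \<Omega> \<longrightarrow> \<bar>rad (g n) x - u x\<bar> \<le> e * sqrt (q (norm x))" "x \<noteq> 0"
        have "norm x \<le> b \<Longrightarrow> 0 \<le> q (norm x)"
          using x b by (intro q_nonneg) (auto intro: le_less_trans[of _ "ereal b"])
        then show "indicator K x *\<^sub>R \<bar>rad (g n) x - u x\<bar> \<le> e * sq b x"
          using x(1) K b e by (cases "x \<in> K") (auto simp: indicator_def)
      qed
    qed
    have meas: "(\<lambda>x. indicator K x *\<^sub>R (rad (g n) x - u x)) \<in> borel_measurable lebesgue"
    proof -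
      have "(\<lambda>x. indicator K x *\<^sub>R rad (g n) x) \<in> borel_measurable lebesgue"
        by (intro measurable_completion) measurable
      from borel_measurable_diff[OF this u_meas[OF K]] show ?thesis
        by (simp add: right_diff_distrib)
    qed
    show int: "set_integrable lebesgue K (\<lambda>x. rad (g n) x - u x)"
      unfolding set_integrable_def
    proof (rule Bochner_Integration.integrable_bound[OF dom[OF b(1,2)] meas])
      show "AE x in lebesgue. norm (indicator K x *\<^sub>R (rad (g n) x - u x)) \<le> norm (e * sq b x)"
        using le
      proof eventually_elim
        fix x assume "indicator K x *\<^sub>R \<bar>rad (g n) x - u x\<bar> \<le> e * sq b x"
        moreover have "norm (indicator K x *\<^sub>R (rad (g n) x - u x)) = indicator K x *\<^sub>R \<bar>rad (g n) x - u x\<bar>"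
          by (simp add: abs_mult)
        ultimately show "norm (indicator K x *\<^sub>R (rad (g n) x - u x)) \<le> norm (e * sq b x)"
          unfolding real_norm_def by linarith
      qed
    qed
    have "L1_dist K (rad (g n)) u \<le> (LINT x|lebesgue. e * sq b x)"
      unfolding set_lebesgue_integral_def
      using set_integrable_abs[OF int] unfolding set_integrable_def
      by (intro integral_mono_AE dom b le)
    then show "L1_dist K (rad (g n)) u \<le>
        e * (LINT x|lebesgue. sq b x)" by simp
  qed
  show ?thesis
    unfolding represents_def
  proof (intro conjI allI impI)
    show "rad (g n) \<in> tests" for n by (rule tf)
  next
    fix e :: real assume e: "e > 0"
    have A: "sphere_area TYPE('a) > 0" by (rule sphere_area_pos)
    with e have "e / sqrt (sphere_area TYPE('a)) > 0" by simp
    then obtain M where M: "\<And>m n. m \<ge> M \<Longrightarrow> n \<ge> M \<Longrightarrow> wdist p (g m) (g n) < e / sqrt (sphere_area TYPE('a))"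
      using cauchy unfolding wcauchy_def by blast
    have "E (\<lambda>x. rad (g m) x - rad (g n) x) < e" if "m \<ge> M" "n \<ge> M" for m n
    proof -
      have "E (\<lambda>x. rad (g m) x - rad (g n) x) = sqrt (sphere_area TYPE('a)) * wdist p (g m) (g n)"
        using energy_norm_rad[OF Cc_diff[OF g g]] test_functions_diff[OF tf tf]
        by (simp add: rad_diff[OF g g] real_sqrt_mult)
      also have "\<dots> < e" using M[OF that] A by (simp add: field_simps)
      finally show ?thesis .
    qed
    then show "\<exists>M. \<forall>m\<ge>M. \<forall>n\<ge>M. E (\<lambda>x. rad (g m) x - rad (g n) x) < e" by blast
  next
    obtain M where M: "\<And>m n. m \<ge> M \<Longrightarrow> n \<ge> M \<Longrightarrow> wdist p (g m) (g n) < 1"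
      using cauchy unfolding wcauchy_def by (meson zero_less_one)
    show "locally_integrable_on u \<Omega>"
      unfolding locally_integrable_on_def
    proof (intro allI impI, elim conjE)
      fix K assume K: "compact K" "K \<subseteq> \<Omega>"
      obtain b where b: "0 < b" "ereal b < T" "K \<subseteq> cball 0 b" using compact_subset_domain[OF K] by blast
      \<comment> \<open>Write \<open>u\<close> as a test function minus an error dominated by
        \<open>sqrt (q (norm x))\<close>.\<close>
      have "set_integrable lebesgue K (\<lambda>x. rad (g M) x - (rad (g M) x - u x))"
        using M[of _ M] by (intro set_integral_diff(1) diff_int[OF K b, of M _ 1] test_fun_set_integrable[OF tf K(1)])
           (auto intro: less_imp_le)
      then show "set_integrable lebesgue K u" by simp
    qed
  next
    fix K assume "compact K \<and> K \<subseteq> \<Omega>"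
    then have K: "compact K" "K \<subseteq> \<Omega>" by auto
    obtain b where b: "0 < b" "ereal b < T" "K \<subseteq> cball 0 b" using compact_subset_domain[OF K] by blast
    define Q where "Q = (LINT x|lebesgue. sq b x)"
    show "(\<lambda>n. L1_dist K (rad (g n)) u) \<longlonglongrightarrow> 0"
    proof (rule LIMSEQ_I)
      fix r :: real assume "r > 0"
      define e where "e = r / (\<bar>Q\<bar> + 1)"
      have e: "e > 0" using \<open>r > 0\<close> by (simp add: e_def)
      then obtain M where M: "\<And>m n. m \<ge> M \<Longrightarrow> n \<ge> M \<Longrightarrow> wdist p (g m) (g n) < e"
        using cauchy unfolding wcauchy_def by blast
      have "norm (L1_dist K (rad (g n)) u - 0) < r" if "n \<ge> M" for n
      proof -
        have "L1_dist K (rad (g n)) u \<le> e * Q"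
          unfolding Q_def using M that by (intro diff_le[OF K b, of M]) (auto intro: less_imp_le)
        also have "\<dots> \<le> e * \<bar>Q\<bar>" using e by (intro mult_left_mono) auto
        also have "\<dots> < r"
        proof -
          have "e * \<bar>Q\<bar> < e * (\<bar>Q\<bar> + 1)" using e by simp
          also have "\<dots> = r" by (simp add: e_def)
          finally show ?thesis .
        qed
        finally have "L1_dist K (rad (g n)) u < r" .
        moreover have "0 \<le> L1_dist K (rad (g n)) u"
          unfolding set_lebesgue_integral_def by (intro Bochner_Integration.integral_nonneg) simp
        ultimately show ?thesis by simp
      qed
      then show "\<exists>no. \<forall>n\<ge>no. norm (L1_dist K (rad (g n)) u - 0) < r" by blast
    qed
  qed
qed

text \<open>Replace each \<open>g n\<close> by a profile \<open>h n\<close> with smooth primitive at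
  weighted distance at most \<open>1 / real (Suc n)\<close>. The bound on primitives carries over
  the limit at each radius, and the reverse triangle inequality carries over the limit of the
  norms.\<close>

theorem represents_radial:
  assumes g: "\<And>n. g n \<in> Cc T" and cauchy: "wcauchy p g"
    and lim: "profile_limit T g U"
    and u: "\<And>x. x \<in> \<Omega> \<Longrightarrow> x \<noteq> 0 \<Longrightarrow> u x = U (norm x)"
    and l: "(\<lambda>n. wnorm p (g n)) \<longlonglongrightarrow> l"
  shows "u \<in> completion_space \<rho> \<Omega>" and "completion_norm \<rho> \<Omega> u = sqrt (sphere_area TYPE('a)) * l"
proof -
  note pc = p_continuous p_nonneg p_zero
  have "\<exists>h. h \<in> Cc T \<and> wenergy p (\<lambda>s. g n s - h s) \<le> (1 / real (Suc n))\<^sup>2 \<and> smooth (\<lambda>x::'a. tail h (norm x))" for n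
    by (rule Cc_smooth_wenergy_approx[OF pc g, of "(1 / real (Suc n))\<^sup>2" n, where ?'a = 'a]) auto
  then obtain h where h: "\<And>n. h n \<in> Cc T" "\<And>n. wenergy p (\<lambda>s. g n s - h n s) \<le> (1 / real (Suc n))\<^sup>2"
    "\<And>n. smooth (\<lambda>x::'a. tail (h n) (norm x))" by metis
  have small: "wdist p (g n) (h n) \<le> 1 / real (Suc n)" for n
    using h(2)[of n] by (intro real_le_lsqrt) auto
  have inv0: "(\<lambda>n. 1 / real (Suc n)) \<longlonglongrightarrow> 0" by (rule LIMSEQ_Suc[OF lim_1_over_n])
  have hc: "wcauchy p h"
    by (rule wcauchy_perturb[OF pc Cc_vanishing[OF g] Cc_vanishing[OF h(1)] cauchy small])
  have hlim: "profile_limit T h U"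
    using lim
  proof (eventually_elim, intro impI)
    fix r assume *: "0 < r \<longrightarrow> ereal r < T \<longrightarrow> (\<lambda>n. - tail (g n) r) \<longlonglongrightarrow> U r" and r: "0 < r" "ereal r < T"
    have "(\<lambda>n. tail (\<lambda>s. g n s - h n s) r) \<longlonglongrightarrow> 0"
    proof (rule Lim_null_comparison)
      show "\<forall>\<^sub>F n in sequentially. norm (tail (\<lambda>s. g n s - h n s) r) \<le> sqrt (q r) * (1 / real (Suc n))"
      proof (intro always_eventually allI)
        fix n
        have "norm (tail (\<lambda>s. g n s - h n s) r) \<le> sqrt (q r) * wdist p (g n) (h n)"
          using tail_bound_abs[OF Cc_diff[OF g h(1)] r] by simp
        also have "\<dots> \<le> sqrt (q r) * (1 / real (Suc n))"
          using q_nonneg[OF r] by (intro mult_left_mono small) auto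
        finally show "norm (tail (\<lambda>s. g n s - h n s) r) \<le> sqrt (q r) * (1 / real (Suc n))" .
      qed
      show "(\<lambda>n. sqrt (q r) * (1 / real (Suc n))) \<longlonglongrightarrow> 0"
        by (rule tendsto_mult_right_zero[OF inv0])
    qed
    then have "(\<lambda>n. - tail (g n) r + tail (\<lambda>s. g n s - h n s) r) \<longlonglongrightarrow> U r + 0"
      using * r by (intro tendsto_add) auto
    then show "(\<lambda>n. - tail (h n) r) \<longlonglongrightarrow> U r"
      by (simp add: tail_diff[OF g h(1)])
  qed
  have rep: "represents \<rho> \<Omega> (\<lambda>n. rad (h n)) u"
    by (rule represents_smooth[OF h(1,3) hc hlim u])
  then show "u \<in> completion_space \<rho> \<Omega>" by (auto simp: completion_space_def)
  have "norm (wnorm p (h n) - wnorm p (g n)) \<le> 1 / real (Suc n)" for n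
    using order_trans[OF sqrt_wenergy_reverse_triangle[OF pc Cc_vanishing[OF g] Cc_vanishing[OF h(1)]] small]
    by (simp add: abs_minus_commute del: of_nat_Suc)
  then have "(\<lambda>n. wnorm p (h n) - wnorm p (g n)) \<longlonglongrightarrow> 0"
    by (intro Lim_null_comparison[OF _ inv0] always_eventually allI)
  from tendsto_add[OF this l] have "(\<lambda>n. wnorm p (h n)) \<longlonglongrightarrow> l" by simp
  then have "(\<lambda>n. sqrt (sphere_area TYPE('a)) * wnorm p (h n)) \<longlonglongrightarrow> sqrt (sphere_area TYPE('a)) * l"
    by (intro tendsto_intros)
  then have "(\<lambda>n. E (rad (h n))) \<longlonglongrightarrow> sqrt (sphere_area TYPE('a)) * l"
    by (simp add: energy_norm_rad[OF h(1) rad_test_function[OF h(1,3)]] real_sqrt_mult)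
  then show "completion_norm \<rho> \<Omega> u = sqrt (sphere_area TYPE('a)) * l"
    by (rule completion_norm_eqI[OF rep])
qed

end

section \<open>Spherical means\<close>

definition spherical_mean :: "('a::euclidean_space \<Rightarrow> real) \<Rightarrow> real \<Rightarrow> real" where
  "spherical_mean \<phi> r = (LINT x|unit_measure. \<phi> (r *\<^sub>R sgn x))"

text \<open>The derivative of \<open>spherical_mean \<phi>\<close>, written with the differentiation
  already inside the integral, so that continuity and energy bounds can be read off.\<close>

definition radial_deriv :: "('a::euclidean_space \<Rightarrow> real) \<Rightarrow> real \<Rightarrow> real" where
  "radial_deriv \<phi> s = (LINT x|unit_measure. inner (grad \<phi> (s *\<^sub>R sgn x)) (sgn x))"

lemma norm_sgn_le_1: "norm (sgn x) \<le> (1::real)" for x :: "'a::real_normed_vector"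
  by (simp add: norm_sgn)

context
  fixes \<phi> :: "'a::euclidean_space \<Rightarrow> real" and \<Omega>
  assumes \<phi>: "\<phi> \<in> test_functions \<Omega>"
begin

lemma test_fun_measurable: "\<phi> \<in> borel_measurable borel" "grad \<phi> \<in> borel_measurable borel"
  using test_fun_continuous[OF \<phi>] test_fun_continuous_grad[OF \<phi>]
  by (auto intro: borel_measurable_continuous_onI)

lemma grad_bounded: "\<exists>C. \<forall>x. norm (grad \<phi> x) \<le> C"
proof -
  obtain K where K: "compact K" "\<And>x. x \<notin> K \<Longrightarrow> grad \<phi> x = 0"
    using test_fun_support[OF \<phi>] by metis
  show ?thesis by (rule continuous_compact_support(2)[OF test_fun_continuous_grad[OF \<phi>] K])
qed

lemma test_fun_bounded: "\<exists>C. \<forall>x. norm (\<phi> x) \<le> C"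
proof -
  obtain K where K: "compact K" "\<And>x. x \<notin> K \<Longrightarrow> \<phi> x = 0"
    using test_fun_support[OF \<phi>] by metis
  show ?thesis by (rule continuous_compact_support(2)[OF test_fun_continuous[OF \<phi>] K])
qed

lemma radial_integrand_bound:
  "norm (grad \<phi> (s *\<^sub>R sgn x)) \<le> C \<Longrightarrow> \<bar>inner (grad \<phi> (s *\<^sub>R sgn x)) (sgn x)\<bar> \<le> C"
  using Cauchy_Schwarz_ineq2[of "grad \<phi> (s *\<^sub>R sgn x)" "sgn x"]
    mult_left_mono[OF norm_sgn_le_1[of x], of "norm (grad \<phi> (s *\<^sub>R sgn x))"] by simp

lemma radial_integrand_integrable:
  "integrable unit_measure (\<lambda>x. inner (grad \<phi> (s *\<^sub>R sgn x)) (sgn x))"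
proof -
  note [measurable] = test_fun_measurable
  obtain C where "\<And>x. norm (grad \<phi> x) \<le> C" using grad_bounded by blast
  then show ?thesis
    by (intro unit_measure.integrable_const_bound[of _ C] AE_I2)
       (auto intro!: radial_integrand_bound simp: measurable_cong_sets[OF sets_unit_measure refl])
qed

lemma mean_integrand_integrable: "integrable unit_measure (\<lambda>x. \<phi> (r *\<^sub>R sgn x))"
proof -
  note [measurable] = test_fun_measurable
  obtain C where "\<And>x. norm (\<phi> x) \<le> C" using test_fun_bounded by blast
  then show ?thesis
    by (intro unit_measure.integrable_const_bound[of _ C] AE_I2)
       (auto simp: measurable_cong_sets[OF sets_unit_measure refl])
qed

lemma continuous_on_radial_deriv: "continuous_on UNIV (radial_deriv \<phi>)"
proof -
  obtain C where C: "\<And>x. norm (grad \<phi> x) \<le> C" using grad_bounded by blast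
  show ?thesis
    unfolding continuous_on_sequentially
  proof (intro ballI allI impI, elim conjE)
    fix y :: "nat \<Rightarrow> real" and s assume y: "y \<longlonglongrightarrow> s"
    have "(\<lambda>n. radial_deriv \<phi> (y n)) \<longlonglongrightarrow> radial_deriv \<phi> s"
      unfolding radial_deriv_def
    proof (rule integral_dominated_convergence[where w = "\<lambda>_. C"])
      show "AE x in unit_measure. (\<lambda>n. inner (grad \<phi> (y n *\<^sub>R sgn x)) (sgn x)) \<longlonglongrightarrow> inner (grad \<phi> (s *\<^sub>R sgn x)) (sgn x)"
      proof (intro AE_I2 tendsto_intros)
        fix x :: 'a
        show "(\<lambda>n. grad \<phi> (y n *\<^sub>R sgn x)) \<longlonglongrightarrow> grad \<phi> (s *\<^sub>R sgn x)"
          by (rule continuous_on_tendsto_compose[OF test_fun_continuous_grad[OF \<phi>]])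
             (auto intro!: tendsto_intros y)
      qed
      show "AE x in unit_measure. norm (inner (grad \<phi> (y n *\<^sub>R sgn x)) (sgn x)) \<le> C" for n
        using C by (auto intro!: AE_I2 radial_integrand_bound)
    qed (use radial_integrand_integrable in \<open>auto\<close>)
    then show "(radial_deriv \<phi> \<circ> y) \<longlonglongrightarrow> radial_deriv \<phi> s" by (simp add: o_def)
  qed
qed

text \<open>The fundamental theorem of calculus along each ray, from radius \<open>r\<close> to a
  radius \<open>c\<close> beyond the support, followed by Fubini.\<close>

lemma spherical_mean_eq_tail:
  assumes b: "\<And>x. norm x > b \<Longrightarrow> \<phi> x = 0 \<and> grad \<phi> x = 0" and r: "0 < r"
  shows "spherical_mean \<phi> r = - tail (radial_deriv \<phi>) r"
proof -
  note [measurable] = test_fun_measurable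
  interpret pair_sigma_finite lborel "unit_measure :: 'a measure" ..
  obtain C where C: "\<And>x. norm (grad \<phi> x) \<le> C" using grad_bounded by blast
  define c where "c = max b r + 1"
  define G where "G s x = indicator {r..} s * inner (grad \<phi> (s *\<^sub>R sgn x)) (sgn x)" for s and x :: 'a
  have [measurable]: "(\<lambda>(s, x). G s x) \<in> borel_measurable (lborel \<Otimes>\<^sub>M unit_measure)"
    unfolding G_def by measurable
  \<comment> \<open>A constant on a set of finite measure dominates \<open>G\<close>, which gives
    the integrability that Fubini asks for.\<close>
  have Gle: "norm (G s x) \<le> C * indicator ({r..c} \<times> UNIV) (s, x)" for s x
  proof -
    have "G s x = 0" if "s > c"
    proof (cases "x = 0")
      case False
      then have "norm (s *\<^sub>R sgn x) > b" using that r by (simp add: norm_sgn c_def)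
      then show ?thesis using b by (simp add: G_def)
    qed (simp add: G_def)
    then show ?thesis
      using radial_integrand_bound[OF C, of s x] by (auto simp: G_def indicator_def not_le)
  qed
  have Gint: "integrable (lborel \<Otimes>\<^sub>M unit_measure) (\<lambda>(s, x). G s x)"
  proof (rule Bochner_Integration.integrable_bound)
    have "emeasure (lborel \<Otimes>\<^sub>M (unit_measure :: 'a measure)) ({r..c} \<times> UNIV) < \<infinity>"
      using unit_measure.emeasure_pair_measure_Times[of "{r..c}" lborel "UNIV :: 'a set"]
      by (simp add: emeasure_unit_measure c_def)
    then show "integrable (lborel \<Otimes>\<^sub>M unit_measure) (\<lambda>z. C * indicator ({r..c} \<times> (UNIV :: 'a set)) z)"
      by (intro integrable_mult_right integrable_real_indicator) auto
    show "AE z in lborel \<Otimes>\<^sub>M unit_measure. norm (case z of (s, x) \<Rightarrow> G s x) \<le> norm (C * indicator ({r..c} \<times> UNIV) z)"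
      using Gle by (intro AE_I2) (auto intro: order_trans[OF _ abs_ge_self])
  qed measurable
  have inner: "(LINT s|lborel. G s x) = - \<phi> (r *\<^sub>R sgn x)" if x: "norm (sgn x) = 1" for x
  proof -
    have "G s x = indicator {r..c} s *\<^sub>R inner (grad \<phi> (s *\<^sub>R sgn x)) (sgn x)" for s
      using Gle[of s x] by (auto simp: G_def indicator_def)
    moreover have "(LINT s|lborel. indicator {r..c} s *\<^sub>R inner (grad \<phi> (s *\<^sub>R sgn x)) (sgn x)) =
        \<phi> (c *\<^sub>R sgn x) - \<phi> (r *\<^sub>R sgn x)"
    proof (rule integral_FTC_Icc)
      show "r \<le> c" by (simp add: c_def)
      show "((\<lambda>s. \<phi> (s *\<^sub>R sgn x)) has_vector_derivative inner (grad \<phi> (s *\<^sub>R sgn x)) (sgn x)) (at s within {r..c})" for s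
      proof -
        have "(\<phi> has_derivative (\<lambda>h. inner h (grad \<phi> (s *\<^sub>R sgn x)))) (at (s *\<^sub>R sgn x))"
          using test_fun_GDERIV[OF \<phi>] by (simp add: gderiv_def)
        moreover have "((\<lambda>s. s *\<^sub>R sgn x) has_derivative (\<lambda>t. t *\<^sub>R sgn x)) (at s)"
          by (auto intro!: derivative_eq_intros)
        ultimately have "((\<lambda>s. \<phi> (s *\<^sub>R sgn x)) has_derivative (\<lambda>t. inner (t *\<^sub>R sgn x) (grad \<phi> (s *\<^sub>R sgn x)))) (at s)"
          by (rule has_derivative_compose[rotated])
        then have "((\<lambda>s. \<phi> (s *\<^sub>R sgn x)) has_vector_derivative inner (grad \<phi> (s *\<^sub>R sgn x)) (sgn x)) (at s)"
          by (simp add: has_vector_derivative_def inner_commute)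
        then show ?thesis by (rule has_vector_derivative_at_within)
      qed
      show "continuous_on {r..c} (\<lambda>s. inner (grad \<phi> (s *\<^sub>R sgn x)) (sgn x))"
        by (intro continuous_intros continuous_on_compose2[OF test_fun_continuous_grad[OF \<phi>]]) auto
    qed
    moreover have "norm (c *\<^sub>R sgn x) > b" using x r by (simp add: c_def)
    ultimately show ?thesis using b by simp
  qed
  have "tail (radial_deriv \<phi>) r = (LINT s|lborel. LINT x|unit_measure. G s x)"
    unfolding tail_def set_lebesgue_integral_def radial_deriv_def G_def by simp
  also have "\<dots> = (LINT x|unit_measure. LINT s|lborel. G s x)"
    using Fubini_integral[OF Gint] by simp
  also have "\<dots> = (LINT x|unit_measure. - \<phi> (r *\<^sub>R sgn x))"
  proof (rule integral_cong_AE)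
    show "AE x in unit_measure. (LINT s|lborel. G s x) = - \<phi> (r *\<^sub>R sgn x)"
      using AE_unit_measure_sgn by eventually_elim (rule inner)
  qed measurable
  finally show ?thesis by (simp add: spherical_mean_def)
qed

end

lemma radial_deriv_diff:
  assumes "\<phi> \<in> test_functions \<Omega>" "\<psi> \<in> test_functions \<Omega>"
  shows "radial_deriv (\<lambda>x. \<phi> x - \<psi> x) s = radial_deriv \<phi> s - radial_deriv \<psi> s"
  unfolding radial_deriv_def grad_test_functions_diff[OF assms] inner_diff_left
  by (intro Bochner_Integration.integral_diff radial_integrand_integrable[OF assms(1)] radial_integrand_integrable[OF assms(2)])

section \<open>Profiles extracted from arbitrary representing sequences\<close>

context radial_weight
begin

lemma test_fun_support_cball:
  assumes "\<phi> \<in> tests"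
  obtains b where "0 < b" "ereal b < T" "\<And>x. norm x > b \<Longrightarrow> \<phi> x = 0 \<and> grad \<phi> x = 0"
proof -
  obtain K where K: "compact K" "K \<subseteq> \<Omega>" "\<And>x. x \<notin> K \<Longrightarrow> \<phi> x = 0" "\<And>x. x \<notin> K \<Longrightarrow> grad \<phi> x = 0"
    using test_fun_support[OF assms] by metis
  obtain b where b: "0 < b" "ereal b < T" "K \<subseteq> cball 0 b" using compact_subset_domain[OF K(1,2)] by blast
  have "\<phi> x = 0 \<and> grad \<phi> x = 0" if "norm x > b" for x
  proof -
    have "x \<notin> K" using b(3) that by auto
    then show ?thesis using K by blast
  qed
  then show ?thesis using that b by blast
qed

lemma radial_deriv_eq_0:
  assumes "\<And>x. norm x > b \<Longrightarrow> \<phi> x = 0 \<and> grad \<phi> x = (0::'a)" "s > b" "s > 0"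
  shows "radial_deriv \<phi> s = 0"
proof -
  have "(\<lambda>x::'a. inner (grad \<phi> (s *\<^sub>R sgn x)) (sgn x)) = (\<lambda>x. 0)"
  proof
    fix x :: 'a
    show "inner (grad \<phi> (s *\<^sub>R sgn x)) (sgn x) = 0"
      using assms(1)[of "s *\<^sub>R sgn x"] assms(2,3) by (cases "x = 0") (auto simp: norm_sgn)
  qed
  then show ?thesis by (simp add: radial_deriv_def)
qed

lemma radial_deriv_vanishing:
  assumes "\<phi> \<in> tests"
  shows "radial_deriv \<phi> \<in> vanishing"
proof -
  obtain b where b: "0 < b" "ereal b < T" "\<And>x. norm x > b \<Longrightarrow> \<phi> x = 0 \<and> grad \<phi> x = 0"
    using test_fun_support_cball[OF assms] by blast
  have "radial_deriv \<phi> s = 0" if "s > b" for s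
    using that b(1) by (intro radial_deriv_eq_0[OF b(3)]) auto
  then show ?thesis
    using continuous_on_radial_deriv[OF assms] unfolding vanishing_def by blast
qed

text \<open>Passing to the mean can only lower the energy, for two reasons: the tangential part of
  the gradient is dropped, and the square of a mean is at most the mean of the square. Dividing by
  the root of the sphere area accounts for comparing a one-dimensional integral with a polar
  one.\<close>

lemma radial_deriv_energy_le:
  assumes \<phi>: "\<phi> \<in> tests"
  shows "wnorm p (radial_deriv \<phi>) \<le> E \<phi> / sqrt (sphere_area TYPE('a))"
proof -
  note [measurable] = test_fun_measurable[OF \<phi>]
  let ?A = "sphere_area TYPE('a)"
  have A: "?A > 0" by (rule sphere_area_pos)
  let ?g = "radial_deriv \<phi>"
  obtain C where C: "\<And>x. norm (grad \<phi> x) \<le> C" using grad_bounded[OF \<phi>] by blast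
  have i: "integrable lborel (\<lambda>s. p s * (?g s)\<^sup>2)"
    by (rule vanishing_square_integrable[OF p_continuous p_nonneg p_zero radial_deriv_vanishing[OF \<phi>]])
  let ?J = "\<lambda>s. \<integral>\<^sup>+x. ennreal ((norm (grad \<phi> (s *\<^sub>R sgn x)))\<^sup>2) \<partial>unit_measure"
  let ?I = "\<lambda>s. \<integral>\<^sup>+x. ennreal (\<rho> (s *\<^sub>R sgn x) * (norm (grad \<phi> (s *\<^sub>R sgn x)))\<^sup>2) \<partial>unit_measure"
  have jensen: "ennreal ((?g s)\<^sup>2) \<le> ?J s" for s
  proof -
    let ?G = "\<lambda>x. inner (grad \<phi> (s *\<^sub>R sgn x)) (sgn x)"
    have b1: "(?G x)\<^sup>2 \<le> (norm (grad \<phi> (s *\<^sub>R sgn x)))\<^sup>2" for x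
      using radial_integrand_bound[OF \<phi> order_refl, of s x] by (metis abs_ge_zero power2_abs power_mono)
    have b2: "(norm (grad \<phi> (s *\<^sub>R sgn x)))\<^sup>2 \<le> C\<^sup>2" for x
      using C by (simp add: power_mono)
    have i2: "integrable unit_measure (\<lambda>x. (norm (grad \<phi> (s *\<^sub>R sgn x)))\<^sup>2)"
      by (intro unit_measure.integrable_const_bound[of _ "C\<^sup>2"] AE_I2) (use b2 in auto)
    have i1: "integrable unit_measure (\<lambda>x. (?G x)\<^sup>2)"
      by (rule Bochner_Integration.integrable_bound[OF i2]) (use b1 in auto)
    \<comment> \<open>Under a probability measure, Cauchy-Schwarz against the constant 1 is Jensen's
      inequality for squares.\<close>
    have "(?g s)\<^sup>2 \<le> (LINT x|unit_measure. (?G x)\<^sup>2)"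
      using weighted_Cauchy_Schwarz[of "unit_measure :: 'a measure" "\<lambda>_. 1" ?G "\<lambda>_. 1"] i1 radial_integrand_integrable[OF \<phi>]
      by (simp add: radial_deriv_def)
    also have "\<dots> \<le> (LINT x|unit_measure. (norm (grad \<phi> (s *\<^sub>R sgn x)))\<^sup>2)"
      by (intro integral_mono i1 i2 b1)
    finally show ?thesis
      by (subst nn_integral_eq_integral[OF i2]) (auto intro: ennreal_leI)
  qed
  have "ennreal (?A * (LINT s|lborel. p s * (?g s)\<^sup>2)) =
     (\<integral>\<^sup>+s. ennreal (?A * (p s * (?g s)\<^sup>2)) \<partial>lborel)"
    using A by (subst nn_integral_eq_integral) (auto intro!: integrable_mult_right i simp: p_nonneg)
  also have "\<dots> \<le> (\<integral>\<^sup>+s. shell TYPE('a) s * ?I s \<partial>lborel)"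
  proof (intro nn_integral_mono)
    fix s :: real
    show "ennreal (?A * (p s * (?g s)\<^sup>2)) \<le> shell TYPE('a) s * ?I s"
    proof (cases "s > 0")
      case True
      \<comment> \<open>\<open>c\<close> is the constant value of \<open>\<rho>\<close> on the
        sphere of radius \<open>s\<close>.\<close>
      define c where "c = p s / s ^ (DIM('a) - 1)"
      have c: "c \<ge> 0" using True p_nonneg by (simp add: c_def)
      have "?I s = (\<integral>\<^sup>+x. ennreal c * ennreal ((norm (grad \<phi> (s *\<^sub>R sgn x)))\<^sup>2) \<partial>unit_measure)"
      proof (rule nn_integral_cong_AE, use AE_unit_measure_sgn in eventually_elim)
        fix x :: 'a assume "norm (sgn x) = 1"
        then have n: "norm (s *\<^sub>R sgn x) = s" "s *\<^sub>R sgn x \<noteq> 0" using True by auto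
        then have "\<rho> (s *\<^sub>R sgn x) = c"
          using weight_radial[OF n(2)] True unfolding n(1) c_def by (simp add: eq_divide_eq)
        then show "ennreal (\<rho> (s *\<^sub>R sgn x) * (norm (grad \<phi> (s *\<^sub>R sgn x)))\<^sup>2) =
            ennreal c * ennreal ((norm (grad \<phi> (s *\<^sub>R sgn x)))\<^sup>2)"
          using c by (simp add: ennreal_mult)
      qed
      also have "\<dots> = ennreal c * ?J s"
        by (rule nn_integral_cmult) measurable
      also have "shell TYPE('a) s * \<dots> = ennreal (?A * s ^ (DIM('a) - 1) * c) * ?J s"
        using True A c by (simp add: ennreal_mult mult.assoc)
      also have "?A * s ^ (DIM('a) - 1) * c = ?A * p s" using True by (simp add: c_def)
      also have "ennreal (?A * p s) * ?J s \<ge> ennreal (?A * p s) * ennreal ((?g s)\<^sup>2)"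
        by (intro mult_left_mono jensen) auto
      moreover have "ennreal (?A * p s) * ennreal ((?g s)\<^sup>2) = ennreal (?A * (p s * (?g s)\<^sup>2))"
        using True A p_nonneg[of s] by (simp add: ennreal_mult[symmetric] mult.assoc)
      ultimately show ?thesis by simp
    qed (simp add: p_zero)
  qed
  also have "\<dots> = (\<integral>\<^sup>+x. ennreal (\<rho> x * (norm (grad \<phi> x))\<^sup>2) \<partial>lborel)"
    by (rule nn_integral_polar[symmetric]) measurable
  also have "\<dots> = ennreal (LINT x|lborel. \<rho> x * (norm (grad \<phi> x))\<^sup>2)"
    by (intro nn_integral_eq_integral energy_integrable_norm \<phi>) (simp add: weight_nonneg)
  finally have "?A * (LINT s|lborel. p s * (?g s)\<^sup>2) \<le> (LINT x|lborel. \<rho> x * (norm (grad \<phi> x))\<^sup>2)"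
    by (subst (asm) ennreal_le_iff) (auto intro!: Bochner_Integration.integral_nonneg simp: weight_nonneg)
  then have "sqrt ?A * wnorm p ?g \<le> E \<phi>"
    unfolding wenergy_def energy_norm_eq[OF \<phi>] real_sqrt_mult[symmetric] by (rule real_sqrt_le_mono)
  then show ?thesis using A by (simp add: field_simps)
qed

text \<open>Multiplying the derivative by a cutoff makes an error that tends to 0 in the weighted
  norm by dominated convergence. The primitive at \<open>r\<close> only sees
  \<open>s \<ge> r\<close>, hence it is exact for \<open>r \<ge> e\<close>.\<close>

lemma radial_deriv_cutoff:
  assumes \<phi>: "\<phi> \<in> tests" and e: "e > 0"
  obtains g where "g \<in> Cc T" "wdist p (radial_deriv \<phi>) g < e"
    "\<And>r. r \<ge> e \<Longrightarrow> tail g r = - spherical_mean \<phi> r"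
proof -
  let ?f = "radial_deriv \<phi>"
  obtain b where b: "0 < b" "ereal b < T" "\<And>x. norm x > b \<Longrightarrow> \<phi> x = 0 \<and> grad \<phi> x = 0"
    using test_fun_support_cball[OF \<phi>] by blast
  have f0: "?f s = 0" if "s > b" for s
    using that b(1) by (intro radial_deriv_eq_0[OF b(3)]) auto
  have cf: "continuous_on UNIV ?f" by (rule continuous_on_radial_deriv[OF \<phi>])
  have [measurable]: "?f \<in> borel_measurable borel" "p \<in> borel_measurable borel"
    using cf p_continuous by (auto intro: borel_measurable_continuous_onI)
  \<comment> \<open>For positive \<open>n\<close>, a ramp that is 0 up to \<open>1 / n\<close> and 1
    from \<open>2 / n\<close> on.\<close>
  define \<kappa> where "\<kappa> n s = max 0 (min 1 (real n * s - 1))" for n :: nat and s :: real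
  have \<kappa>01: "0 \<le> \<kappa> n s" "\<kappa> n s \<le> 1" for n s by (auto simp: \<kappa>_def)
  have c\<kappa>: "continuous_on UNIV (\<kappa> n)" for n unfolding \<kappa>_def by (intro continuous_intros)
  have [measurable]: "\<kappa> n \<in> borel_measurable borel" for n by (rule borel_measurable_continuous_onI[OF c\<kappa>])
  have \<kappa>1: "\<kappa> n s = 1" if "real n * s \<ge> 2" for n s using that by (simp add: \<kappa>_def)
  have ev: "\<forall>\<^sub>F n in sequentially. real n * s \<ge> 2" if "s > 0" for s
  proof -
    have "filterlim (\<lambda>n. real n * s) at_top sequentially"
      by (rule filterlim_at_top_mult_tendsto_pos[OF tendsto_const that filterlim_real_sequentially])
    then show ?thesis by (simp add: filterlim_at_top)
  qed
  have "(\<lambda>n. LINT s|lborel. p s * (?f s - \<kappa> n s * ?f s)\<^sup>2) \<longlonglongrightarrow> (LINT s|(lborel :: real measure). 0)"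
  proof (rule integral_dominated_convergence)
    show "integrable lborel (\<lambda>s. p s * (?f s)\<^sup>2)"
      by (rule vanishing_square_integrable[OF p_continuous p_nonneg p_zero radial_deriv_vanishing[OF \<phi>]])
    show "AE s in lborel. (\<lambda>n. p s * (?f s - \<kappa> n s * ?f s)\<^sup>2) \<longlonglongrightarrow> 0"
    proof (intro AE_I2)
      fix s :: real
      show "(\<lambda>n. p s * (?f s - \<kappa> n s * ?f s)\<^sup>2) \<longlonglongrightarrow> 0"
      proof (cases "s > 0")
        case True
        show ?thesis
          by (rule tendsto_eventually, use ev[OF True] in eventually_elim) (simp add: \<kappa>1)
      qed (simp add: p_zero)
    qed
    show "AE s in lborel. norm (p s * (?f s - \<kappa> n s * ?f s)\<^sup>2) \<le> p s * (?f s)\<^sup>2" for n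
    proof (intro AE_I2)
      fix s :: real
      have "(?f s - \<kappa> n s * ?f s)\<^sup>2 = (1 - \<kappa> n s)\<^sup>2 * (?f s)\<^sup>2" by (simp add: power2_eq_square algebra_simps)
      also have "\<dots> \<le> 1 * (?f s)\<^sup>2"
        using \<kappa>01[of n s] by (intro mult_right_mono) (auto simp: power2_eq_square intro: mult_le_one)
      finally show "norm (p s * (?f s - \<kappa> n s * ?f s)\<^sup>2) \<le> p s * (?f s)\<^sup>2"
        using p_nonneg[of s] by (simp add: abs_mult mult_left_mono)
    qed
  qed measurable
  then have "(\<lambda>n. wdist p ?f (\<lambda>s. \<kappa> n s * ?f s)) \<longlonglongrightarrow> 0"
    unfolding wenergy_def using tendsto_real_sqrt by fastforce
  then have "\<forall>\<^sub>F n in sequentially. wdist p ?f (\<lambda>s. \<kappa> n s * ?f s) < e"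
    using e by (rule order_tendstoD)
  \<comment> \<open>The second condition puts the end \<open>2 / n\<close> of the ramp at or below
    both \<open>e\<close> and \<open>b\<close>: the cutoff is 1 from \<open>e\<close> on, and
    \<open>1 / n < b\<close> makes the support interval nondegenerate.\<close>
  then have "\<forall>\<^sub>F n in sequentially. wdist p ?f (\<lambda>s. \<kappa> n s * ?f s) < e \<and> real n * min e b \<ge> 2"
    using e b(1) by (intro eventually_conj ev) auto
  then obtain n where n: "wdist p ?f (\<lambda>s. \<kappa> n s * ?f s) < e" "real n * min e b \<ge> 2"
    unfolding eventually_sequentially by blast
  define g where "g s = \<kappa> n s * ?f s" for s
  have npos: "real n > 0" using n(2) by (cases n) auto
  have cg: "continuous_on UNIV g" unfolding g_def by (intro continuous_intros c\<kappa> cf)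
  have g0: "g s = 0" if "s \<notin> {1 / real n..b}" for s
  proof (cases "s > b")
    case False
    then have "s < 1 / real n" using that by auto
    then have "real n * s < 1" using npos by (simp add: field_simps)
    then show ?thesis by (simp add: g_def \<kappa>_def)
  qed (simp add: g_def f0)
  have nb: "real n * b \<ge> 2" "real n * e \<ge> 2" using n(2) npos
    by (meson mult_left_mono min.cobounded1 min.cobounded2 of_nat_0_le_iff order_trans)+
  show ?thesis
  proof (rule that)
    show "g \<in> Cc T"
      unfolding Cc_def using cg g0 b npos nb
      by (intro CollectI conjI exI[of _ "1 / real n"] exI[of _ b]) (auto simp: field_simps)
    show "wdist p ?f g < e" using n(1) by (simp add: g_def)
    fix r assume r: "r \<ge> e"
    have "g s = ?f s" if "s \<ge> r" for s
    proof -
      have "real n * e \<le> real n * s" using that r by (intro mult_left_mono) auto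
      then show ?thesis using nb by (simp add: g_def \<kappa>1)
    qed
    then have "tail g r = tail ?f r"
      unfolding tail_def set_lebesgue_integral_def
      by (intro Bochner_Integration.integral_cong) (auto simp: indicator_def)
    moreover have "spherical_mean \<phi> r = - tail ?f r"
      by (rule spherical_mean_eq_tail[OF \<phi> b(3)]) (use r e in auto)
    ultimately show "tail g r = - spherical_mean \<phi> r" by simp
  qed
qed

text \<open>In polar coordinates, L1 convergence on a ball says that the spherical L1 errors,
  integrated over the radius, tend to 0. Fatou's lemma gives them lower limit 0 for almost every
  radius without choosing a subsequence. This identifies the limit of the means wherever one exists,
  which is why the conclusion is conditional.\<close>

lemma spherical_mean_limit:
  assumes rep: "represents \<rho> \<Omega> \<phi> u" and b: "0 < b" "ereal b < T"
    and u: "\<And>x. x \<in> \<Omega> \<Longrightarrow> x \<noteq> 0 \<Longrightarrow> u x = U (norm x)"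
  shows "AE r in lborel. 0 < r \<and> r \<le> b \<longrightarrow> (\<forall>m. (\<lambda>n. spherical_mean (\<phi> n) r) \<longlonglongrightarrow> m \<longrightarrow> m = U r)"
proof -
  let ?A = "sphere_area TYPE('a)"
  have A: "?A > 0" by (rule sphere_area_pos)
  note tf = representsD(1)[OF rep]
  note [measurable] = test_fun_measurable[OF tf]
  define K where "K = cball (0::'a) b"
  have K: "compact K" "K \<subseteq> \<Omega>"
    using b by (auto simp: K_def domain_eq intro: le_less_trans[of _ "ereal b"])
  have [measurable]: "K \<in> sets borel" by (simp add: K_def)
  have "(\<lambda>x. indicator K x *\<^sub>R u x) \<in> borel_measurable (completion lborel)"
    using representsD(3)[OF rep K] unfolding set_integrable_def by blast
  \<comment> \<open>The polar formula is for Borel functions, so \<open>u\<close> is replaced on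
    \<open>K\<close> by a Borel representative \<open>v\<close>.\<close>
  then obtain v where v [measurable]: "v \<in> borel_measurable lborel" and veq: "AE x in lborel. indicator K x *\<^sub>R u x = v x"
    using completion_ex_borel_measurable_real by blast
  define H where "H n r = (\<integral>\<^sup>+x. indicator K (r *\<^sub>R sgn x) * ennreal \<bar>\<phi> n (r *\<^sub>R sgn x) - v (r *\<^sub>R sgn (x::'a))\<bar> \<partial>unit_measure)" for n r
  define F where "F n r = shell TYPE('a) r * H n r" for n r
  have [measurable]: "F n \<in> borel_measurable borel" for n
    unfolding F_def H_def by measurable
  have "(\<integral>\<^sup>+r. F n r \<partial>lborel) = ennreal (L1_dist K (\<phi> n) u)" for n
  proof -
    have "(\<integral>\<^sup>+r. F n r \<partial>lborel) = (\<integral>\<^sup>+x. indicator K x * ennreal \<bar>\<phi> n x - v x\<bar> \<partial>lborel)"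
      unfolding F_def H_def by (rule nn_integral_polar[symmetric]) measurable
    also have "\<dots> = (\<integral>\<^sup>+x. ennreal (indicator K x *\<^sub>R \<bar>\<phi> n x - u x\<bar>) \<partial>lborel)"
      using veq by (intro nn_integral_cong_AE) (auto elim!: eventually_mono simp: indicator_def)
    also have "\<dots> = (\<integral>\<^sup>+x. ennreal (indicator K x *\<^sub>R \<bar>\<phi> n x - u x\<bar>) \<partial>lebesgue)"
      by (simp add: nn_integral_completion)
    also have "\<dots> = ennreal (L1_dist K (\<phi> n) u)"
      unfolding set_lebesgue_integral_def
    proof (intro nn_integral_eq_integral)
      have "set_integrable lebesgue K (\<lambda>x. \<bar>\<phi> n x - u x\<bar>)"
        by (intro set_integrable_abs set_integral_diff(1) test_fun_set_integrable[OF tf K(1)] representsD(3)[OF rep K])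
      then show "integrable lebesgue (\<lambda>x. indicator K x *\<^sub>R \<bar>\<phi> n x - u x\<bar>)"
        by (simp add: set_integrable_def)
    qed auto
    finally show ?thesis .
  qed
  moreover have "(\<lambda>n. ennreal (L1_dist K (\<phi> n) u)) \<longlonglongrightarrow> ennreal 0"
    by (intro tendsto_ennrealI representsD(4)[OF rep K])
  ultimately have "(\<lambda>n. \<integral>\<^sup>+r. F n r \<partial>lborel) \<longlonglongrightarrow> 0" by simp
  then have "liminf (\<lambda>n. \<integral>\<^sup>+r. F n r \<partial>lborel) = 0" by (intro lim_imp_Liminf) auto
  moreover have "(\<integral>\<^sup>+r. liminf (\<lambda>n. F n r) \<partial>lborel) \<le> liminf (\<lambda>n. \<integral>\<^sup>+r. F n r \<partial>lborel)"
    by (rule nn_integral_liminf) simp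
  ultimately have "(\<integral>\<^sup>+r. liminf (\<lambda>n. F n r) \<partial>lborel) = 0" by simp
  then have AE1: "AE r in lborel. liminf (\<lambda>n. F n r) = 0"
    by (rule nn_integral_0_iff_AE[THEN iffD1, rotated]) measurable
  have AE2: "AE r in lborel. 0 < r \<longrightarrow> (AE x in unit_measure. indicator K (r *\<^sub>R sgn x) *\<^sub>R u (r *\<^sub>R sgn x) = v (r *\<^sub>R sgn x))"
    by (rule AE_polar[OF veq])
  from AE1 AE2 show ?thesis
  proof (eventually_elim, intro impI allI, elim conjE)
    fix r m
    assume lim0: "liminf (\<lambda>n. F n r) = 0" and r: "0 < r" "r \<le> b" and m: "(\<lambda>n. spherical_mean (\<phi> n) r) \<longlonglongrightarrow> m"
      and "0 < r \<longrightarrow> (AE x in unit_measure. indicator K (r *\<^sub>R sgn x) *\<^sub>R u (r *\<^sub>R sgn x) = v (r *\<^sub>R sgn x))"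
    then have vU: "AE x in unit_measure. indicator K (r *\<^sub>R sgn x) *\<^sub>R u (r *\<^sub>R sgn x) = v (r *\<^sub>R sgn x)" by simp
    have vr: "AE x in unit_measure. r *\<^sub>R sgn (x::'a) \<in> K \<and> v (r *\<^sub>R sgn x) = U r"
      using vU AE_unit_measure_sgn
    proof eventually_elim
      fix x :: 'a assume *: "indicator K (r *\<^sub>R sgn x) *\<^sub>R u (r *\<^sub>R sgn x) = v (r *\<^sub>R sgn x)" and n: "norm (sgn x) = 1"
      have "r *\<^sub>R sgn x \<in> K" "r *\<^sub>R sgn x \<noteq> 0" "norm (r *\<^sub>R sgn x) = r" using n r by (auto simp: K_def)
      then show "r *\<^sub>R sgn x \<in> K \<and> v (r *\<^sub>R sgn x) = U r"
        using * u[of "r *\<^sub>R sgn x"] K(2) by auto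
    qed
    \<comment> \<open>The mean of \<open>\<phi> n\<close> minus \<open>U r\<close> is at most the
      spherical error \<open>H n r\<close>, since \<open>v\<close> equals \<open>U r\<close> almost
      everywhere on this sphere.\<close>
    have "ennreal (?A * r ^ (DIM('a) - 1) * \<bar>spherical_mean (\<phi> n) r - U r\<bar>) \<le> F n r" for n
    proof -
      have int: "integrable unit_measure (\<lambda>x. \<phi> n (r *\<^sub>R sgn x) - U r)"
        by (intro Bochner_Integration.integrable_diff mean_integrand_integrable[OF tf]) simp
      have "spherical_mean (\<phi> n) r - U r = (LINT x|unit_measure. \<phi> n (r *\<^sub>R sgn x) - U r)"
        unfolding spherical_mean_def
        by (subst Bochner_Integration.integral_diff) (auto intro: mean_integrand_integrable[OF tf])
      then have "ennreal \<bar>spherical_mean (\<phi> n) r - U r\<bar> \<le> (\<integral>\<^sup>+x. ennreal \<bar>\<phi> n (r *\<^sub>R sgn x) - U r\<bar> \<partial>unit_measure)"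
        using integral_norm_bound_ennreal[OF int] by simp
      also have "\<dots> = H n r"
        unfolding H_def by (rule nn_integral_cong_AE, use vr in eventually_elim) auto
      finally have "ennreal (?A * r ^ (DIM('a) - 1)) * ennreal \<bar>spherical_mean (\<phi> n) r - U r\<bar> \<le> F n r"
        using r(1) by (simp add: F_def mult_left_mono)
      then show ?thesis using A r(1) by (simp add: ennreal_mult)
    qed
    then have "liminf (\<lambda>n. ennreal (?A * r ^ (DIM('a) - 1) * \<bar>spherical_mean (\<phi> n) r - U r\<bar>)) \<le> 0"
      unfolding lim0[symmetric] by (intro Liminf_mono always_eventually allI)
    moreover have "(\<lambda>n. ennreal (?A * r ^ (DIM('a) - 1) * \<bar>spherical_mean (\<phi> n) r - U r\<bar>)) \<longlonglongrightarrow>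
        ennreal (?A * r ^ (DIM('a) - 1) * \<bar>m - U r\<bar>)"
      by (intro tendsto_ennrealI tendsto_intros m)
    then have "liminf (\<lambda>n. ennreal (?A * r ^ (DIM('a) - 1) * \<bar>spherical_mean (\<phi> n) r - U r\<bar>)) =
        ennreal (?A * r ^ (DIM('a) - 1) * \<bar>m - U r\<bar>)"
      by (intro lim_imp_Liminf) auto
    ultimately have "?A * r ^ (DIM('a) - 1) * \<bar>m - U r\<bar> \<le> 0" by (simp add: ennreal_eq_0_iff)
    moreover have "?A * r ^ (DIM('a) - 1) > 0" using A r(1) by simp
    ultimately have "\<not> 0 < \<bar>m - U r\<bar>"
      using mult_pos_pos[of "?A * r ^ (DIM('a) - 1)" "\<bar>m - U r\<bar>"] by linarith
    then show "m = U r" by simp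
  qed
qed

text \<open>The primitives of the cut-off derivatives converge at every radius in
  \<open>(0, T)\<close> by the bound through \<open>q\<close>, and their negatives equal the
  spherical means once \<open>1 / real (Suc n) < r\<close>. For almost every \<open>r\<close> the
  limit of these means can only be \<open>U r\<close>.\<close>

theorem radial_representation:
  assumes rep: "represents \<rho> \<Omega> \<phi> u"
    and u: "\<And>x. x \<in> \<Omega> \<Longrightarrow> x \<noteq> 0 \<Longrightarrow> u x = U (norm x)"
  obtains g where "\<And>n. g n \<in> Cc T" "wcauchy p g" "profile_limit T g U"
proof -
  let ?A = "sphere_area TYPE('a)"
  have A: "?A > 0" by (rule sphere_area_pos)
  note tf = representsD(1)[OF rep]
  have "\<exists>g. g \<in> Cc T \<and> wdist p (radial_deriv (\<phi> n)) g < 1 / real (Suc n) \<and>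
     (\<forall>r\<ge>1 / real (Suc n). tail g r = - spherical_mean (\<phi> n) r)" for n
    by (rule radial_deriv_cutoff[OF tf, of "1 / real (Suc n)" n]) auto
  then obtain g where g: "\<And>n. g n \<in> Cc T" "\<And>n. wdist p (radial_deriv (\<phi> n)) (g n) < 1 / real (Suc n)"
     "\<And>n r. r \<ge> 1 / real (Suc n) \<Longrightarrow> tail (g n) r = - spherical_mean (\<phi> n) r" by metis
  have inv0: "(\<lambda>n. 1 / real (Suc n)) \<longlonglongrightarrow> 0" by (rule LIMSEQ_Suc[OF lim_1_over_n])
  note pc = p_continuous p_nonneg p_zero
  have fc: "wcauchy p (\<lambda>n. radial_deriv (\<phi> n))"
    unfolding wcauchy_def
  proof (intro allI impI)
    fix e :: real assume "e > 0"
    then have "sqrt ?A * e > 0" using A by simp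
    from representsD(2)[OF rep this] obtain M where
      M: "\<And>m n. m \<ge> M \<Longrightarrow> n \<ge> M \<Longrightarrow> E (\<lambda>x. \<phi> m x - \<phi> n x) < sqrt ?A * e" by blast
    have "wdist p (radial_deriv (\<phi> m)) (radial_deriv (\<phi> n)) < e" if "m \<ge> M" "n \<ge> M" for m n
    proof -
      have "wdist p (radial_deriv (\<phi> m)) (radial_deriv (\<phi> n)) \<le> E (\<lambda>x. \<phi> m x - \<phi> n x) / sqrt ?A"
        using radial_deriv_energy_le[OF test_functions_diff[OF tf tf], of m n]
        unfolding radial_deriv_diff[OF tf tf, abs_def] .
      also have "\<dots> < e" using M[OF that] A by (simp add: field_simps)
      finally show ?thesis .
    qed
    then show "\<exists>M. \<forall>m\<ge>M. \<forall>n\<ge>M. wdist p (radial_deriv (\<phi> m)) (radial_deriv (\<phi> n)) < e" by blast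
  qed
  have cauchy: "wcauchy p g"
    by (rule wcauchy_perturb[OF pc _ _ fc])
       (assumption | rule radial_deriv_vanishing[OF tf] Cc_vanishing[OF g(1)] less_imp_le[OF g(2)])+
  have conv: "\<exists>m. (\<lambda>n. - tail (g n) r) \<longlonglongrightarrow> m \<and> (\<lambda>n. spherical_mean (\<phi> n) r) \<longlonglongrightarrow> m"
    if r: "0 < r" "ereal r < T" for r
  proof -
    have "Cauchy (\<lambda>n. - tail (g n) r)"
    proof (rule metric_CauchyI)
      fix e :: real assume e: "e > 0"
      define e' where "e' = e / (sqrt (q r) + 1)"
      have q0: "sqrt (q r) \<ge> 0" using q_nonneg[OF r] by simp
      have e': "e' > 0" unfolding e'_def using e q0 by (intro divide_pos_pos) linarith+
      then obtain M where M: "\<And>m n. m \<ge> M \<Longrightarrow> n \<ge> M \<Longrightarrow> wdist p (g m) (g n) < e'"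
        using cauchy unfolding wcauchy_def by blast
      have "dist (- tail (g m) r) (- tail (g n) r) < e" if "m \<ge> M" "n \<ge> M" for m n
      proof -
        have "dist (- tail (g m) r) (- tail (g n) r) = \<bar>tail (\<lambda>s. g m s - g n s) r\<bar>"
          by (simp add: dist_real_def tail_diff[OF g(1) g(1)] abs_minus_commute)
        also have "\<dots> \<le> sqrt (q r) * wdist p (g m) (g n)"
          by (intro tail_bound_abs Cc_diff g r)
        also have "\<dots> \<le> sqrt (q r) * e'"
          using M[OF that] q0 by (intro mult_left_mono) auto
        also have "\<dots> < (sqrt (q r) + 1) * e'" using e' by simp
        also have "\<dots> = e"
        proof -
          have "sqrt (q r) + 1 \<noteq> 0" using q0 by linarith
          then show ?thesis unfolding e'_def by simp
        qed
        finally show ?thesis .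
      qed
      then show "\<exists>M. \<forall>m\<ge>M. \<forall>n\<ge>M. dist (- tail (g m) r) (- tail (g n) r) < e" by blast
    qed
    then obtain m where m: "(\<lambda>n. - tail (g n) r) \<longlonglongrightarrow> m"
      using Cauchy_convergent_iff convergent_def by blast
    have "\<forall>\<^sub>F n in sequentially. - tail (g n) r = spherical_mean (\<phi> n) r"
      using order_tendstoD(2)[OF inv0 r(1)] by eventually_elim (simp add: g(3) less_imp_le del: of_nat_Suc)
    from Lim_transform_eventually[OF m this] show ?thesis using m by blast
  qed
  let ?P = "\<lambda>b r. 0 < r \<and> r \<le> b \<longrightarrow> (\<forall>m. (\<lambda>n. spherical_mean (\<phi> n) r) \<longlonglongrightarrow> m \<longrightarrow> m = U r)"
  \<comment> \<open>The exceptional null set depends on the outer radius \<open>b\<close>;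
    restricting to rational \<open>b\<close> keeps the union null.\<close>
  have "AE r in lborel. \<forall>b\<in>\<rat>. 0 < b \<and> ereal b < T \<longrightarrow>
      ?P b r"
  proof (subst AE_ball_countable[OF countable_rat], intro ballI)
    fix b :: real
    show "AE r in lborel. 0 < b \<and> ereal b < T \<longrightarrow>
      ?P b r"
      using spherical_mean_limit[OF rep _ _ u, of b]
      by (cases "0 < b \<and> ereal b < T") auto
  qed
  then have "profile_limit T g U"
  proof (eventually_elim, intro impI)
    fix r assume *: "\<forall>b\<in>\<rat>. 0 < b \<and> ereal b < T \<longrightarrow>
      ?P b r" and r: "0 < r" "ereal r < T"
    obtain b where b: "b \<in> \<rat>" "r < b" "ereal b < T"
      using ereal_dense3[OF r(2)] Rats_of_rat by (metis less_ereal.simps(1))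
    obtain m where m: "(\<lambda>n. - tail (g n) r) \<longlonglongrightarrow> m" "(\<lambda>n. spherical_mean (\<phi> n) r) \<longlonglongrightarrow> m"
      using conv[OF r] by blast
    then have "m = U r" using * b r by auto
    then show "(\<lambda>n. - tail (g n) r) \<longlonglongrightarrow> U r" using m by simp
  qed
  then show ?thesis using that[OF g(1) cauchy] by blast
qed

lemma wcauchy_energy_convergent:
  assumes g: "\<And>n. g n \<in> Cc T" and "wcauchy p g"
  shows "\<exists>l. (\<lambda>n. wnorm p (g n)) \<longlonglongrightarrow> l"
proof -
  have "Cauchy (\<lambda>n. wnorm p (g n))"
  proof (rule metric_CauchyI)
    fix e :: real assume "e > 0"
    then obtain M where M: "\<And>m n. m \<ge> M \<Longrightarrow> n \<ge> M \<Longrightarrow> wdist p (g m) (g n) < e"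
      using assms(2) unfolding wcauchy_def by blast
    have "dist (wnorm p (g m)) (wnorm p (g n)) < e" if "m \<ge> M" "n \<ge> M" for m n
      using sqrt_wenergy_reverse_triangle[OF p_continuous p_nonneg p_zero Cc_vanishing[OF g] Cc_vanishing[OF g], of m n] M[OF that]
      by (simp add: dist_real_def)
    then show "\<exists>M. \<forall>m\<ge>M. \<forall>n\<ge>M. dist (wnorm p (g m)) (wnorm p (g n)) < e" by blast
  qed
  then show ?thesis using Cauchy_convergent_iff convergent_def by blast
qed

end

section \<open>Change of the radial variable\<close>

text \<open>Cauchy-Schwarz with weight \<open>p\<close> for \<open>g\<close> and
  \<open>1 / p\<close> on \<open>{r..c}\<close>, where the integral of \<open>1 / p\<close> is
  \<open>P c - P r\<close>. Here \<open>c\<close> depends on the support of \<open>g\<close>, so the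
  increment is bounded for all admissible \<open>c\<close> at once.\<close>

lemma tail_bound_antiderivative:
  assumes g: "g \<in> Cc T" and r: "0 < r" "ereal r < T"
    and p: "continuous_on UNIV p" "\<And>s. 0 \<le> p s" "\<And>s. 0 < s \<Longrightarrow> 0 < p s"
    and P: "\<And>s. 0 < s \<Longrightarrow> DERIV P s :> 1 / p s"
    and q: "\<And>c. r \<le> c \<Longrightarrow> ereal c < T \<Longrightarrow> P c - P r \<le> q"
  shows "(tail g r)\<^sup>2 \<le> q * wenergy p g"
proof -
  obtain a b where ab: "0 < a" "a < b" "ereal b < T" "\<And>s. s \<notin> {a..b} \<Longrightarrow> g s = 0"
    using CcD(2)[OF g] by blast
  \<comment> \<open>This \<open>c\<close> is at least \<open>r\<close> and at least the end of the
    support, so the integral of \<open>g\<close> over \<open>{r..c}\<close> is the full tail even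
    when the support ends before \<open>r\<close>.\<close>
  define c where "c = max b r"
  have c: "r \<le> c" "ereal c < T" using ab r by (auto simp: c_def max_def)
  define I where "I s = indicator {r..c} s / p s" for s
  have I1: "p s * (g s * I s) = indicator {r..c} s *\<^sub>R g s" for s
    using p(3)[of s] r(1) by (auto simp: I_def indicator_def)
  have I2: "p s * (I s)\<^sup>2 = indicator {r..c} s *\<^sub>R (1 / p s)" for s
    using p(3)[of s] r(1) by (auto simp: I_def indicator_def power2_eq_square)
  have "integrable lborel (\<lambda>s. indicator {r..c} s *\<^sub>R g s)"
    by (intro borel_integrable_compact continuous_on_subset[OF CcD(1)[OF g]]) auto
  moreover have cont: "continuous_on {r..c} (\<lambda>s. 1 / p s)"
    using p(3) r(1) by (intro continuous_intros continuous_on_subset[OF p(1)]) (auto simp: less_imp_neq[symmetric])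
  then have "integrable lborel (\<lambda>s. indicator {r..c} s *\<^sub>R (1 / p s))"
    by (intro borel_integrable_compact) auto
  ultimately have "(LINT s|lborel. p s * (g s * I s))\<^sup>2 \<le> wenergy p g * (LINT s|lborel. p s * (I s)\<^sup>2)"
    using weighted_Cauchy_Schwarz[of lborel p g I] Cc_square_integrable[OF g p(1)]
    by (simp add: I1 I2 wenergy_def p(2) del: real_scaleR_def)
  moreover have "(LINT s|lborel. p s * (I s)\<^sup>2) = P c - P r"
    unfolding I2
  proof (rule integral_FTC_Icc[OF c(1) _ cont])
    fix s assume "r \<le> s" "s \<le> c"
    then show "(P has_vector_derivative 1 / p s) (at s within {r..c})"
      using P[of s] r(1)
      by (auto simp: has_real_derivative_iff_has_vector_derivative[symmetric] intro: has_field_derivative_at_within)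
  qed
  moreover have "(LINT s|lborel. p s * (g s * I s)) = tail g r"
  proof -
    have "indicator {r..c} s *\<^sub>R g s = indicator {r..} s *\<^sub>R g s" for s
      using ab(4)[of s] by (auto simp: indicator_def c_def le_max_iff_disj)
    then show ?thesis by (simp only: I1 tail_def set_lebesgue_integral_def)
  qed
  ultimately have "(tail g r)\<^sup>2 \<le> wenergy p g * (P c - P r)" by simp
  also have "\<dots> \<le> wenergy p g * q"
    using q[OF c] wenergy_nonneg[OF p(2)] by (intro mult_left_mono) auto
  finally show ?thesis by (simp add: mult.commute)
qed

lemma ereal_less_trans: "a < b \<Longrightarrow> ereal b < T \<Longrightarrow> ereal a < T"
  by (metis less_ereal.simps(1) less_trans)

text \<open>\<open>\<theta>\<close> maps \<open>(0, S)\<close> onto \<open>(0, T)\<close>, and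
  profiles travel the other way by composition. In the energy of a transported derivative the factor
  \<open>\<theta>'\<close> occurs squared: one copy is consumed by \<open>weights\<close>, the other
  by the substitution, and the constant \<open>c\<close> is left. Differentiability of the inverse
  serves to carry null sets.\<close>

locale change_of_variable =
  fixes S T :: ereal and \<theta> \<theta>' \<theta>i p1 p2 :: "real \<Rightarrow> real" and c :: real
  assumes maps: "0 < s \<Longrightarrow> ereal s < S \<Longrightarrow> 0 < \<theta> s" "0 < s \<Longrightarrow> ereal s < S \<Longrightarrow> ereal (\<theta> s) < T"
    and maps_inv: "0 < y \<Longrightarrow> ereal y < T \<Longrightarrow> 0 < \<theta>i y" "0 < y \<Longrightarrow> ereal y < T \<Longrightarrow> ereal (\<theta>i y) < S"
    and inv1: "0 < s \<Longrightarrow> ereal s < S \<Longrightarrow> \<theta>i (\<theta> s) = s"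
    and inv2: "0 < y \<Longrightarrow> ereal y < T \<Longrightarrow> \<theta> (\<theta>i y) = y"
    and deriv: "0 < s \<Longrightarrow> ereal s < S \<Longrightarrow> DERIV \<theta> s :> \<theta>' s"
    and deriv_pos: "0 < s \<Longrightarrow> ereal s < S \<Longrightarrow> 0 < \<theta>' s"
    and deriv_cont: "continuous_on {s. 0 < s \<and> ereal s < S} \<theta>'"
    and inv_differentiable: "0 < y \<Longrightarrow> ereal y < T \<Longrightarrow> \<theta>i differentiable (at y)"
    and weights: "0 < s \<Longrightarrow> ereal s < S \<Longrightarrow> p2 s * \<theta>' s = c * p1 (\<theta> s)"
    and p1_cont: "continuous_on UNIV p1"
begin

text \<open>The chain rule: if \<open>U\<close> has derivative \<open>g\<close> on
  \<open>(0, T)\<close>, then \<open>U\<close> composed with \<open>\<theta>\<close> has derivative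
  \<open>pull g\<close> on \<open>(0, S)\<close>. The value 0 elsewhere makes it a function on the
  whole line.\<close>

definition pull :: "(real \<Rightarrow> real) \<Rightarrow> real \<Rightarrow> real" where
  "pull g s = (if 0 < s \<and> ereal s < S then g (\<theta> s) * \<theta>' s else 0)"

lemma subinterval:
  assumes "0 < s" "ereal d < S" "x \<in> {s..d}" shows "0 < x" "ereal x < S"
  using assms by (auto intro: le_less_trans[of _ "ereal d"])

lemma theta_strict_mono:
  assumes "0 < s" "s < s'" "ereal s' < S"
  shows "\<theta> s < \<theta> s'"
proof (rule DERIV_pos_imp_increasing[OF assms(2)])
  fix x assume "s \<le> x" "x \<le> s'"
  then have "0 < x" "ereal x < S" using subinterval[OF assms(1,3), of x] by auto
  then show "\<exists>y. DERIV \<theta> x :> y \<and> 0 < y" using deriv deriv_pos by blast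
qed

lemma theta_le_iff:
  assumes "0 < s" "ereal s < S" "0 < s'" "ereal s' < S"
  shows "\<theta> s \<le> \<theta> s' \<longleftrightarrow> s \<le> s'"
  using assms theta_strict_mono[of s s'] theta_strict_mono[of s' s] by (cases s s' rule: linorder_cases) auto

lemma pull_support:
  assumes "0 < a" "a < b" "ereal b < T" "\<And>s. s \<notin> {a..b} \<Longrightarrow> g s = 0" "s \<notin> {\<theta>i a..\<theta>i b}"
  shows "pull g s = 0"
proof (cases "0 < s \<and> ereal s < S")
  case True
  note aT = ereal_less_trans[OF assms(2,3)]
  have b: "0 < b" using assms by simp
  have "\<theta> s \<notin> {a..b}"
    using theta_le_iff[of "\<theta>i a" s] theta_le_iff[of s "\<theta>i b"] True assms(5) maps_inv[OF assms(1) aT] maps_inv[OF b assms(3)]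
      inv2[OF assms(1) aT] inv2[OF b assms(3)] by auto
  then show ?thesis using assms(4) by (simp add: pull_def)
qed (auto simp: pull_def)

lemma pull_Cc:
  assumes g: "g \<in> Cc T"
  shows "pull g \<in> Cc S"
proof -
  obtain a b where ab: "0 < a" "a < b" "ereal b < T" "\<And>s. s \<notin> {a..b} \<Longrightarrow> g s = 0"
    using CcD(2)[OF g] by blast
  note aT = ereal_less_trans[OF ab(2,3)]
  have b0: "0 < b" using ab by simp
  let ?U = "{s. 0 < s \<and> ereal s < S}"
  let ?V = "- {\<theta>i a..\<theta>i b}"
  have m: "0 < \<theta>i a" "ereal (\<theta>i a) < S" "0 < \<theta>i b" "ereal (\<theta>i b) < S"
    using maps_inv[OF ab(1) aT] maps_inv[OF b0 ab(3)] by auto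
  have "\<theta>i a < \<theta>i b"
    using theta_le_iff[of "\<theta>i b" "\<theta>i a"] m ab(2) inv2[OF ab(1) aT] inv2[OF b0 ab(3)] by auto
  \<comment> \<open>Two open sets cover the line: the interval \<open>(0, S)\<close>, and the
    complement of the transported support, where \<open>pull g\<close> is 0. The ends of the
    interval lie in the second set.\<close>
  moreover have "continuous_on UNIV (pull g)"
  proof -
    have oU: "open ?U"
    proof -
      have "open (ereal -` {..<S})" by (intro open_vimage continuous_intros)
      then have "open ({0<..} \<inter> ereal -` {..<S})" by (intro open_Int open_greaterThan)
      moreover have "{0<..} \<inter> ereal -` {..<S} = ?U" by auto
      ultimately show ?thesis by (simp only:)
    qed
    have "continuous_on ?U \<theta>"
      using deriv by (intro continuous_at_imp_continuous_on) (auto intro: DERIV_isCont)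
    then have "continuous_on ?U (\<lambda>s. g (\<theta> s) * \<theta>' s)"
      by (intro continuous_on_mult deriv_cont continuous_on_compose2[OF CcD(1)[OF g]]) auto
    then have "continuous_on ?U (pull g)"
      by (rule continuous_on_eq) (auto simp: pull_def)
    moreover have "continuous_on ?V (pull g)"
      by (rule continuous_on_eq[OF continuous_on_const[of _ 0]])
         (use pull_support[OF ab] in auto)
    ultimately have "continuous_on (?U \<union> ?V) (pull g)"
      using oU by (intro continuous_on_open_Un) auto
    moreover have "?U \<union> ?V = UNIV"
      using m by (auto intro: less_le_trans le_less_trans[of _ "ereal (\<theta>i b)"])
    ultimately show ?thesis by simp
  qed
  ultimately show ?thesis
    unfolding Cc_def using m pull_support[OF ab]
    by (intro CollectI conjI exI[of _ "\<theta>i a"] exI[of _ "\<theta>i b"]) auto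
qed

lemma pull_diff: "pull (\<lambda>s. g s - h s) = (\<lambda>s. pull g s - pull h s)"
  by (auto simp: pull_def left_diff_distrib)

lemma integral_pull:
  assumes f: "continuous_on UNIV f" and sd: "0 < s" "s \<le> d" "ereal d < S"
  shows "(LBINT x. f x * indicator {\<theta> s..\<theta> d} x) = (LBINT x. f (\<theta> x) * \<theta>' x * indicator {s..d} x)"
proof (rule integral_substitution(2)[OF _ _ _ _ sd(2)])
  show "set_integrable lborel {\<theta> s..\<theta> d} f"
    by (intro borel_integrable_atLeastAtMost' continuous_on_subset[OF f]) auto
  show "continuous_on {s..d} \<theta>'"
    using subinterval[OF sd(1,3)] by (intro continuous_on_subset[OF deriv_cont]) auto
qed (use subinterval[OF sd(1,3)] deriv deriv_pos in \<open>auto intro: less_imp_le\<close>)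

lemma tail_pull:
  assumes g: "g \<in> Cc T" and s: "0 < s" "ereal s < S"
  shows "tail (pull g) s = tail g (\<theta> s)"
proof -
  obtain a b where ab: "0 < a" "a < b" "ereal b < T" "\<And>s. s \<notin> {a..b} \<Longrightarrow> g s = 0"
    using CcD(2)[OF g] by blast
  have b0: "0 < b" using ab by simp
  note mb = maps_inv[OF b0 ab(3)]
  define d where "d = max s (\<theta>i b)"
  have d: "s \<le> d" "ereal d < S" "\<theta>i b \<le> d" "0 < d" using s mb by (auto simp: d_def max_def)
  have "\<theta> (\<theta>i b) \<le> \<theta> d" using theta_le_iff[of "\<theta>i b" d] d mb by auto
  then have bd: "b \<le> \<theta> d" using inv2[OF b0 ab(3)] by simp
  have "tail (pull g) s = (LBINT x. g (\<theta> x) * \<theta>' x * indicator {s..d} x)"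
    unfolding tail_def set_lebesgue_integral_def
  proof (intro Bochner_Integration.integral_cong refl)
    fix x
    show "indicator {s..} x *\<^sub>R pull g x = g (\<theta> x) * \<theta>' x * indicator {s..d} x"
    proof (cases "x \<in> {s..d}")
      case True
      then show ?thesis using subinterval[OF s(1) d(2) True] by (simp add: pull_def)
    next
      case False
      then have "x < s \<or> x \<notin> {\<theta>i a..\<theta>i b}" using d by auto
      then show ?thesis using pull_support[OF ab] False by auto
    qed
  qed
  also have "\<dots> = (LBINT x. g x * indicator {\<theta> s..\<theta> d} x)"
    by (rule integral_pull[OF CcD(1)[OF g] s(1) d(1,2), symmetric])
  also have "\<dots> = tail g (\<theta> s)"
    unfolding tail_def set_lebesgue_integral_def
    using ab(4) bd by (intro Bochner_Integration.integral_cong refl) (auto simp: indicator_def)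
  finally show ?thesis .
qed

lemma wenergy_pull:
  assumes g: "g \<in> Cc T"
  shows "wenergy p2 (pull g) = c * wenergy p1 g"
proof -
  obtain a b where ab: "0 < a" "a < b" "ereal b < T" "\<And>s. s \<notin> {a..b} \<Longrightarrow> g s = 0"
    using CcD(2)[OF g] by blast
  have b0: "0 < b" using ab by simp
  note aT = ereal_less_trans[OF ab(2,3)]
  note mb = maps_inv[OF b0 ab(3)] and ma = maps_inv[OF ab(1) aT]
  have le: "\<theta>i a \<le> \<theta>i b"
    using theta_le_iff[OF ma mb] ab(2) inv2[OF ab(1) aT] inv2[OF b0 ab(3)] by auto
  have "wenergy p2 (pull g) = (LBINT x. (c * (p1 (\<theta> x) * (g (\<theta> x))\<^sup>2)) * \<theta>' x * indicator {\<theta>i a..\<theta>i b} x)"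
    unfolding wenergy_def
  proof (intro Bochner_Integration.integral_cong refl)
    fix x
    show "p2 x * (pull g x)\<^sup>2 = (c * (p1 (\<theta> x) * (g (\<theta> x))\<^sup>2)) * \<theta>' x * indicator {\<theta>i a..\<theta>i b} x"
    proof (cases "x \<in> {\<theta>i a..\<theta>i b}")
      case True
      note x = subinterval[OF ma(1) mb(2) True]
      have "p2 x * (pull g x)\<^sup>2 = (p2 x * \<theta>' x) * (g (\<theta> x))\<^sup>2 * \<theta>' x"
        using x by (simp add: pull_def power2_eq_square)
      then show ?thesis using True by (simp add: weights[OF x])
    next
      case False
      then show ?thesis using pull_support[OF ab False] by simp
    qed
  qed
  also have "\<dots> = (LBINT y. (c * (p1 y * (g y)\<^sup>2)) * indicator {\<theta> (\<theta>i a)..\<theta> (\<theta>i b)} y)"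
    by (rule integral_pull[symmetric, OF _ ma(1) le mb(2)]) (intro continuous_intros p1_cont CcD(1)[OF g])
  also have "\<dots> = (LBINT y. c * (p1 y * (g y)\<^sup>2))"
    using ab(4) by (intro Bochner_Integration.integral_cong refl) (auto simp: indicator_def inv2[OF ab(1) aT] inv2[OF b0 ab(3)])
  finally show ?thesis by (simp add: wenergy_def)
qed

text \<open>The exceptional set of radii is carried over by \<open>\<theta>i\<close>, and a
  differentiable map of the line sends null sets to null sets. The detour through
  \<open>lebesgue\<close> accommodates exceptional sets that are not Borel.\<close>

lemma AE_pull:
  assumes "AE y in lborel. 0 < y \<longrightarrow> ereal y < T \<longrightarrow> Q y"
  shows "AE s in lborel. 0 < s \<longrightarrow> ereal s < S \<longrightarrow> Q (\<theta> s)"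
proof -
  let ?Z = "{y. 0 < y \<and> ereal y < T \<and> \<not> Q y}"
  have "AE y in lebesgue. y \<notin> ?Z"
    using AE_completion[OF assms] by eventually_elim auto
  then have "negligible ?Z"
    by (simp only: negligible_iff_null_sets completion.null_sets_iff_AE) simp
  then have "negligible (\<theta>i ` ?Z)"
    using inv_differentiable
    by (intro negligible_differentiable_image_negligible)
       (auto simp: differentiable_on_def intro: differentiable_at_withinI)
  then have "AE s in lebesgue. s \<notin> \<theta>i ` ?Z"
    unfolding negligible_iff_null_sets by (rule AE_not_in)
  then have "AE s in lborel. s \<notin> \<theta>i ` ?Z"
    by (simp only: AE_completion_iff)
  then show ?thesis
  proof (eventually_elim, intro impI)
    fix s assume z: "s \<notin> \<theta>i ` ?Z" and s: "0 < s" "ereal s < S"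
    show "Q (\<theta> s)"
    proof (rule ccontr)
      assume "\<not> Q (\<theta> s)"
      then have "\<theta> s \<in> ?Z" using maps[OF s] by simp
      with inv1[OF s] z show False by (metis image_eqI)
    qed
  qed
qed

text \<open>Since \<open>pull\<close> respects differences and multiplies energies by
  \<open>c\<close>, Cauchy sequences go to Cauchy sequences; the primitives are merely composed with
  \<open>\<theta>\<close>.\<close>

lemma transfer_sequence:
  assumes g: "\<And>n. g n \<in> Cc T" and cauchy: "wcauchy p1 g" and c: "0 < c"
    and lim: "profile_limit T g V"
    and W: "\<And>s. 0 < s \<Longrightarrow> ereal s < S \<Longrightarrow> W s = V (\<theta> s)"
  shows "pull (g n) \<in> Cc S" and "wcauchy p2 (\<lambda>n. pull (g n))"
    and "profile_limit S (\<lambda>n. pull (g n)) W"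
proof -
  show "pull (g n) \<in> Cc S" by (rule pull_Cc[OF g])
  show "wcauchy p2 (\<lambda>n. pull (g n))"
    unfolding wcauchy_def
  proof (intro allI impI)
    fix e :: real assume "e > 0"
    then have "e / sqrt c > 0" using c by simp
    then obtain M where M: "\<And>m n. m \<ge> M \<Longrightarrow> n \<ge> M \<Longrightarrow> wdist p1 (g m) (g n) < e / sqrt c"
      using cauchy unfolding wcauchy_def by blast
    have "wdist p2 (pull (g m)) (pull (g n)) < e" if "m \<ge> M" "n \<ge> M" for m n
    proof -
      have "wenergy p2 (\<lambda>s. pull (g m) s - pull (g n) s) = c * wenergy p1 (\<lambda>s. g m s - g n s)"
        using wenergy_pull[OF Cc_diff[OF g g]] by (simp add: pull_diff)
      then show ?thesis using M[OF that] c by (simp add: real_sqrt_mult field_simps)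
    qed
    then show "\<exists>M. \<forall>m\<ge>M. \<forall>n\<ge>M. wdist p2 (pull (g m)) (pull (g n)) < e" by blast
  qed
  show "profile_limit S (\<lambda>n. pull (g n)) W"
    using AE_pull[OF lim] by eventually_elim (auto simp: tail_pull[OF g] W)
qed

end

section \<open>The two weights\<close>

text \<open>Meant for bounding \<open>s ^ (DIM('a) - 1) * sqrt (q s)\<close> near 0: the power of
  \<open>s\<close> already outweighs \<open>q s\<close> itself, so a crude estimate of the root is
  enough.\<close>

lemma sqrt_le_1_plus: "0 \<le> y \<Longrightarrow> sqrt y \<le> 1 + (y::real)"
  by (rule real_le_lsqrt) (auto simp: power2_eq_square algebra_simps)

lemma grad_const: "grad (\<lambda>x::'a::euclidean_space. c) = (\<lambda>x. 0)"
  by (rule ext, rule grad_eq, rule GDERIV_const)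

text \<open>The constant weight is its own smooth approximation. The last function is the integral
  of \<open>1 / s ^ (N - 1)\<close> from a given radius to infinity, with \<open>N\<close> the
  dimension; it is finite because \<open>N \<ge> 3\<close>.\<close>

lemma radial_weight_D12:
  assumes "DIM('a::euclidean_space) \<ge> 3"
  shows "radial_weight (\<lambda>_::'a. 1) UNIV (\<lambda>_ _. 1) \<infinity>
     (\<lambda>s. max s 0 ^ (DIM('a) - 1)) (\<lambda>s. 1 / (real (DIM('a) - 2) * s ^ (DIM('a) - 2)))"
proof -
  define n where "n = DIM('a) - 2"
  have n: "n \<ge> 1" "DIM('a) - 1 = n + 1" "DIM('a) - 2 = n" using assms by (auto simp: n_def)
  show ?thesis
    unfolding n(2,3)
  proof unfold_locales
    fix K :: "'a set" assume "compact K"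
    then show "integrable lborel (\<lambda>x. indicator K x * (1::real))"
      using borel_integrable_compact[of K "\<lambda>_. 1::real"] by simp
  next
    fix s :: real assume "s \<le> 0"
    then show "max s 0 ^ (n + 1) = 0" by (simp add: max_absorb2)
  next
    fix x :: 'a assume "x \<noteq> 0"
    show "1 * norm x ^ (DIM('a) - 1) = max (norm x) 0 ^ (n + 1)"
      unfolding n(2) by (simp add: max_def)
  next
    fix g :: "real \<Rightarrow> real" and r :: real
    assume g: "g \<in> Cc \<infinity>" and r: "0 < r" "ereal r < \<infinity>"
    show "(tail g r)\<^sup>2 \<le> 1 / (real n * r ^ n) * wenergy (\<lambda>s. max s 0 ^ (n + 1)) g"
    proof (rule tail_bound_antiderivative[OF g r, where P = "\<lambda>s. - (1 / (real n * s ^ n))"])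
      show "DERIV (\<lambda>s. - (1 / (real n * s ^ n))) s :> 1 / max s 0 ^ (n + 1)" if "0 < s" for s :: real
      proof -
        have "s ^ n = s ^ (n - Suc 0) * s" using n(1) by (metis Suc_pred' power_Suc2 One_nat_def less_eq_Suc_le)
        then show ?thesis using that n(1)
          by (auto intro!: derivative_eq_intros simp: max_def field_simps)
      qed
      show "- (1 / (real n * c ^ n)) - - (1 / (real n * r ^ n)) \<le> 1 / (real n * r ^ n)" if "r \<le> c" for c
        using r that by simp
    qed (auto intro!: continuous_intros)
  next
    fix b :: real assume b: "0 < b"
    have "s ^ (n + 1) * sqrt (1 / (real n * s ^ n)) \<le> b ^ (n + 1) + b" if s: "0 < s" "s \<le> b" for s
    proof -
      have "sqrt (1 / (real n * s ^ n)) \<le> 1 + 1 / (real n * s ^ n)"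
        using s by (intro sqrt_le_1_plus) simp
      also have "1 / (real n * s ^ n) \<le> 1 / s ^ n"
        using s n(1) by (intro divide_left_mono) (auto simp: mult_le_cancel_right1)
      finally have "s ^ (n + 1) * sqrt (1 / (real n * s ^ n)) \<le> s ^ (n + 1) * (1 + 1 / s ^ n)"
        using s by (intro mult_left_mono) auto
      also have "\<dots> = s ^ (n + 1) + s" using s by (simp add: field_simps)
      also have "\<dots> \<le> b ^ (n + 1) + b" using s by (intro add_mono power_mono) auto
      finally show ?thesis .
    qed
    then show "\<exists>C. \<forall>s\<in>{0<..b}. s ^ (DIM('a) - 1) * sqrt (1 / (real n * s ^ n)) \<le> C"
      unfolding n(2) by (intro exI[of _ "b ^ (n + 1) + b"]) auto
  qed (auto simp: grad_const intro!: continuous_intros)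
qed

lemma GDERIV_regularised_norm_powr:
  fixes x :: "'a::euclidean_space"
  assumes "e > 0"
  shows "GDERIV (\<lambda>x. (inner x x + e) powr a) x :> (a * (inner x x + e) powr (a - 1)) *\<^sub>R (2 *\<^sub>R x)"
proof -
  have pos: "inner x x + e > 0" using assms by (simp add: add_nonneg_pos)
  have "DERIV (\<lambda>s. s powr a) (inner x x + e) :> a * (inner x x + e) powr (a - 1)"
    using pos by (rule has_real_derivative_powr)
  moreover have "GDERIV (\<lambda>x. inner x x + e) x :> 2 *\<^sub>R x + 0"
    by (intro GDERIV_add GDERIV_const GDERIV_inner_self)
  ultimately show ?thesis using GDERIV_DERIV_compose[of "\<lambda>x. inner x x + e" x] by fastforce
qed

text \<open>The last function is the integral of \<open>1 / s\<close> from a given radius to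
  \<open>R\<close>. Adding \<open>1 / real (Suc k)\<close> under the power removes the singularity
  and gives approximations from below. At the origin \<open>singular_weight\<close> has the value 0
  by the convention for \<open>powr\<close>, below every approximation; hence the comparison of
  weights is asked for nonzero points only.\<close>

lemma radial_weight_W0:
  assumes "DIM('a::euclidean_space) \<ge> 3" and R: "R > 0"
  shows "radial_weight (singular_weight :: 'a \<Rightarrow> real) (ball 0 R)
     (\<lambda>k x. (inner x x + 1 / real (Suc k)) powr (- ((real DIM('a) - 2) / 2))) (ereal R)
     (\<lambda>s. max s 0) (\<lambda>s. ln (R / s))"
proof -
  define n where "n = DIM('a) - 2"
  have n: "n \<ge> 1" "DIM('a) - 1 = n + 1" "real DIM('a) - 2 = real n" using assms by (auto simp: n_def)
  have sw: "singular_weight x = norm x powr (- real n)" for x :: 'a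
    by (simp only: singular_weight_def n(3))
  have [measurable]: "(singular_weight :: 'a \<Rightarrow> real) \<in> borel_measurable borel"
    unfolding singular_weight_def by measurable
  have rad: "singular_weight x * norm x ^ (n + 1) = norm x" if "x \<noteq> 0" for x :: 'a
    using that by (simp add: sw powr_minus powr_realpow field_simps)
  have approx: "norm x powr (- real n) = (inner x x) powr (- (real n / 2))" for x :: 'a
    by (simp add: norm_eq_sqrt_inner powr_half_sqrt[symmetric] powr_powr)
  let ?w = "\<lambda>k (x::'a). (inner x x + 1 / real (Suc k)) powr (- (real n / 2))"
  show ?thesis
    unfolding n(3)
  proof unfold_locales
    fix K :: "'a set" assume K: "compact K"
    then obtain b where b: "b > 0" "\<And>x. x \<in> K \<Longrightarrow> norm x \<le> b"
      using compact_imp_bounded[OF K] unfolding bounded_pos by blast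
    have [measurable]: "K \<in> sets borel" using K by (simp add: borel_compact)
    show "integrable lborel (\<lambda>x. indicator K x * singular_weight x)"
    proof (rule integrableI_bounded)
      let ?A = "sphere_area TYPE('a)"
      have A: "?A > 0" by (rule sphere_area_pos)
      have "(\<integral>\<^sup>+x. ennreal (norm (indicator K x * singular_weight x)) \<partial>lborel) \<le>
          (\<integral>\<^sup>+x. indicator {..b} (norm x) * ennreal (norm x powr (- real n)) \<partial>(lborel :: 'a measure))"
        by (intro nn_integral_mono) (auto simp: indicator_def sw b)
      also have "\<dots> = (\<integral>\<^sup>+r. shell TYPE('a) r *
          (indicator {..b} r * ennreal (r powr (- real n))) \<partial>lborel)"
        by (rule nn_integral_radial) measurable
      also have "\<dots> \<le> (\<integral>\<^sup>+r. ennreal (?A * b) * indicator {0..b} r \<partial>lborel)"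
      proof (intro nn_integral_mono)
        fix r :: real
        show "shell TYPE('a) r *
          (indicator {..b} r * ennreal (r powr (- real n))) \<le> ennreal (?A * b) * indicator {0..b} r"
        proof (cases "r \<in> {0<..b}")
          case True
          have "r ^ (n + 1) * r powr (- real n) = r"
            using True by (simp add: powr_minus powr_realpow field_simps)
          then have "?A * r ^ (n + 1) * r powr (- real n) \<le> ?A * b"
            using True A by (simp add: mult.assoc)
          then show ?thesis
            using True A unfolding n(2) by (simp add: ennreal_mult'[symmetric] ennreal_leI del: power_Suc)
        qed (auto simp: indicator_def)
      qed
      also have "\<dots> < \<infinity>"
        using b(1) by (subst nn_integral_cmult_indicator) (auto simp: ennreal_mult_less_top)
      finally show "(\<integral>\<^sup>+x. ennreal (norm (indicator K x * singular_weight x)) \<partial>lborel) < \<infinity>" .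
    qed measurable
  next
    fix k and x :: 'a assume x: "x \<noteq> 0"
    show "?w k x \<le> singular_weight x"
      unfolding sw approx using x by (intro powr_mono2') auto
  next
    fix x :: 'a assume x: "x \<noteq> 0"
    have "(\<lambda>k. ?w k x) \<longlonglongrightarrow> (inner x x + 0) powr (- (real n / 2))"
      using x by (intro tendsto_intros LIMSEQ_Suc[OF lim_1_over_n]) auto
    then show "(\<lambda>k. ?w k x) \<longlonglongrightarrow> singular_weight x"
      by (simp add: sw approx)
  next
    fix k and x :: 'a
    show "(?w k) differentiable (at x)"
      by (rule gderiv_differentiable[OF GDERIV_regularised_norm_powr]) simp
  next
    fix i :: 'a and k
    have "grad (?w k) x =
      (- (real n / 2) * (inner x x + 1 / real (Suc k)) powr (- (real n / 2) - 1)) *\<^sub>R (2 *\<^sub>R x)" for x :: 'a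
      by (rule grad_eq[OF GDERIV_regularised_norm_powr]) simp
    moreover have "inner x x + 1 / real (Suc k) \<noteq> 0" for x :: 'a
      by (metis add_nonneg_pos inner_ge_zero less_irrefl of_nat_0_less_iff zero_less_Suc zero_less_divide_1_iff)
    ultimately show "continuous_on UNIV (\<lambda>x::'a. inner (grad (?w k) x) i)"
      by (simp del: of_nat_Suc, intro continuous_intros) (auto simp del: of_nat_Suc)
  next
    fix x :: 'a assume "x \<noteq> 0"
    from rad[OF this] show "singular_weight x * norm x ^ (DIM('a) - 1) = max (norm x) 0"
      unfolding n(2) by simp
  next
    fix s :: real assume "s \<le> 0"
    then show "max s 0 = 0" by (rule max_absorb2)
  next
    fix s assume "0 < s" "ereal s < ereal R"
    then show "0 \<le> ln (R / s)" by simp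
  next
    fix g :: "real \<Rightarrow> real" and r :: real
    assume g: "g \<in> Cc (ereal R)" and r: "0 < r" "ereal r < ereal R"
    show "(tail g r)\<^sup>2 \<le> ln (R / r) * wenergy (\<lambda>s. max s 0) g"
    proof (rule tail_bound_antiderivative[OF g r, where P = ln])
      show "DERIV ln s :> 1 / max s 0" if "0 < s" for s :: real
        using that by (auto intro!: derivative_eq_intros simp: max_def)
      show "ln c - ln r \<le> ln (R / r)" if "r \<le> c" "ereal c < ereal R" for c
        using that r R by (simp add: ln_div)
    qed (auto intro!: continuous_intros)
  next
    fix b :: real assume b: "0 < b" "ereal b < ereal R"
    have "s ^ (n + 1) * sqrt (ln (R / s)) \<le> b ^ (n + 1) + b ^ n * R" if s: "0 < s" "s \<le> b" for s
    proof -
      have "sqrt (ln (R / s)) \<le> 1 + ln (R / s)"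
        using s b by (intro sqrt_le_1_plus) simp
      also have "ln (R / s) \<le> R / s" using s R ln_le_minus_one[of "R / s"] by simp
      finally have "s ^ (n + 1) * sqrt (ln (R / s)) \<le> s ^ (n + 1) * (1 + R / s)"
        using s by (intro mult_left_mono) auto
      also have "\<dots> = s ^ (n + 1) + s ^ n * R" using s by (simp add: field_simps)
      also have "\<dots> \<le> b ^ (n + 1) + b ^ n * R" using s R by (intro add_mono power_mono mult_right_mono) auto
      finally show ?thesis .
    qed
    then show "\<exists>C. \<forall>s\<in>{0<..b}. s ^ (DIM('a) - 1) * sqrt (ln (R / s)) \<le> C"
      unfolding n(2) by (intro exI[of _ "b ^ (n + 1) + b ^ n * R"]) auto
  qed (use R in \<open>auto simp: singular_weight_def intro!: continuous_intros\<close>)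
qed

section \<open>The change of variable between the ball and the whole space\<close>

context
  fixes R :: real and n :: nat
  assumes R: "R > 0" and n: "n \<ge> 1"
begin

definition to_ball :: "real \<Rightarrow> real" where
  "to_ball t = R * exp (- (1 / t ^ n))"

definition to_space :: "real \<Rightarrow> real" where
  "to_space r = (- ln (r / R)) powr (- 1 / real n)"

lemma to_ball_bounds: "0 < t \<Longrightarrow> 0 < to_ball t" "0 < t \<Longrightarrow> to_ball t < R"
  using R by (auto simp: to_ball_def)

lemma to_space_pos: "0 < r \<Longrightarrow> r < R \<Longrightarrow> 0 < to_space r"
  by (simp add: to_space_def ln_less_zero_iff)

lemma to_space_to_ball:
  assumes "0 < t" shows "to_space (to_ball t) = t"
proof -
  have "- ln (to_ball t / R) = t powr (- real n)"
    using R assms by (simp add: to_ball_def powr_minus powr_realpow inverse_eq_divide)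
  then show ?thesis
    using assms n by (simp add: to_space_def powr_powr)
qed

lemma to_ball_to_space:
  assumes "0 < r" "r < R" shows "to_ball (to_space r) = r"
proof -
  have pos: "- ln (r / R) > 0" using assms R by (simp add: ln_less_zero_iff)
  have "to_space r ^ n = to_space r powr real n"
    using to_space_pos[OF assms] by (simp add: powr_realpow)
  also have "\<dots> = (- ln (r / R)) powr (- 1)"
    using n by (simp only: to_space_def powr_powr) simp
  also have "\<dots> = 1 / (- ln (r / R))"
    using pos powr_minus[of "- ln (r / R)" 1] by (simp add: inverse_eq_divide)
  finally show ?thesis using pos assms R by (simp add: to_ball_def exp_ln)
qed

lemma DERIV_to_ball:
  assumes "0 < t"
  shows "DERIV to_ball t :> to_ball t * real n / t ^ (n + 1)"
proof -
  have "t ^ n = t ^ (n - Suc 0) * t" using n by (metis Suc_pred' power_Suc2 One_nat_def less_eq_Suc_le)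
  then show ?thesis unfolding to_ball_def using assms
    by (auto intro!: derivative_eq_intros simp: field_simps power2_eq_square)
qed

text \<open>The reciprocal of the derivative of \<open>to_ball\<close> at \<open>to_space r\<close>;
  the inverse function rule avoids differentiating the power of the logarithm.\<close>

lemma DERIV_to_space:
  assumes "0 < r" "r < R"
  shows "DERIV to_space r :> to_space r ^ (n + 1) / (real n * r)"
proof -
  let ?t = "to_space r"
  have t: "?t > 0" by (rule to_space_pos[OF assms])
  have "DERIV to_space r :> inverse (to_ball ?t * real n / ?t ^ (n + 1))"
  proof (rule DERIV_inverse_function[where f = to_ball and a = 0 and b = R])
    show "DERIV to_ball ?t :> to_ball ?t * real n / ?t ^ (n + 1)" by (rule DERIV_to_ball[OF t])
    show "to_ball ?t * real n / ?t ^ (n + 1) \<noteq> 0" using t n to_ball_bounds(1)[OF t] by simp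
    show "isCont to_space r"
      unfolding to_space_def using assms R
      by (intro continuous_intros) (auto simp: ln_less_zero_iff)
  qed (use assms to_ball_to_space in auto)
  then show ?thesis by (simp add: to_ball_to_space[OF assms] mult.commute)
qed

text \<open>The derivative of \<open>to_ball\<close> has \<open>t ^ (n + 1)\<close> in its
  denominator, which cancels the weight of the whole space and leaves \<open>n\<close> times the
  weight of the ball. Profiles move from the ball to the space.\<close>

lemma change_to_space:
  "change_of_variable \<infinity> (ereal R) to_ball (\<lambda>t. to_ball t * real n / t ^ (n + 1)) to_space
     (\<lambda>s. max s 0) (\<lambda>s. max s 0 ^ (n + 1)) (real n)"
proof unfold_locales
  show "continuous_on {s. 0 < s \<and> ereal s < \<infinity>} (\<lambda>t. to_ball t * real n / t ^ (n + 1))"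
    unfolding to_ball_def by (intro continuous_intros) auto
  show "DERIV to_ball s :> to_ball s * real n / s ^ (n + 1)" if "0 < s" for s
    by (rule DERIV_to_ball[OF that])
  show "to_space differentiable (at y)" if "0 < y" "ereal y < ereal R" for y
    using DERIV_to_space[of y] that real_differentiable_def by auto
  show "max s 0 ^ (n + 1) * (to_ball s * real n / s ^ (n + 1)) = real n * max (to_ball s) 0"
    if "0 < s" for s using that to_ball_bounds(1)[OF that] by (simp add: max_def)
qed (use n in \<open>auto simp: to_ball_bounds to_space_pos to_space_to_ball to_ball_to_space DERIV_to_ball
       simp del: power_Suc intro!: continuous_intros divide_pos_pos mult_pos_pos\<close>)

text \<open>The same relation between the weights read for the inverse map, hence the reciprocal
  constant. Profiles move from the space to the ball.\<close>

lemma change_to_ball: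
  "change_of_variable (ereal R) \<infinity> to_space (\<lambda>r. to_space r ^ (n + 1) / (real n * r)) to_ball
     (\<lambda>s. max s 0 ^ (n + 1)) (\<lambda>s. max s 0) (1 / real n)"
proof unfold_locales
  show "continuous_on {s. 0 < s \<and> ereal s < ereal R} (\<lambda>r. to_space r ^ (n + 1) / (real n * r))"
    unfolding to_space_def using R n by (intro continuous_intros) (auto simp: ln_less_zero_iff)
  show "DERIV to_space s :> to_space s ^ (n + 1) / (real n * s)" if "0 < s" "ereal s < ereal R" for s
    using that by (intro DERIV_to_space) auto
  show "to_ball differentiable (at y)" if "0 < y" for y
    using DERIV_to_ball[OF that] real_differentiable_def by blast
  show "max s 0 * (to_space s ^ (n + 1) / (real n * s)) = 1 / real n * max (to_space s) 0 ^ (n + 1)"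
    if "0 < s" "ereal s < ereal R" for s
    using that to_space_pos[of s] by (simp add: max_def del: power_Suc)
qed (use n in \<open>auto simp: to_ball_bounds to_space_pos to_space_to_ball to_ball_to_space DERIV_to_space
       simp del: power_Suc intro!: continuous_intros divide_pos_pos mult_pos_pos\<close>)

end

section \<open>Transfer between the two completions\<close>

theorem lemma1p3:
  fixes R :: real and v w :: "real ^ 'n \<Rightarrow> real"
  assumes N: "CARD('n) \<ge> 3"
    and R: "R > 0"
    and v_radial: "radial_on (ball 0 R) v"
    and w_radial: "radial_on UNIV w"
    and v_w: "\<And>x y. x \<in> ball 0 R - {0} \<Longrightarrow>
        norm y = (- ln (norm x / R)) powr (- 1 / (real CARD('n) - 2)) \<Longrightarrow> v x = w y"
  shows "(v \<in> W0_rad R \<longleftrightarrow> w \<in> D12_rad) \<and>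
         (v \<in> W0_rad R \<longrightarrow>
            (W0_norm R v)\<^sup>2 = inverse (real CARD('n) - 2) * (D12_norm w)\<^sup>2)"
proof -
  let ?n = "CARD('n) - 2"
  have n: "?n \<ge> 1" "real CARD('n) - 2 = real ?n" "CARD('n) - 1 = ?n + 1" using N by auto
  have dim: "DIM(real ^ 'n) = CARD('n)" by simp
  interpret D: radial_weight "\<lambda>_::real ^ 'n. 1" UNIV "\<lambda>_ _. 1" \<infinity>
      "\<lambda>s. max s 0 ^ (?n + 1)" "\<lambda>s. 1 / (real ?n * s ^ ?n)"
    using radial_weight_D12[where 'a = "real ^ 'n"] N unfolding dim n(3) by simp
  interpret W: radial_weight "singular_weight :: real ^ 'n \<Rightarrow> real" "ball 0 R"
      "\<lambda>k x. (inner x x + 1 / real (Suc k)) powr (- ((real CARD('n) - 2) / 2))" "ereal R"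
      "\<lambda>s. max s 0" "\<lambda>s. ln (R / s)"
    using radial_weight_W0[where 'a = "real ^ 'n", OF _ R] N unfolding dim by blast
  interpret S: change_of_variable \<infinity> "ereal R" "to_ball R ?n" "\<lambda>t. to_ball R ?n t * real ?n / t ^ (?n + 1)"
      "to_space R ?n" "\<lambda>s. max s 0" "\<lambda>s. max s 0 ^ (?n + 1)" "real ?n"
    by (rule change_to_space[OF R n(1)])
  interpret B: change_of_variable "ereal R" \<infinity> "to_space R ?n" "\<lambda>r. to_space R ?n r ^ (?n + 1) / (real ?n * r)"
      "to_ball R ?n" "\<lambda>s. max s 0 ^ (?n + 1)" "\<lambda>s. max s 0" "1 / real ?n"
    by (rule change_to_ball[OF R n(1)])
  let ?A = "sphere_area TYPE(real ^ 'n)"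
  \<comment> \<open>A fixed unit vector samples the radial functions along a ray and gives their
    profiles \<open>V\<close> and \<open>U\<close>.\<close>
  obtain e :: "real ^ 'n" where e: "norm e = 1"
    using norm_Basis SOME_Basis by blast
  define V where "V r = v (r *\<^sub>R e)" for r
  define U where "U t = w (t *\<^sub>R e)" for t
  have vV: "v x = V (norm x)" if "x \<in> ball 0 R" for x
    using v_radial that e unfolding radial_on_def V_def by (metis abs_norm_cancel mem_ball_0 mult.right_neutral norm_scaleR)
  have wU: "w x = U (norm x)" for x
    using w_radial e unfolding radial_on_def U_def by (metis UNIV_I abs_norm_cancel mult.right_neutral norm_scaleR)
  have VU: "V r = U (to_space R ?n r)" if "0 < r" "ereal r < ereal R" for r
    unfolding V_def U_def
  proof (rule v_w)
    show "r *\<^sub>R e \<in> ball 0 R - {0}" using that e by auto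
    show "norm (to_space R ?n r *\<^sub>R e) = (- ln (norm (r *\<^sub>R e) / R)) powr (- 1 / (real CARD('n) - 2))"
      using that e to_space_pos[OF R n(1), of r] unfolding n(2) by (simp add: to_space_def[OF R n(1)])
  qed
  have UV: "U t = V (to_ball R ?n t)" if "0 < t" "ereal t < \<infinity>" for t
    using VU[of "to_ball R ?n t"] to_ball_bounds[OF R n(1) that(1)] to_space_to_ball[OF R n(1) that(1)] by simp
  have v_rad: "v \<in> W0_rad R \<longleftrightarrow> v \<in> completion_space singular_weight (ball 0 R)"
    using v_radial by (simp add: W0_rad_def W0_def)
  have w_rad: "w \<in> D12_rad \<longleftrightarrow> w \<in> completion_space (\<lambda>_. 1) UNIV"
    using w_radial by (simp add: D12_rad_def D12_def)
  \<comment> \<open>The norm identity is obtained in this direction, where \<open>v\<close> is known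
    to lie in its space and the transported profiles compute the norm of \<open>w\<close>.\<close>
  have vw: "w \<in> D12_rad \<and> (W0_norm R v)\<^sup>2 = inverse (real CARD('n) - 2) * (D12_norm w)\<^sup>2"
    if "v \<in> W0_rad R"
  proof -
    from that obtain \<phi> where rep: "represents singular_weight (ball 0 R) \<phi> v"
      unfolding v_rad completion_space_def by blast
    have "\<exists>g. (\<forall>m. g m \<in> Cc (ereal R)) \<and> wcauchy (\<lambda>s. max s 0) g \<and>
      profile_limit (ereal R) g V"
      by (rule W.radial_representation[OF rep, where U = V]) (use vV in blast)+
    then obtain g where g: "\<And>m. g m \<in> Cc (ereal R)" "wcauchy (\<lambda>s. max s 0) g" "profile_limit (ereal R) g V"
      by blast
    obtain l where l: "(\<lambda>m. sqrt (wenergy (\<lambda>s. max s 0) (g m))) \<longlonglongrightarrow> l"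
      using W.wcauchy_energy_convergent[OF g(1,2)] by blast
    have nv: "W0_norm R v = sqrt ?A * l"
      unfolding W0_norm_def by (rule W.represents_radial(2)[OF g vV l])
    have n0: "0 < real ?n" using n(1) by simp
    note h = S.transfer_sequence[OF g(1,2) n0 g(3) UV]
    \<comment> \<open>Transport multiplies each energy by \<open>?n\<close>, hence the limiting norm
      by its square root; the factor \<open>sqrt ?A\<close> is the same for both spaces.\<close>
    have "(\<lambda>m. sqrt (wenergy (\<lambda>s. max s 0 ^ (?n + 1)) (S.pull (g m)))) \<longlonglongrightarrow> sqrt (real ?n) * l"
      unfolding S.wenergy_pull[OF g(1)] real_sqrt_mult by (intro tendsto_intros l)
    note D = D.represents_radial[OF h(1-3) wU this]
    show ?thesis
      using D n0 unfolding w_rad nv D12_norm_def n(2) by (simp add: power_mult_distrib)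
  qed
  have wv: "v \<in> W0_rad R" if "w \<in> D12_rad"
  proof -
    from that obtain \<phi> where rep: "represents (\<lambda>_. 1) UNIV \<phi> w"
      unfolding w_rad completion_space_def by blast
    have "\<exists>g. (\<forall>m. g m \<in> Cc \<infinity>) \<and> wcauchy (\<lambda>s. max s 0 ^ (?n + 1)) g \<and>
      profile_limit \<infinity> g U"
      by (rule D.radial_representation[OF rep, where U = U]) (use wU in blast)+
    then obtain g where g: "\<And>m. g m \<in> Cc \<infinity>" "wcauchy (\<lambda>s. max s 0 ^ (?n + 1)) g"
      "profile_limit \<infinity> g U"
      by blast
    obtain l where l: "(\<lambda>m. sqrt (wenergy (\<lambda>s. max s 0 ^ (?n + 1)) (g m))) \<longlonglongrightarrow> l"
      using D.wcauchy_energy_convergent[OF g(1,2)] by blast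
    have n0: "0 < 1 / real ?n" using n(1) by simp
    note h = B.transfer_sequence[OF g(1,2) n0 g(3) VU]
    have "(\<lambda>m. sqrt (wenergy (\<lambda>s. max s 0) (B.pull (g m)))) \<longlonglongrightarrow> sqrt (1 / real ?n) * l"
      unfolding B.wenergy_pull[OF g(1)] real_sqrt_mult by (intro tendsto_intros l)
    from W.represents_radial(1)[OF h(1-3) vV this] show ?thesis
      by (simp only: v_rad)
  qed
  show ?thesis using vw wv by blast
qed

end
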